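(* Let $C$ be a $C^{*}$-algebra, $A\subseteq C$ a closed two-sided ideal with quotient map $\rho:C\to D=C/A$, and $C'\subseteq C$ a $C^{*}$-subalgebra with $\rho(C')=D$; let $A'=A\cap C'$, so that the rows $0\to A\to C\to D\to 0$ and $0\to A'\to C'\to D\to 0$ are exact and form a commutative diagram with the inclusions $A'\subseteq A$, $C'\subseteq C$ and the identity on $D$. Then the map $\pi_{*}:K_{0}(A';A)\to K_{0}(C';C)$ induced by the inclusion $\pi:A\to C$ is an isomorphism.
   Context: For a $C^{*}$-algebra $D$, $\widetilde{D}$ is its unitization (a unit adjoined even if $D$ is unital), $\mathcal{M}(D)=\bigcup_n M_n(D)$ under $x\mapsto x\oplus 0$. For a $C^{*}$-subalgebra $A'\subseteq A$, $\Gamma(A';A)$ is the set of triples $(p,q,a)$ with $p,q$ projections in $\mathcal{M}(\widetilde{A'})$ and $a\in q\mathcal{M}(\widetilde{A})p$ invertible as a morphism from $p$ to $q$ (there is $b\in p\mathcal{M}(\widetilde A)q$ with $ab=q$, $ba=p$). Triples $(p,q,a),(p',q',a')$ are isomorphic if there are invertible morphisms $c:p\to p'$, $d:q\to q'$ with entries in $\mathcal{M}(\widetilde{A'})$ such that $da=a'c$. A triple $(p,p,a)$ is elementary if $a$ is homotopic to $p$ through invertibles of $p\mathcal{M}(\widetilde A)p$. Two triples are equivalent if they become isomorphic after adding (via direct sum $(p,q,a)\oplus(p',q',a')=(p\oplus p',q\oplus q',a\oplus a')$) an elementary triple to each. $K_{0}(A';A)$ is the abelian group of equivalence classes $[p,q,a]$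 under direct sum. A $*$-homomorphism $\pi:A\to C$ with $\pi(A')\subseteq C'$ induces $\pi_{*}[p,q,a]=[\pi(p),\pi(q),\pi(a)]$ (extending $\pi$ unitally to unitizations and entrywise to matrices). *)

theory Defs
  imports "HOL-Analysis.Analysis" "HOL-Algebra.Group"
begin

class cstar_algebra = banach + real_normed_algebra +
  fixes scaleC :: "complex \<Rightarrow> 'a \<Rightarrow> 'a"
    and adj :: "'a \<Rightarrow> 'a"
  assumes scaleC_of_real: "scaleC (of_real r) x = scaleR r x"
    and scaleC_add_left: "scaleC (a + b) x = scaleC a x + scaleC b x"
    and scaleC_add_right: "scaleC a (x + y) = scaleC a x + scaleC a y"
    and scaleC_scaleC: "scaleC a (scaleC b x) = scaleC (a * b) x"
    and scaleC_one: "scaleC 1 x = x"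
    and scaleC_mult_left: "scaleC a (x * y) = scaleC a x * y"
    and scaleC_mult_right: "scaleC a (x * y) = x * scaleC a y"
    and norm_scaleC: "norm (scaleC a x) = cmod a * norm x"
    and adj_adj: "adj (adj x) = x"
    and adj_add: "adj (x + y) = adj x + adj y"
    and adj_scaleC: "adj (scaleC a x) = scaleC (cnj a) (adj x)"
    and adj_mult: "adj (x * y) = adj y * adj x"
    and cstar_identity: "norm (adj x * x) = (norm x)\<^sup>2"

definition complex_subspace :: "'a::cstar_algebra set \<Rightarrow> bool" where
  "complex_subspace S \<longleftrightarrow> 0 \<in> S \<and> (\<forall>x\<in>S. \<forall>y\<in>S. x + y \<in> S) \<and> (\<forall>c. \<forall>x\<in>S. scaleC c x \<in> S)"

definition closed_ideal :: "'a::cstar_algebra set \<Rightarrow> bool" where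
  "closed_ideal A \<longleftrightarrow> closed A \<and> complex_subspace A \<and>
     (\<forall>x. \<forall>a\<in>A. x * a \<in> A \<and> a * x \<in> A)"

definition cstar_subalgebra :: "'a::cstar_algebra set \<Rightarrow> bool" where
  "cstar_subalgebra B \<longleftrightarrow> closed B \<and> complex_subspace B \<and>
     (\<forall>x\<in>B. \<forall>y\<in>B. x * y \<in> B) \<and> (\<forall>x\<in>B. adj x \<in> B)"

definition star_hom :: "('a::cstar_algebra \<Rightarrow> 'b::cstar_algebra) \<Rightarrow> bool" where
  "star_hom f \<longleftrightarrow> (\<forall>x y. f (x + y) = f x + f y) \<and> (\<forall>c x. f (scaleC c x) = scaleC c (f x))
     \<and> (\<forall>x y. f (x * y) = f x * f y) \<and> (\<forall>x. f (adj x) = adj (f x))"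

section \<open>Unitization: pairs (lambda, a) standing for lambda*1 + a\<close>

type_synonym 'a unit_elt = "complex \<times> 'a"

definition umult :: "'a::cstar_algebra unit_elt \<Rightarrow> 'a unit_elt \<Rightarrow> 'a unit_elt" where
  "umult x y = (fst x * fst y, scaleC (fst x) (snd y) + scaleC (fst y) (snd x) + snd x * snd y)"

definition uadj :: "'a::cstar_algebra unit_elt \<Rightarrow> 'a unit_elt" where
  "uadj x = (cnj (fst x), adj (snd x))"

section \<open>M(D~) = union of M_n(D~), as finitely supported infinite matrices\<close>

type_synonym 'a umat = "nat \<Rightarrow> nat \<Rightarrow> 'a unit_elt"

definition supp_in :: "nat \<Rightarrow> 'a::cstar_algebra umat \<Rightarrow> bool" where
  "supp_in N x \<longleftrightarrow> (\<forall>i j. N \<le> i \<or> N \<le> j \<longrightarrow> x i j = 0)"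

definition fin_supp :: "'a::cstar_algebra umat \<Rightarrow> bool" where
  "fin_supp x \<longleftrightarrow> (\<exists>N. supp_in N x)"

definition mbound :: "'a::cstar_algebra umat \<Rightarrow> nat" where
  "mbound x = (LEAST N. supp_in N x)"

definition mmult :: "'a::cstar_algebra umat \<Rightarrow> 'a umat \<Rightarrow> 'a umat" where
  "mmult x y = (\<lambda>i j. \<Sum>k<max (mbound x) (mbound y). umult (x i k) (y k j))"

definition madj :: "'a::cstar_algebra umat \<Rightarrow> 'a umat" where
  "madj x = (\<lambda>i j. uadj (x j i))"

definition mat_in :: "'a::cstar_algebra set \<Rightarrow> 'a umat \<Rightarrow> bool" where
  "mat_in B x \<longleftrightarrow> fin_supp x \<and> (\<forall>i j. snd (x i j) \<in> B)"

definition is_proj :: "'a::cstar_algebra set \<Rightarrow> 'a umat \<Rightarrow> bool" where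
  "is_proj B p \<longleftrightarrow> mat_in B p \<and> madj p = p \<and> mmult p p = p"

definition morph :: "'a::cstar_algebra set \<Rightarrow> 'a umat \<Rightarrow> 'a umat \<Rightarrow> 'a umat \<Rightarrow> bool" where
  "morph B p q a \<longleftrightarrow> mat_in B a \<and> mmult q (mmult a p) = a"

definition inv_morph :: "'a::cstar_algebra set \<Rightarrow> 'a umat \<Rightarrow> 'a umat \<Rightarrow> 'a umat \<Rightarrow> bool" where
  "inv_morph B p q a \<longleftrightarrow> morph B p q a \<and>
     (\<exists>b. morph B q p b \<and> mmult a b = q \<and> mmult b a = p)"

type_synonym 'a triple = "'a umat \<times> 'a umat \<times> 'a umat"

definition Gamma :: "'a::cstar_algebra set \<Rightarrow> 'a set \<Rightarrow> 'a triple set" where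
  "Gamma A' A = {(p, q, a). is_proj A' p \<and> is_proj A' q \<and> inv_morph A p q a}"

definition iso_triple :: "'a::cstar_algebra set \<Rightarrow> 'a triple \<Rightarrow> 'a triple \<Rightarrow> bool" where
  "iso_triple A' t t' \<longleftrightarrow> (case t of (p, q, a) \<Rightarrow> case t' of (p', q', a') \<Rightarrow>
     (\<exists>c d. inv_morph A' p p' c \<and> inv_morph A' q q' d \<and> mmult d a = mmult a' c))"

text \<open>Homotopy through invertibles of p M(A~) p; topology on M_n(A~) = entrywise
  (product) topology on complex x A, equivalent to the C*-norm topology.\<close>
definition elementary :: "'a::cstar_algebra set \<Rightarrow> 'a triple \<Rightarrow> bool" where
  "elementary A t \<longleftrightarrow> (case t of (p, q, a) \<Rightarrow> p = q \<and>
     (\<exists>h :: real \<Rightarrow> 'a umat. (\<forall>i j. continuous_on {0..1} (\<lambda>s. h s i j)) \<and>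
        h 0 = a \<and> h 1 = p \<and> (\<forall>s\<in>{0..1}. inv_morph A p p (h s))))"

definition dsum_mat :: "nat \<Rightarrow> 'a::cstar_algebra umat \<Rightarrow> 'a umat \<Rightarrow> 'a umat" where
  "dsum_mat N x y = (\<lambda>i j. if i < N \<and> j < N then x i j
      else if N \<le> i \<and> N \<le> j then y (i - N) (j - N) else 0)"

definition tbound :: "'a::cstar_algebra triple \<Rightarrow> nat" where
  "tbound t = (case t of (p, q, a) \<Rightarrow> (LEAST N. supp_in N p \<and> supp_in N q \<and> supp_in N a))"

definition tsum :: "'a::cstar_algebra triple \<Rightarrow> 'a triple \<Rightarrow> 'a triple" where
  "tsum t t' = (case t of (p, q, a) \<Rightarrow> case t' of (p', q', a') \<Rightarrow>
     (dsum_mat (tbound t) p p', dsum_mat (tbound t) q q', dsum_mat (tbound t) a a'))"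

definition K0rel :: "'a::cstar_algebra set \<Rightarrow> 'a set \<Rightarrow> ('a triple \<times> 'a triple) set" where
  "K0rel A' A = {(x, y). x \<in> Gamma A' A \<and> y \<in> Gamma A' A \<and>
     (\<exists>e e'. e \<in> Gamma A' A \<and> e' \<in> Gamma A' A \<and> elementary A e \<and> elementary A e' \<and>
        iso_triple A' (tsum x e) (tsum y e'))}"

definition zero_triple :: "'a::cstar_algebra triple" where
  "zero_triple = ((\<lambda>i j. 0), (\<lambda>i j. 0), (\<lambda>i j. 0))"

definition K0 :: "'a::cstar_algebra set \<Rightarrow> 'a set \<Rightarrow> 'a triple set monoid" where
  "K0 A' A = \<lparr>carrier = Gamma A' A // K0rel A' A,
     monoid.mult = (\<lambda>X Y. K0rel A' A `` {tsum (SOME x. x \<in> X) (SOME y. y \<in> Y)}),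
     one = K0rel A' A `` {zero_triple}\<rparr>"

text \<open>Induced map of an inclusion (A',A) into (C',C): unital extension to unitizations and
  entrywise extension to matrices is the identity on representatives.\<close>
definition incl_star :: "'a::cstar_algebra set \<Rightarrow> 'a set \<Rightarrow> 'a triple set \<Rightarrow> 'a triple set" where
  "incl_star C' C X = K0rel C' C `` {SOME x. x \<in> X}"

end

theory Submission
  imports Defs
begin

text \<open>All matrices are computed in a ring \<open>M(C~)\<close>, and everything happens modulo the ideal \<open>M(A)\<close>.

  Surjectivity: after adding an elementary triple, \<open>q\<close> is a scalar projection \<open>f\<close> orthogonal
  to \<open>p\<close>. Lift \<open>a\<close> and \<open>b = a\<^sup>-\<^sup>1\<close> modulo \<open>A\<close> to \<open>a'\<close> and \<open>b'\<close> over \<open>C'\<close>. The product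
  \<open>W = (1 + a') (1 - b') (1 + a')\<close> is invertible over \<open>C'\<close> and congruent to \<open>a' - b'\<close> modulo
  \<open>A\<close>, so \<open>W p W\<^sup>-\<^sup>1\<close> is an idempotent congruent to \<open>f\<close>, that is, over \<open>A'\<close>. It is similar
  over \<open>A'\<close> to a projection, and transporting \<open>a\<close> along this similarity gives a triple in
  \<open>\<Gamma>(A'; A)\<close>.

  Injectivity: since \<open>(q, p, a\<^sup>-\<^sup>1)\<close> represents the negative of \<open>(p, q, a)\<close>, it suffices to treat a
  triple that is trivial for \<open>(C'; C)\<close>. After adding a scalar elementary triple there is an
  invertible \<open>g : q \<rightarrow> p\<close> over \<open>C'\<close> with \<open>g a\<close> homotopic to \<open>p\<close> over \<open>C\<close>. By the open mapping
  theorem \<open>g a = l \<pi>\<close> with \<open>l\<close> over \<open>C'\<close> and \<open>\<pi>\<close> homotopic to \<open>p\<close> through invertibles congruent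
  to \<open>p\<close> modulo \<open>A\<close>; then \<open>l\<^sup>-\<^sup>1 g\<close> is over \<open>A'\<close> and identifies the triple with \<open>(p, p, \<pi>)\<close>.

  The replacement of idempotents by projections needs \<open>1 + x\<^sup>* x\<close> to be invertible for matrices
  over a \<open>C\<^sup>*\<close>-algebra. This is reduced to positivity of \<open>x\<^sup>* x\<close> in the unitization, which is
  proved without spectral theory.\<close>

text \<open>The obstacle is that invertibility is lost in lifting from C / A to C'. For
  surjectivity, source and target are placed orthogonally: the factors of \<open>W\<close> are then
  unipotent, hence invertible whatever the lifts are, and if the lifts are inverse to each other
  modulo A, the product is a rotation exchanging the two projections. The target has to be scalar
  because the descent rests on one remark: a matrix congruent modulo A to one over the unitization
  of A is itself over that unitization. For injectivity, lifting is done only near the identity,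
  where the Neumann series inverts the lift. The open mapping theorem supplies small lifts, and
  since the products \<open>l * \<pi>\<close> form a group, connectedness carries the factorization
  along the whole path. The scalar summand completes the projection of a stabilizing triple, which
  is only over C', to one over A'. Matrices carry the sum of the norms of their entries, which
  violates the C*-identity; this is why positivity is established for single entries and matrices
  are inverted row by row.\<close>

section \<open>Identities for scalars, adjoint and norm\<close>

lemma scaleC_zero_right [simp]: "scaleC c (0::'a::cstar_algebra) = 0"
  using scaleC_add_right[of c "0::'a" 0] by simp

lemma scaleC_zero_left [simp]: "scaleC 0 (x::'a::cstar_algebra) = 0"
  using scaleC_add_left[of 0 0 x] by simp

lemma scaleC_minus_right: "scaleC c (- x) = - scaleC c (x::'a::cstar_algebra)"
  using scaleC_add_right[of c x "- x"] by (simp add: eq_neg_iff_add_eq_0 add.commute)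

lemma scaleC_minus_left: "scaleC (- c) x = - scaleC c (x::'a::cstar_algebra)"
  using scaleC_add_left[of c "- c" x] by (simp add: eq_neg_iff_add_eq_0 add.commute)

lemma scaleC_diff_right: "scaleC c (x - y) = scaleC c x - scaleC c (y::'a::cstar_algebra)"
  using scaleC_add_right[of c x "- y"] by (simp add: scaleC_minus_right)

lemma adj_zero [simp]: "adj (0::'a::cstar_algebra) = 0"
  using adj_add[of "0::'a" 0] by simp

lemma adj_minus: "adj (- x) = - adj (x::'a::cstar_algebra)"
  using adj_add[of x "- x"] by (simp add: eq_neg_iff_add_eq_0 add.commute)

lemma adj_diff: "adj (x - y) = adj x - adj (y::'a::cstar_algebra)"
  using adj_add[of x "- y"] by (simp add: adj_minus)

lemma adj_sum: "adj (\<Sum>i\<in>I. f i) = (\<Sum>i\<in>I. adj (f i :: 'a::cstar_algebra))"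
  by (induction I rule: infinite_finite_induct) (auto simp: adj_add)

lemma adj_scaleR: "adj (scaleR r x) = scaleR r (adj (x::'a::cstar_algebra))"
  using adj_scaleC[of "of_real r" x] by (simp add: scaleC_of_real)

lemma norm_adj [simp]: "norm (adj x) = norm (x::'a::cstar_algebra)"
proof -
  have le: "norm y \<le> norm (adj y)" for y :: 'a
  proof (cases "y = 0")
    case False
    have "norm y * norm y \<le> norm (adj y) * norm y"
      using norm_mult_ineq[of "adj y" y] cstar_identity[of y] by (simp add: power2_eq_square)
    with False show ?thesis by (simp add: mult_le_cancel_right)
  qed simp
  show ?thesis using le[of x] le[of "adj x"] by (simp add: adj_adj)
qed

lemma bounded_linear_adj: "bounded_linear (adj :: 'a::cstar_algebra \<Rightarrow> 'a)"
  by (rule bounded_linear_intro[where K = 1]) (auto simp: adj_add adj_scaleR)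

section \<open>The unitization as a unital \<open>C\<^sup>*\<close>-algebra\<close>

text \<open>A type of its own, since pairs already carry the Euclidean product norm, for which the
  C*-identity fails.\<close>

datatype 'a unitz = Unitz (scal: complex) (vect: 'a)

text \<open>The left regular representation of the unitization on the algebra; its operator norm is
  the source of the C*-identity there.\<close>

definition lact :: "'a::cstar_algebra unitz \<Rightarrow> 'a \<Rightarrow> 'a" where
  "lact u y = scaleC (scal u) y + vect u * y"

lemma bounded_linear_lact: "bounded_linear (lact u)"
proof (rule bounded_linear_intro)
  fix x y :: 'a and r :: real
  show "lact u (x + y) = lact u x + lact u y"
    by (simp add: lact_def scaleC_add_right distrib_left)
  have "scaleC (scal u) (scaleR r x) = scaleR r (scaleC (scal u) x)"
    by (metis scaleC_of_real scaleC_scaleC mult.commute)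
  then show "lact u (scaleR r x) = scaleR r (lact u x)"
    by (simp add: lact_def scaleR_add_right)
  show "norm (lact u x) \<le> norm x * (cmod (scal u) + norm (vect u))"
    unfolding lact_def
    by (rule order_trans[OF norm_triangle_ineq])
      (use norm_mult_ineq[of "vect u" x] in \<open>simp add: norm_scaleC algebra_simps\<close>)
qed

lemma norm_lact_le: "norm (lact u x) \<le> onorm (lact u) * norm x"
  by (rule onorm[OF bounded_linear_lact])

text \<open>By the C*-identity the operator norm is attained at \<open>adj a\<close>.\<close>

lemma onorm_lact_vect: "onorm (lact (Unitz 0 a)) = norm a"
proof (rule antisym)
  show "onorm (lact (Unitz 0 a)) \<le> norm a"
    by (rule onorm_bound) (auto simp: lact_def norm_mult_ineq)
  show "norm a \<le> onorm (lact (Unitz 0 a))"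
  proof (cases "a = 0")
    case False
    have "norm a * norm a = norm (a * adj a)"
      using cstar_identity[of "adj a"] by (simp add: adj_adj power2_eq_square)
    also have "\<dots> \<le> onorm (lact (Unitz 0 a)) * norm a"
      using norm_lact_le[of "Unitz 0 a" "adj a"] by (simp add: lact_def)
    finally show ?thesis using False by (simp add: mult_le_cancel_right)
  qed (simp add: onorm_pos_le bounded_linear_lact)
qed

instantiation unitz :: (cstar_algebra) real_normed_algebra_1
begin

definition "0 = Unitz 0 0"
definition "1 = Unitz 1 0"
definition "x + y = Unitz (scal x + scal y) (vect x + vect y)"
definition "x - y = Unitz (scal x - scal y) (vect x - vect y)"
definition "- x = Unitz (- scal x) (- vect x)"
definition "x * y = Unitz (scal x * scal y)
  (scaleC (scal x) (vect y) + scaleC (scal y) (vect x) + vect x * vect y)"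
definition "scaleR r x = Unitz (scaleR r (scal x)) (scaleR r (vect x))"
text \<open>If the algebra has a unit \<open>e\<close>, then \<open>Unitz 1 (- e)\<close> acts as
  zero, so the operator norm alone would only be a seminorm. The maximum with the absolute value of
  the character \<open>scal\<close> separates such elements and preserves the C*-identity.\<close>

definition "norm x = max (cmod (scal x)) (onorm (lact x))"
definition "sgn (x :: 'a unitz) = scaleR (inverse (norm x)) x"
definition "dist x (y :: 'a unitz) = norm (x - y)"
definition [code del]: "(uniformity :: ('a unitz \<times> 'a unitz) filter) =
  (INF e\<in>{0 <..}. principal {(x, y). dist x y < e})"
definition [code del]: "open (U :: 'a unitz set) \<longleftrightarrow>
  (\<forall>x\<in>U. eventually (\<lambda>(x', y). x' = x \<longrightarrow> y \<in> U) uniformity)"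

lemmas unitz_ops = zero_unitz_def one_unitz_def plus_unitz_def minus_unitz_def uminus_unitz_def
  times_unitz_def scaleR_unitz_def

lemma unitz_scal_vect [simp]:
  "scal (0 :: 'a unitz) = 0" "vect (0 :: 'a unitz) = 0"
  "scal (1 :: 'a unitz) = 1" "vect (1 :: 'a unitz) = 0"
  "scal (x + y) = scal x + scal y" "vect (x + y) = vect x + vect (y :: 'a unitz)"
  "scal (x - y) = scal x - scal y" "vect (x - y) = vect x - vect (y :: 'a unitz)"
  "scal (- x) = - scal x" "vect (- x) = - vect (x :: 'a unitz)"
  "scal (x * y) = scal x * scal y"
  "vect (x * y) = scaleC (scal x) (vect y) + scaleC (scal y) (vect x) + vect x * vect y"
  "scal (scaleR r x) = scaleR r (scal x)" "vect (scaleR r x) = scaleR r (vect x)"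
  by (simp_all add: unitz_ops)

lemma lact_mult: "lact (u * v) = lact u \<circ> lact v"
  by (rule ext) (simp add: lact_def scaleC_add_left scaleC_add_right scaleC_scaleC
      scaleC_mult_left scaleC_mult_right algebra_simps flip: scaleC_mult_left scaleC_mult_right)

lemma lact_add: "lact (u + v) = (\<lambda>x. lact u x + lact v x)"
  by (rule ext) (simp add: lact_def scaleC_add_left algebra_simps)

lemma lact_scaleR: "lact (scaleR r u) = (\<lambda>x. scaleR r (lact u x))"
  by (rule ext) (simp add: lact_def scaleR_add_right scaleR_conv_of_real scaleC_of_real
      flip: scaleC_scaleC)

lemma norm_lact: "norm (lact u x) \<le> norm u * norm x"
  by (rule order_trans[OF norm_lact_le]) (auto simp: norm_unitz_def intro: mult_right_mono)

text \<open>The constant 2 comes from writing \<open>vect u\<close> as \<open>u\<close> minus its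
  scalar part. With the next two estimates, the norm topology is the product topology of scalar and
  vector part, as used in \<open>elementary\<close>, and completeness is inherited.\<close>

lemma norm_vect_le: "norm (vect u) \<le> 2 * norm (u :: 'a unitz)"
proof -
  have "norm (vect u) = onorm (lact (Unitz 0 (vect u)))" by (simp add: onorm_lact_vect)
  also have "\<dots> \<le> norm u + cmod (scal u)"
  proof (rule onorm_bound)
    fix x
    have "lact (Unitz 0 (vect u)) x = lact u x - scaleC (scal u) x" by (simp add: lact_def)
    then have "norm (lact (Unitz 0 (vect u)) x) \<le> norm (lact u x) + norm (scaleC (scal u) x)"
      by (simp add: norm_triangle_ineq4)
    also have "\<dots> \<le> (norm u + cmod (scal u)) * norm x"
      using norm_lact[of u x] by (simp add: norm_scaleC algebra_simps)
    finally show "norm (lact (Unitz 0 (vect u)) x) \<le> (norm u + cmod (scal u)) * norm x" .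
  qed (simp add: norm_unitz_def le_max_iff_disj add_nonneg_nonneg)
  also have "\<dots> \<le> 2 * norm u" by (simp add: norm_unitz_def)
  finally show ?thesis .
qed

lemma norm_scal_le: "cmod (scal u) \<le> norm (u :: 'a unitz)"
  by (simp add: norm_unitz_def)

lemma norm_unitz_le: "norm u \<le> cmod (scal u) + norm (vect (u :: 'a unitz))"
proof -
  have "onorm (lact u) \<le> cmod (scal u) + norm (vect u)"
  proof (rule onorm_bound)
    fix x
    have "norm (lact u x) \<le> norm (scaleC (scal u) x) + norm (vect u * x)"
      unfolding lact_def by (rule norm_triangle_ineq)
    also have "\<dots> \<le> (cmod (scal u) + norm (vect u)) * norm x"
      using norm_mult_ineq[of "vect u" x] by (simp add: norm_scaleC algebra_simps)
    finally show "norm (lact u x) \<le> (cmod (scal u) + norm (vect u)) * norm x" .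
  qed simp
  then show ?thesis by (simp add: norm_unitz_def)
qed

instance
proof
  fix x y z :: "'a unitz" and r s :: real and a b :: complex
  show "(0 :: 'a unitz) \<noteq> 1" by (simp add: unitz_ops)
  show "x + y + z = x + (y + z)" "x + y = y + x" "0 + x = x" "- x + x = 0" "x - y = x + - y"
    "1 * x = x" "x * 1 = x" "(x + y) * z = x * z + y * z" "x * (y + z) = x * y + x * z"
    "scaleR r (x + y) = scaleR r x + scaleR r y" "scaleR (r + s) x = scaleR r x + scaleR s x"
    "scaleR r (scaleR s x) = scaleR (r * s) x" "scaleR 1 x = x"
    by (rule unitz.expand; simp add: scaleC_one scaleC_add_left scaleC_add_right algebra_simps)+
  show "x * y * z = x * (y * z)"
    by (rule unitz.expand) (simp add: scaleC_add_left scaleC_add_right scaleC_scaleC algebra_simps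
      flip: scaleC_mult_left scaleC_mult_right)
  have *: "scaleR r w = scaleC (of_real r) w" for r and w :: 'a
    by (simp add: scaleC_of_real)
  show "scaleR r x * y = scaleR r (x * y)" "x * scaleR r y = scaleR r (x * y)"
    by (rule unitz.expand; simp add: * scaleR_conv_of_real scaleC_add_right scaleC_scaleC ac_simps
      flip: scaleC_mult_left scaleC_mult_right)+
  show "dist x y = norm (x - y)" by (rule dist_unitz_def)
  show "sgn x = scaleR (inverse (norm x)) x" by (rule sgn_unitz_def)
  show "(uniformity :: ('a unitz \<times> 'a unitz) filter) =
      (INF e\<in>{0 <..}. principal {(x, y). dist x y < e})" by (rule uniformity_unitz_def)
  show "open U \<longleftrightarrow> (\<forall>x\<in>U. \<forall>\<^sub>F (x', y) in uniformity. x' = x \<longrightarrow> y \<in> U)" for U :: "'a unitz set"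
    by (rule open_unitz_def)
  show "norm x = 0 \<longleftrightarrow> x = 0"
  proof
    assume "norm x = 0"
    then show "x = 0" using norm_vect_le[of x] norm_scal_le[of x] by (intro unitz.expand) auto
  next
    assume "x = 0"
    then show "norm x = 0" using norm_unitz_le[of x] norm_scal_le[of x] by auto
  qed
  show "norm (x + y) \<le> norm x + norm y"
  proof -
    have "onorm (lact (x + y)) \<le> onorm (lact x) + onorm (lact y)"
      unfolding lact_add by (intro onorm_triangle bounded_linear_lact)
    moreover have "cmod (scal (x + y)) \<le> cmod (scal x) + cmod (scal y)"
      by (simp add: norm_triangle_ineq)
    ultimately show ?thesis unfolding norm_unitz_def by linarith
  qed
  show "norm (scaleR r x) = \<bar>r\<bar> * norm x"
    unfolding norm_unitz_def lact_scaleR onorm_scaleR[OF bounded_linear_lact]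
    by (simp add: max_mult_distrib_left)
  show "norm (x * y) \<le> norm x * norm y"
  proof -
    have "onorm (lact (x * y)) \<le> onorm (lact x) * onorm (lact y)"
      unfolding lact_mult by (intro onorm_compose bounded_linear_lact)
    also have "\<dots> \<le> norm x * norm y"
      by (intro mult_mono) (auto simp: norm_unitz_def onorm_pos_le bounded_linear_lact le_max_iff_disj)
    finally show ?thesis
      by (auto simp: norm_unitz_def norm_mult le_max_iff_disj intro!: mult_mono)
  qed
  show "norm (1 :: 'a unitz) = 1"
  proof -
    have "onorm (lact (1 :: 'a unitz)) \<le> 1"
      by (rule onorm_bound) (auto simp: lact_def scaleC_one)
    then show ?thesis by (simp add: norm_unitz_def)
  qed
qed

end

lemma bounded_linear_scal: "bounded_linear (scal :: 'a::cstar_algebra unitz \<Rightarrow> complex)"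
  by (rule bounded_linear_intro[where K = 1]) (simp_all add: norm_scal_le)

lemma bounded_linear_vect: "bounded_linear (vect :: 'a::cstar_algebra unitz \<Rightarrow> 'a)"
  by (rule bounded_linear_intro[where K = 2]) (use norm_vect_le in \<open>auto simp: mult.commute[of _ 2]\<close>)

lemma dist_unitz_le:
  "dist u v \<le> dist (scal u) (scal v) + dist (vect u) (vect (v :: 'a::cstar_algebra unitz))"
  using norm_unitz_le[of "u - v"] by (simp add: dist_norm)

lemma tendsto_unitz:
  assumes "((\<lambda>x. scal (f x)) \<longlongrightarrow> scal l) F" "((\<lambda>x. vect (f x)) \<longlongrightarrow> vect l) F"
  shows "(f \<longlongrightarrow> (l :: 'a::cstar_algebra unitz)) F"
proof (rule metric_tendsto_imp_tendsto)
  show "((\<lambda>x. dist (scal (f x)) (scal l) + dist (vect (f x)) (vect l)) \<longlongrightarrow> (0::real)) F"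
    using tendsto_add[OF assms[THEN tendsto_dist_iff[THEN iffD1]]] by simp
  show "\<forall>\<^sub>F x in F. dist (f x) l \<le> dist (dist (scal (f x)) (scal l) + dist (vect (f x)) (vect l)) 0"
    by (intro always_eventually allI) (use dist_unitz_le in auto)
qed

instantiation unitz :: (cstar_algebra) cstar_algebra
begin

definition "scaleC c x = Unitz (c * scal x) (scaleC c (vect x))"
definition "adj x = Unitz (cnj (scal x)) (adj (vect x))"

lemma unitz_scal_vect' [simp]:
  "scal (scaleC c x) = c * scal x" "vect (scaleC c x) = scaleC c (vect (x :: 'a unitz))"
  "scal (adj x) = cnj (scal x)" "vect (adj x) = adj (vect (x :: 'a unitz))"
  by (simp_all add: scaleC_unitz_def adj_unitz_def)

instance
proof
  fix X :: "nat \<Rightarrow> 'a unitz"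
  assume X: "Cauchy X"
  have "Cauchy (\<lambda>n. scal (X n))" "Cauchy (\<lambda>n. vect (X n))"
    by (rule bounded_linear.Cauchy[OF bounded_linear_scal X]
        bounded_linear.Cauchy[OF bounded_linear_vect X])+
  then obtain c a where "(\<lambda>n. scal (X n)) \<longlonglongrightarrow> c" "(\<lambda>n. vect (X n)) \<longlonglongrightarrow> a"
    by (auto simp: convergent_def dest!: Cauchy_convergent)
  then have "X \<longlonglongrightarrow> Unitz c a" by (intro tendsto_unitz) auto
  then show "convergent X" by (auto simp: convergent_def)
next
  fix x y z :: "'a unitz" and r s :: real and a b :: complex
  show "scaleC (of_real r) x = scaleR r x" "scaleC (a + b) x = scaleC a x + scaleC b x"
    "scaleC a (x + y) = scaleC a x + scaleC a y" "scaleC a (scaleC b x) = scaleC (a * b) x"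
    "scaleC 1 x = x" "scaleC a (x * y) = scaleC a x * y" "scaleC a (x * y) = x * scaleC a y"
    by (rule unitz.expand; simp add: scaleC_of_real scaleR_conv_of_real[where 'a = complex] scaleC_one scaleC_add_left
        scaleC_add_right scaleC_scaleC algebra_simps flip: scaleC_mult_left scaleC_mult_right)+
  show "adj (adj x) = x" "adj (x + y) = adj x + adj y" "adj (scaleC a x) = scaleC (cnj a) (adj x)"
    "adj (x * y) = adj y * adj x"
    by (rule unitz.expand; simp add: adj_adj adj_add adj_scaleC adj_mult ac_simps)+
  show "norm (scaleC a x) = cmod a * norm x"
  proof -
    have le: "norm (scaleC a x) \<le> cmod a * norm x" for a and x :: "'a unitz"
    proof -
      have "lact (scaleC a x) = (\<lambda>y. scaleC a (lact x y))"
        by (rule ext) (simp add: lact_def scaleC_add_right scaleC_scaleC scaleC_mult_left)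
      then have "onorm (lact (scaleC a x)) \<le> cmod a * norm x"
        by (intro onorm_bound)
          (auto simp: norm_scaleC mult.assoc norm_unitz_def le_max_iff_disj
            intro!: mult_left_mono norm_lact[unfolded norm_unitz_def])
      then show ?thesis by (auto simp: norm_unitz_def norm_mult intro!: mult_left_mono)
    qed
    show ?thesis
    proof (cases "a = 0")
      case True
      then have "scaleC a x = 0" by (intro unitz.expand) simp
      with True show ?thesis by simp
    next
      case False
      have "x = scaleC (inverse a) (scaleC a x)"
        using False by (intro unitz.expand) (simp add: scaleC_scaleC scaleC_one)
      then have "norm x \<le> cmod (inverse a) * norm (scaleC a x)"
        using le[of "inverse a" "scaleC a x"] by simp
      then have "cmod a * norm x \<le> norm (scaleC a x)"
        using False by (simp add: norm_inverse norm_divide divide_simps mult.commute)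
      with le[of a x] show ?thesis by simp
    qed
  qed
  show "norm (adj x * x) = (norm x)\<^sup>2"
  proof -
    have le: "(norm x)\<^sup>2 \<le> norm (adj x * x)" for x :: "'a unitz"
    proof -
      \<comment> \<open>Moves the C*-identity into the algebra: the norm of the left side is the
        square of \<open>norm (lact x y)\<close>.\<close>
      have eq: "adj (lact x y) * lact x y = adj y * lact (adj x * x) y" for y
        by (simp add: lact_def adj_add adj_scaleC adj_mult scaleC_add_left scaleC_add_right
            scaleC_scaleC algebra_simps flip: scaleC_mult_left scaleC_mult_right)
      have "norm (lact x y) \<le> sqrt (norm (adj x * x)) * norm y" for y
      proof (rule power2_le_imp_le)
        have "(norm (lact x y))\<^sup>2 = norm (adj y * lact (adj x * x) y)"
          by (simp flip: cstar_identity eq)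
        also have "\<dots> \<le> norm y * (norm (adj x * x) * norm y)"
          by (rule order_trans[OF norm_mult_ineq]) (auto intro!: mult_left_mono norm_lact)
        finally show "(norm (lact x y))\<^sup>2 \<le> (sqrt (norm (adj x * x)) * norm y)\<^sup>2"
          by (simp add: power_mult_distrib power2_eq_square norm_unitz_def le_max_iff_disj ac_simps)
      qed (simp add: norm_unitz_def le_max_iff_disj)
      then have "onorm (lact x) \<le> sqrt (norm (adj x * x))"
        by (intro onorm_bound) (simp_all add: norm_unitz_def le_max_iff_disj)
      moreover have "cmod (scal x) \<le> sqrt (norm (adj x * x))"
      proof (rule real_le_rsqrt)
        show "(cmod (scal x))\<^sup>2 \<le> norm (adj x * x)"
          using norm_scal_le[of "adj x * x"] by (simp add: norm_mult power2_eq_square)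
      qed
      ultimately have "norm x \<le> sqrt (norm (adj x * x))" by (simp add: norm_unitz_def)
      then have "(norm x)\<^sup>2 \<le> (sqrt (norm (adj x * x)))\<^sup>2"
        by (intro power_mono) (auto simp: norm_unitz_def le_max_iff_disj)
      then show ?thesis by (simp add: norm_unitz_def le_max_iff_disj)
    qed
    have adjle: "norm x \<le> norm (adj x)" for x :: "'a unitz"
    proof (cases "norm x = 0")
      case False
      have "norm x * norm x \<le> norm (adj x) * norm x"
        using order_trans[OF le norm_mult_ineq] by (simp add: power2_eq_square)
      then show ?thesis using False by (simp add: mult_le_cancel_right)
    qed simp
    have "adj (adj x) = x" by (rule unitz.expand) (simp add: adj_adj)
    then have "norm (adj x) = norm x" using adjle[of x] adjle[of "adj x"] by simp
    then show ?thesis using le[of x] norm_mult_ineq[of "adj x" x] by (simp add: power2_eq_square)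
  qed
qed

end

section \<open>Positive elements of a unital \<open>C\<^sup>*\<close>-algebra\<close>

text \<open>\<open>y\<close> is the sum of the powers of \<open>x\<close> from the first on, so that
  \<open>1 + y\<close> inverts \<open>1 - x\<close>. It is found as the fixed point of
  \<open>\<lambda>y. x + x * y\<close>, which keeps it in \<open>S\<close>, and it is phrased
  without a unit because the matrix ring has none.\<close>

lemma neumann:
  fixes x :: "'a::real_normed_algebra"
  assumes S: "complete S" "0 \<in> S" "\<And>u v. u \<in> S \<Longrightarrow> v \<in> S \<Longrightarrow> u + v \<in> S \<and> u * v \<in> S"
    and x: "x \<in> S" "norm x < 1"
  obtains y where "y \<in> S" "y = x + x * y" "y = x + y * x"
proof -
  have "\<exists>!y. y \<in> S \<and> x + x * y = y"
    by (rule Banach_fix[OF S(1) _ norm_ge_zero x(2)])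
      (use S x in \<open>auto simp: dist_norm norm_mult_ineq simp flip: right_diff_distrib\<close>)
  then obtain y where y: "y \<in> S" "x + x * y = y" by auto
  have "\<exists>!y. y \<in> S \<and> x + y * x = y"
    by (rule Banach_fix[OF S(1) _ norm_ge_zero x(2)])
      (use S x in \<open>auto simp: dist_norm norm_mult_ineq mult.commute[of "norm x"] simp flip: left_diff_distrib\<close>)
  then obtain z where z: "z \<in> S" "x + z * x = z" by auto
  \<comment> \<open>The argument that a left and a right inverse agree, for quasi-inverses.\<close>
  have "x * y + z * (x * y) = z * y" "z * x + z * (x * y) = z * y"
    using arg_cong[OF z(2), of "\<lambda>w. w * y"] arg_cong[OF y(2), of "\<lambda>w. z * w"]
    by (simp_all add: distrib_left distrib_right mult.assoc)
  then have "z * x = x * y" by (metis add_right_cancel)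
  then have "z = y" using y z by simp
  with y z show thesis by (intro that[of y]) auto
qed

lemma adj_one [simp]: "adj (1::'u::{cstar_algebra, real_normed_algebra_1}) = 1"
  by (metis adj_adj adj_mult mult.right_neutral mult.left_neutral)

lemma adj_of_real [simp]: "adj (of_real r :: 'u::{cstar_algebra, real_normed_algebra_1}) = of_real r"
  by (simp add: of_real_def adj_scaleR)

text \<open>For self-adjoint \<open>h\<close>, a bound \<open>norm (t - h) \<le> t\<close> says that
  the spectrum of \<open>h\<close> lies between 0 and 2 t; the slack \<epsilon> makes the condition
  stable under limits.\<close>

definition cpos :: "'u::{cstar_algebra, real_normed_algebra_1} \<Rightarrow> bool" where
  "cpos h \<longleftrightarrow> adj h = h \<and> (\<forall>\<epsilon>>0. \<exists>t\<ge>0. norm (of_real t - h) \<le> t + \<epsilon>)"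

lemma cposI: "adj h = h \<Longrightarrow> 0 \<le> t \<Longrightarrow> norm (of_real t - h) \<le> t \<Longrightarrow> cpos (h :: 'u::{cstar_algebra, real_normed_algebra_1})"
  unfolding cpos_def by (meson less_eq_real_def add_increasing2 order_trans add_increasing)

lemma cpos_adj: "cpos h \<Longrightarrow> adj h = (h :: 'u::{cstar_algebra, real_normed_algebra_1})"
  by (simp add: cpos_def)

lemma cpos_of_real: "0 \<le> r \<Longrightarrow> cpos (of_real r :: 'u::{cstar_algebra, real_normed_algebra_1})"
  by (rule cposI[of _ r]) auto

lemma cpos_zero [simp]: "cpos (0 :: 'u::{cstar_algebra, real_normed_algebra_1})"
  using cpos_of_real[of 0] by simp

lemma cpos_add:
  assumes "cpos h" "cpos k"
  shows "cpos (h + k :: 'u::{cstar_algebra, real_normed_algebra_1})"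
  unfolding cpos_def
proof (intro conjI allI impI)
  fix \<epsilon> :: real
  assume "\<epsilon> > 0"
  then obtain s t where "s \<ge> 0" "t \<ge> 0" "norm (of_real s - h) \<le> s + \<epsilon>/2" "norm (of_real t - k) \<le> t + \<epsilon>/2"
    using assms unfolding cpos_def by (meson half_gt_zero)
  moreover have "of_real (s + t) - (h + k) = (of_real s - h) + (of_real t - k)"
    by simp
  then have "norm (of_real (s + t) - (h + k)) \<le> norm (of_real s - h) + norm (of_real t - k)"
    by (metis norm_triangle_ineq)
  ultimately show "\<exists>t\<ge>0. norm (of_real t - (h + k)) \<le> t + \<epsilon>"
    by (intro exI[of _ "s + t"]) simp
qed (use assms in \<open>simp add: cpos_def adj_add\<close>)

lemma cpos_sum: "(\<And>i. i \<in> I \<Longrightarrow> cpos (f i :: 'u::{cstar_algebra, real_normed_algebra_1})) \<Longrightarrow> cpos (\<Sum>i\<in>I. f i)"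
  by (induction I rule: infinite_finite_induct) (auto intro: cpos_add)

lemma cpos_scaleR:
  assumes "cpos h" "0 \<le> r"
  shows "cpos (scaleR r h :: 'u::{cstar_algebra, real_normed_algebra_1})"
proof (cases "r = 0")
  case False
  show ?thesis unfolding cpos_def
  proof (intro conjI allI impI)
    fix \<epsilon> :: real
    assume "\<epsilon> > 0"
    then have "\<epsilon> / r > 0" using False assms by simp
    then obtain t where t: "t \<ge> 0" "norm (of_real t - h) \<le> t + \<epsilon>/r"
      using assms unfolding cpos_def by meson
    have "of_real (r * t) - scaleR r h = scaleR r (of_real t - h)"
      by (simp add: scaleR_conv_of_real algebra_simps)
    then have "norm (of_real (r * t) - scaleR r h) \<le> r * (t + \<epsilon>/r)"
      using t assms by (simp add: mult_left_mono)
    also have "\<dots> = r * t + \<epsilon>" using False by (simp add: algebra_simps)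
    finally show "\<exists>t\<ge>0. norm (of_real t - scaleR r h) \<le> t + \<epsilon>"
      using t assms by (intro exI[of _ "r * t"]) simp
  qed (use assms in \<open>simp add: cpos_def adj_scaleR\<close>)
qed simp

lemma cpos_closure:
  assumes "adj h = (h :: 'u::{cstar_algebra, real_normed_algebra_1})" "\<And>\<delta>. \<delta> > 0 \<Longrightarrow> \<exists>k. cpos k \<and> norm (h - k) \<le> \<delta>"
  shows "cpos h"
  unfolding cpos_def
proof (intro conjI allI impI)
  fix \<epsilon> :: real
  assume "\<epsilon> > 0"
  then obtain k where k: "cpos k" "norm (h - k) \<le> \<epsilon>/2" using assms(2)[of "\<epsilon>/2"] by auto
  then obtain t where t: "t \<ge> 0" "norm (of_real t - k) \<le> t + \<epsilon>/2"
    using \<open>\<epsilon> > 0\<close> unfolding cpos_def by (meson half_gt_zero)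
  have "norm (of_real t - h) \<le> norm (of_real t - k) + norm (h - k)"
    using norm_triangle_ineq4[of "of_real t - k" "h - k"] by simp
  with k t show "\<exists>t\<ge>0. norm (of_real t - h) \<le> t + \<epsilon>" by (intro exI[of _ t]) simp
qed (use assms in simp)

lemma cpos_limit:
  assumes "\<And>\<delta>. \<delta> > 0 \<Longrightarrow> cpos (h + of_real \<delta> :: 'u::{cstar_algebra, real_normed_algebra_1})"
  shows "cpos h"
proof (rule cpos_closure)
  show "adj h = h" using assms[of 1] by (simp add: cpos_def adj_add)
  show "\<exists>k. cpos k \<and> norm (h - k) \<le> \<delta>" if "\<delta> > 0" for \<delta>
    using assms[OF that] that by (intro exI[of _ "h + of_real \<delta>"]) simp
qed

lemma cpos_norm_minus: "adj v = v \<Longrightarrow> cpos (of_real (norm v) - v :: 'u::{cstar_algebra, real_normed_algebra_1})"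
  by (rule cposI[of _ "norm v"]) (auto simp: adj_diff)

text \<open>The square root of \<open>1 - k\<close> is \<open>1 - y\<close> where \<open>y\<close> is the fixed point of the contraction
  \<open>y \<mapsto> (k + y\<^sup>2) / 2\<close>.\<close>

lemma sqrt_near_one:
  assumes h: "adj h = h" "norm (1 - h) < 1"
  obtains s :: "'u::{cstar_algebra, real_normed_algebra_1}" where "adj s = s" "s * s = h" "\<And>x. x * h = h * x \<Longrightarrow> x * s = s * x" "cpos s"
proof -
  define k where "k = 1 - h"
  \<comment> \<open>\<rho> solves the scalar equation
    \<open>\<rho> = (norm k + \<rho> * \<rho>) / 2\<close>, so the ball of radius \<rho> is mapped
    into itself and \<rho> < 1 is a contraction constant. Self-adjointness and the commutation
    property are built into \<open>S\<close> and thus pass to the fixed point.\<close>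
  define \<rho> where "\<rho> = 1 - sqrt (1 - norm k)"
  define S where "S = {y. norm y \<le> \<rho>} \<inter> {y. adj y = y} \<inter> (\<Inter>x\<in>{x. x * h = h * x}. {y. x * y = y * x})"
  have k1: "norm k < 1" using h by (simp add: k_def)
  then have \<rho>: "0 \<le> \<rho>" "\<rho> < 1" by (auto simp: \<rho>_def)
  have "(1 - \<rho>)\<^sup>2 = 1 - norm k" using k1 by (simp add: \<rho>_def)
  then have eq: "(norm k + \<rho> * \<rho>) / 2 = \<rho>" by (simp add: power2_eq_square algebra_simps)
  have cadj: "continuous_on UNIV (adj :: 'u \<Rightarrow> 'u)"
    using bounded_linear_adj by (rule linear_continuous_on)
  have "closed S" unfolding S_def
    by (intro closed_Int closed_INT ballI closed_Collect_le closed_Collect_eq continuous_intros cadj)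
  then have "complete S" by (simp add: complete_eq_closed)
  moreover have "0 \<in> S" using \<rho> by (auto simp: S_def)
  moreover have "(\<lambda>y. scaleR (1/2) (k + y * y)) ` S \<subseteq> S"
  proof clarify
    fix y assume "y \<in> S"
    then have y: "norm y \<le> \<rho>" "adj y = y" and yc: "\<And>x. x * h = h * x \<Longrightarrow> x * y = y * x"
      by (simp_all only: S_def Int_iff mem_Collect_eq INT_iff)
    have "norm (k + y * y) \<le> norm k + norm y * norm y"
      by (rule order_trans[OF norm_triangle_ineq]) (simp add: norm_mult_ineq)
    also have "\<dots> \<le> norm k + \<rho> * \<rho>" using y \<rho> by (intro add_left_mono mult_mono) auto
    finally have "norm (scaleR (1/2) (k + y * y)) \<le> \<rho>" using eq by simp
    moreover have "adj (scaleR (1/2) (k + y * y)) = scaleR (1/2) (k + y * y)"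
      using y h by (simp add: k_def adj_scaleR adj_add adj_mult adj_diff)
    moreover have "x * scaleR (1/2) (k + y * y) = scaleR (1/2) (k + y * y) * x" if "x * h = h * x" for x
    proof -
      have "x * y = y * x" using that by (rule yc)
      then have "x * (y * y) = y * y * x" by (metis mult.assoc)
      then show ?thesis using that by (simp add: k_def distrib_left distrib_right left_diff_distrib right_diff_distrib)
    qed
    ultimately show "scaleR (1/2) (k + y * y) \<in> S"
      by (simp only: S_def Int_iff mem_Collect_eq INT_iff) blast
  qed
  moreover have "dist (scaleR (1/2) (k + y * y)) (scaleR (1/2) (k + z * z)) \<le> \<rho> * dist y z"
    if "y \<in> S" "z \<in> S" for y z
  proof -
    have "norm (y * y - z * z) = norm (y * (y - z) + (y - z) * z)" by (simp add: algebra_simps)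
    also have "\<dots> \<le> norm y * norm (y - z) + norm (y - z) * norm z"
      by (intro order_trans[OF norm_triangle_ineq] add_mono norm_mult_ineq)
    also have "\<dots> \<le> \<rho> * norm (y - z) + norm (y - z) * \<rho>"
      using that \<rho> by (intro add_mono mult_mono) (auto simp: S_def)
    finally show ?thesis
      by (simp add: dist_norm flip: scaleR_diff_right)
  qed
  ultimately obtain y where y: "y \<in> S" "scaleR (1/2) (k + y * y) = y"
    using Banach_fix[of S \<rho> "\<lambda>y. scaleR (1/2) (k + y * y)"] \<rho> by blast
  have yS: "norm y \<le> \<rho>" "adj y = y" and yc: "\<And>x. x * h = h * x \<Longrightarrow> x * y = y * x"
    using y(1) by (simp_all only: S_def Int_iff mem_Collect_eq INT_iff)
  have "scaleR 2 y = k + y * y" using arg_cong[OF y(2), of "scaleR 2"] by simp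
  then have "(1 - y) * (1 - y) = h" by (simp add: algebra_simps k_def scaleR_2)
  moreover have "cpos (1 - y)"
    by (rule cposI[of _ 1]) (use yS \<rho> in \<open>auto simp: adj_diff\<close>)
  moreover have "x * (1 - y) = (1 - y) * x" if "x * h = h * x" for x
    using yc[OF that] by (simp add: left_diff_distrib right_diff_distrib)
  moreover have "adj (1 - y) = 1 - y" using yS by (simp add: adj_diff)
  ultimately show thesis using that[of "1 - y"] by blast
qed

text \<open>The summand \<epsilon> moves the rescaled element to distance strictly less than 1 from
  the unit, where \<open>sqrt_near_one\<close> applies.\<close>

lemma cpos_sqrt:
  assumes h: "cpos h" and "\<epsilon> > 0"
  obtains s :: "'u::{cstar_algebra, real_normed_algebra_1}" where "adj s = s" "s * s = h + of_real \<epsilon>"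
    "\<And>x. x * h = h * x \<Longrightarrow> x * s = s * x" "cpos s"
proof -
  obtain t where t: "t \<ge> 0" "norm (of_real t - h) \<le> t + \<epsilon>/2"
    using assms unfolding cpos_def by (meson half_gt_zero)
  define T where "T = t + \<epsilon>"
  have T: "T > 0" using t assms by (simp add: T_def)
  define g where "g = scaleR (1/T) (h + of_real \<epsilon>)"
  have "1 - g = scaleR (1/T) (of_real T - (h + of_real \<epsilon>))"
    using T by (simp add: g_def scaleR_diff_right of_real_def)
  also have "of_real T - (h + of_real \<epsilon>) = of_real t - h" by (simp add: T_def)
  finally have "norm (1 - g) = norm (of_real t - h) / T" using T by simp
  then have g1: "norm (1 - g) < 1" using t T assms by (simp add: T_def)
  have ga: "adj g = g" using h by (simp add: g_def adj_scaleR adj_add cpos_def)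
  obtain s where s: "adj s = s" "s * s = g" "\<And>x. x * g = g * x \<Longrightarrow> x * s = s * x" "cpos s"
    using sqrt_near_one[OF ga g1] by metis
  have "x * g = g * x" if "x * h = h * x" for x
    using that by (simp add: g_def algebra_simps of_real_def)
  then have "x * scaleR (sqrt T) s = scaleR (sqrt T) s * x" if "x * h = h * x" for x
    using s(3)[of x] that by simp
  moreover have "scaleR (sqrt T) s * scaleR (sqrt T) s = h + of_real \<epsilon>"
    using T by (simp add: s(2) g_def)
  moreover have "adj (scaleR (sqrt T) s) = scaleR (sqrt T) s" "cpos (scaleR (sqrt T) s)"
    using s(1,4) T by (simp_all add: adj_scaleR cpos_scaleR)
  ultimately show thesis using that[of "scaleR (sqrt T) s"] by blast
qed

text \<open>For commuting self-adjoint \<open>h\<close> and \<open>s\<close> the element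
  \<open>h + i s\<close> is normal, so its norm is governed by \<open>h * h + s * s\<close>. When
  that is a scalar, both parts are bounded; this takes the place of functional calculus
  below.\<close>

lemma norm_cartesian:
  assumes "adj h = h" "adj s = s" "h * s = s * (h :: 'u::{cstar_algebra, real_normed_algebra_1})"
  shows "(norm (h + scaleC \<i> s))\<^sup>2 = norm (h * h + s * s)"
    "norm h \<le> norm (h + scaleC \<i> s)" "norm s \<le> norm (h + scaleC \<i> s)"
proof -
  define u where "u = h + scaleC \<i> s"
  have u': "adj u = h - scaleC \<i> s"
    using assms by (simp add: u_def adj_add adj_scaleC scaleC_minus_left)
  have "adj u * u = h * h + s * s"
    unfolding u' using assms
    by (simp add: u_def algebra_simps scaleC_diff_right scaleC_scaleC scaleC_minus_left scaleC_one flip: scaleC_mult_left scaleC_mult_right)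
  then show "(norm (h + scaleC \<i> s))\<^sup>2 = norm (h * h + s * s)"
    unfolding u_def[symmetric] by (simp flip: cstar_identity)
  have "scaleR 2 h = u + adj u" by (simp add: u', simp add: u_def scaleR_2)
  then have "2 * norm h = norm (u + adj u)" by (metis norm_scaleR abs_numeral)
  also have "\<dots> \<le> 2 * norm u" using norm_triangle_ineq[of u "adj u"] by simp
  finally show "norm h \<le> norm (h + scaleC \<i> s)" by (simp add: u_def)
  have "scaleC (2 * \<i>) s = u - adj u"
    by (simp add: u', simp add: u_def flip: scaleC_add_left)
  then have "2 * norm s = norm (u - adj u)"
    using norm_scaleC[of "2 * \<i>" s] by (simp add: norm_mult)
  also have "\<dots> \<le> 2 * norm u" using norm_triangle_ineq4[of u "adj u"] by simp
  finally show "norm s \<le> norm (h + scaleC \<i> s)" by (simp add: u_def)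
qed

text \<open>Scale to \<open>norm g < 1\<close> and let \<open>s\<close> be the root of
  \<open>1 - g * g\<close>. Then \<open>g + i s\<close> is unitary, hence
  \<open>norm s \<le> 1\<close>, and \<open>norm (1 - g * g) = norm (s * s) \<le> 1\<close> is
  positivity of \<open>g * g\<close> with t = 1.\<close>

lemma cpos_square:
  assumes h: "adj h = (h :: 'u::{cstar_algebra, real_normed_algebra_1})"
  shows "cpos (h * h)"
proof -
  define T where "T = norm h + 1"
  have T: "T > 0" by (simp add: T_def add_nonneg_pos)
  define g where "g = scaleR (1/T) h"
  have g: "norm g < 1" "adj g = g" using h T by (auto simp: g_def adj_scaleR T_def)
  have "norm (1 - (1 - g * g)) < 1"
  proof -
    have "norm (g * g) \<le> norm g * norm g" by (rule norm_mult_ineq)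
    also have "\<dots> \<le> norm g" using g by (intro mult_left_le) auto
    finally show ?thesis using g by simp
  qed
  moreover have "adj (1 - g * g) = 1 - g * g" using g(2) by (simp add: adj_diff adj_mult)
  moreover have "g * (1 - g * g) = (1 - g * g) * g"
    by (simp add: right_diff_distrib left_diff_distrib mult.assoc)
  ultimately obtain s where s: "adj s = s" "s * s = 1 - g * g" "g * s = s * g"
    using sqrt_near_one[of "1 - g * g"] by blast
  have "(norm (g + scaleC \<i> s))\<^sup>2 = 1" using norm_cartesian(1)[OF g(2) s(1,3)] s(2) by simp
  then have "norm s \<le> 1"
    using norm_cartesian(3)[OF g(2) s(1,3)] norm_ge_zero[of "g + scaleC \<i> s"]
    unfolding power2_eq_1_iff by linarith
  then have "norm (s * s) \<le> 1"
    using norm_mult_ineq[of s s] mult_mono[of "norm s" 1 "norm s" 1] by simp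
  then have "cpos (g * g)" by (intro cposI[of _ 1]) (simp_all add: adj_mult g(2) s(2))
  then have "cpos (scaleR (T * T) (g * g))" using T by (intro cpos_scaleR) auto
  then show ?thesis using T by (simp add: g_def)
qed

text \<open>Up to a small error \<open>h * k\<close> is the square of \<open>s * r\<close>, where
  \<open>s\<close> and \<open>r\<close> are commuting self-adjoint roots of
  \<open>h + \<epsilon>\<close> and \<open>k + \<epsilon>\<close>.\<close>

lemma cpos_mult:
  assumes h: "cpos h" and k: "cpos (k :: 'u::{cstar_algebra, real_normed_algebra_1})" and hk: "h * k = k * h"
  shows "cpos (h * k)"
proof (rule cpos_closure)
  show "adj (h * k) = h * k" using assms by (simp add: adj_mult cpos_def)
  fix \<delta> :: real
  assume \<delta>: "\<delta> > 0"
  \<comment> \<open>The error is \<open>\<epsilon> * (h + k + \<epsilon>)\<close>, of norm at most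
    \<open>\<epsilon> * M\<close> since \<epsilon> \<le> 1.\<close>
  define M where "M = norm h + norm k + 1"
  have M: "M > 0" by (simp add: M_def add_nonneg_pos)
  define \<epsilon> where "\<epsilon> = min 1 (\<delta> / M)"
  have \<epsilon>: "\<epsilon> > 0" "\<epsilon> \<le> 1" "\<epsilon> * M \<le> \<delta>" using \<delta> M by (auto simp: \<epsilon>_def min_def field_simps)
  obtain s where s: "adj s = s" "s * s = h + of_real \<epsilon>" "\<And>x. x * h = h * x \<Longrightarrow> x * s = s * x"
    using cpos_sqrt[OF h \<epsilon>(1)] by metis
  obtain r where r: "adj r = r" "r * r = k + of_real \<epsilon>" "\<And>x. x * k = k * x \<Longrightarrow> x * r = r * x"
    using cpos_sqrt[OF k \<epsilon>(1)] by metis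
  have sr: "s * r = r * s" using s(3)[of k] r(3)[of s] hk by simp
  have "cpos ((s * r) * (s * r))"
    by (rule cpos_square) (simp add: adj_mult s(1) r(1) sr)
  also have "(s * r) * (s * r) = (s * s) * (r * r)" by (metis sr mult.assoc)
  also have "\<dots> = h * k + of_real \<epsilon> * (h + k + of_real \<epsilon>)"
    by (simp add: s(2) r(2) algebra_simps of_real_def)
  finally have "cpos (h * k + of_real \<epsilon> * (h + k + of_real \<epsilon>))" .
  moreover have "norm (of_real \<epsilon> * (h + k + of_real \<epsilon>)) \<le> \<epsilon> * M"
  proof -
    have "norm (h + k + of_real \<epsilon>) \<le> norm h + norm k + \<epsilon>"
      using \<epsilon> by (metis norm_triangle_mono norm_triangle_ineq norm_of_real abs_of_pos order_refl)
    then show ?thesis using \<epsilon> by (simp add: M_def of_real_def mult_left_mono)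
  qed
  ultimately show "\<exists>k'. cpos k' \<and> norm (h * k - k') \<le> \<delta>"
    using \<epsilon>(3) by (intro exI[of _ "h * k + of_real \<epsilon> * (h + k + of_real \<epsilon>)"]) simp
qed

text \<open>The constant is \<open>1 / norm v\<close>: then \<open>h - c\<close> is
  \<open>h * (norm v - v)\<close> divided by \<open>norm v\<close>, a product of commuting positive
  elements.\<close>

lemma cpos_gap:
  assumes h: "cpos h" and v: "h * v = 1" "v * h = (1 :: 'u::{cstar_algebra, real_normed_algebra_1})"
  obtains c where "c > 0" "cpos (h - of_real c)"
proof -
  have hv: "v \<noteq> 0" using v by auto
  have "adj v * h = 1" using arg_cong[OF v(1), of adj] h by (simp add: adj_mult cpos_def)
  then have "adj v = v" using v by (metis mult.assoc mult.left_neutral mult.right_neutral)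
  then have "cpos (h * (of_real (norm v) - v))"
    by (intro cpos_mult h cpos_norm_minus) (simp_all add: algebra_simps v of_real_def)
  then have "cpos (scaleR (1 / norm v) (h * (of_real (norm v) - v)))"
    by (rule cpos_scaleR) simp
  also have "scaleR (1 / norm v) (h * (of_real (norm v) - v)) = h - of_real (1 / norm v)"
    using hv by (simp add: right_diff_distrib v scaleR_diff_right of_real_def)
  finally show thesis using hv by (intro that[of "1 / norm v"]) auto
qed

text \<open>Let \<open>r0\<close> be the infimum of the r \<ge> \<delta> for which
  \<open>r - m\<close> is positive. If r0 > \<delta>, then \<open>r0 - m\<close> is positive and
  invertible, and \<open>cpos_gap\<close> produces a smaller r.\<close>

lemma cpos_of_resolvent:
  assumes m: "adj m = m"
    and inv: "\<And>r. r > \<delta> \<Longrightarrow> \<exists>v. (of_real r - m) * v = 1 \<and> v * (of_real r - m) = (1 :: 'u::{cstar_algebra, real_normed_algebra_1})"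
  shows "cpos (of_real \<delta> - m)"
proof -
  define J where "J = {r. \<delta> \<le> r \<and> cpos (of_real r - m)}"
  have up: "cpos (of_real r' - m)" if "r \<in> J" "r \<le> r'" for r r'
    using cpos_add[of "of_real r - m" "of_real (r' - r)"] cpos_of_real[of "r' - r"] that
    by (simp add: J_def)
  have "norm m \<le> r \<Longrightarrow> cpos (of_real r - m)" for r
    using cpos_add[OF cpos_norm_minus[OF m] cpos_of_real[of "r - norm m"]] by simp
  then have ne: "J \<noteq> {}" by (auto simp: J_def intro!: exI[of _ "max \<delta> (norm m)"])
  have bdd: "bdd_below J" by (auto simp: J_def intro: bdd_belowI[of _ \<delta>])
  define r0 where "r0 = Inf J"
  have r0: "\<delta> \<le> r0" unfolding r0_def using ne by (intro cInf_greatest) (auto simp: J_def)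
  have pos: "cpos (of_real r0 - m)"
  proof (rule cpos_limit)
    fix e :: real assume "e > 0"
    then obtain r where "r \<in> J" "r < r0 + e"
      using cInf_lessD[OF ne, of "r0 + e"] by (auto simp: r0_def)
    then have "cpos (of_real (r0 + e) - m)" by (intro up) auto
    then show "cpos (of_real r0 - m + of_real e)" by (simp add: algebra_simps)
  qed
  show ?thesis
  proof (cases "r0 = \<delta>")
    case False
    with r0 have "r0 > \<delta>" by simp
    then obtain v where "(of_real r0 - m) * v = 1" "v * (of_real r0 - m) = 1" using inv by blast
    then obtain c where c: "c > 0" "cpos (of_real r0 - m - of_real c)" by (rule cpos_gap[OF pos])
    define d where "d = min c (r0 - \<delta>)"
    have d: "d > 0" "d \<le> c" "d \<le> r0 - \<delta>" using c \<open>r0 > \<delta>\<close> by (auto simp: d_def)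
    have "cpos (of_real (r0 - d) - m)"
      using cpos_add[OF c(2) cpos_of_real[of "c - d"]] d by (simp add: algebra_simps)
    then have "r0 - d \<in> J" using d by (auto simp: J_def)
    then have "r0 \<le> r0 - d" unfolding r0_def using bdd by (rule cInf_lower)
    with d show ?thesis by simp
  qed (use pos in simp)
qed

text \<open>\<open>r + h\<close> is \<open>(t + r) * (1 - x)\<close> with \<open>norm x < 1\<close>.
  The Neumann series stays in the closed subalgebra \<open>S\<close>, which later keeps inverses
  over the given subalgebra.\<close>

lemma cpos_invertible:
  assumes S: "closed S" "1 \<in> S" "\<And>u v. u \<in> S \<Longrightarrow> v \<in> S \<Longrightarrow> u + v \<in> S \<and> u * v \<in> S"
    "\<And>r u. u \<in> S \<Longrightarrow> scaleR r u \<in> S"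
    and h: "h \<in> S" "cpos (h :: 'u::{cstar_algebra, real_normed_algebra_1})" and "r > 0"
  obtains v where "v \<in> S" "(of_real r + h) * v = 1" "v * (of_real r + h) = 1"
proof -
  obtain t where t: "t \<ge> 0" "norm (of_real t - h) \<le> t + r/2"
    using h \<open>r > 0\<close> unfolding cpos_def by (meson half_gt_zero)
  define x where "x = scaleR (1 / (t + r)) (of_real t - h)"
  have tr: "t + r > 0" using t \<open>r > 0\<close> by simp
  have "norm x < 1" using t \<open>r > 0\<close> tr by (simp add: x_def)
  moreover have "x \<in> S"
  proof -
    have "of_real t - h = scaleR t 1 + scaleR (-1) h" by (simp add: of_real_def)
    then show ?thesis unfolding x_def using S h by metis
  qed
  moreover have "0 \<in> S" using S(4)[OF S(2), of 0] by simp
  moreover have "complete S" using S by (simp add: complete_eq_closed)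
  ultimately obtain y where y: "y \<in> S" "y = x + x * y" "y = x + y * x"
    using neumann[of S x] S(3) by metis
  have eq: "of_real r + h = scaleR (t + r) (1 - x)"
    using tr by (simp add: x_def scaleR_diff_right) (simp add: of_real_def scaleR_add_left)
  have "(1 - x) * (1 + y) = 1" "(1 + y) * (1 - x) = 1"
    using y(2,3) by (simp_all add: algebra_simps)
  then show thesis using S y tr
    by (intro that[of "scaleR (1 / (t + r)) (1 + y)"]) (auto simp: eq)
qed

text \<open>Here \<open>t * t - k * k\<close> is positive. If \<open>s\<close> is a root of
  \<open>t * t - k * k + e * e\<close>, then \<open>k + i s\<close> has squared norm
  \<open>t * t + e * e\<close>, and this bounds \<open>norm k\<close>.\<close>

lemma cpos_norm_le:
  assumes "cpos k" "cpos (of_real t - k :: 'u::{cstar_algebra, real_normed_algebra_1})" "t \<ge> 0"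
  shows "norm k \<le> t"
proof (rule field_le_epsilon)
  fix e :: real assume e: "e > 0"
  have "cpos ((of_real t - k) * (of_real t + k))"
    using assms by (intro cpos_mult cpos_add cpos_of_real) (auto simp: algebra_simps of_real_def)
  then have p: "cpos (of_real (t * t) - k * k)" by (simp add: algebra_simps of_real_def)
  obtain s where s: "adj s = s" "s * s = of_real (t * t) - k * k + of_real (e * e)"
      "\<And>x. x * (of_real (t * t) - k * k) = (of_real (t * t) - k * k) * x \<Longrightarrow> x * s = s * x"
    using cpos_sqrt[OF p mult_pos_pos[OF e e]] by metis
  have ks: "k * s = s * k" by (rule s(3)) (simp add: algebra_simps of_real_def)
  have "k * k + s * s = of_real (t * t + e * e)" using s(2) by simp
  then have "(norm (k + scaleC \<i> s))\<^sup>2 = t * t + e * e"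
    using norm_cartesian(1)[OF cpos_adj[OF assms(1)] s(1) ks] by (simp del: of_real_add)
  also have "\<dots> \<le> (t + e)\<^sup>2" using e assms by (simp add: power2_eq_square algebra_simps)
  finally have "norm (k + scaleC \<i> s) \<le> t + e"
    by (rule power2_le_imp_le) (use e assms in simp)
  then show "norm k \<le> t + e"
    using norm_cartesian(2)[OF cpos_adj[OF assms(1)] s(1) ks] by simp
qed

text \<open>The reason why \<open>x * y\<close> and \<open>y * x\<close> have the same spectrum away
  from zero: the inverse is explicitly \<open>(1 - y * v * x) / r\<close>.\<close>

lemma invertible_swap:
  assumes "r \<noteq> 0" "(of_real r + x * y) * v = 1" "v * (of_real r + x * y) = (1 :: 'u::{cstar_algebra, real_normed_algebra_1})"
  obtains w where "(of_real r + y * x) * w = 1" "w * (of_real r + y * x) = 1"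
proof -
  define w where "w = scaleR (1/r) (1 - y * v * x)"
  have xyv: "x * y * v = 1 - scaleR r v" "v * (x * y) = 1 - scaleR r v"
    using assms by (simp_all add: algebra_simps of_real_def)
  have a: "y * x * (y * v * x) = y * (x * y * v) * x" "y * v * x * (y * x) = y * (v * (x * y)) * x"
    by (simp_all add: mult.assoc)
  have "(of_real r + y * x) * (1 - y * v * x) = of_real r" "(1 - y * v * x) * (of_real r + y * x) = of_real r"
    unfolding left_diff_distrib right_diff_distrib distrib_left distrib_right a xyv
    by (simp_all add: algebra_simps of_real_def)
  then show thesis using assms(1)
    by (intro that[of w]) (simp_all add: w_def, simp_all add: of_real_def)
qed

text \<open>Kaplansky's trick: if \<open>h = x\<^sup>* x\<close> and \<open>f\<close> is (almost) its negative part, then \<open>y = x f\<close>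
  has \<open>y\<^sup>* y \<approx> - f\<^sup>3\<close>, whereas \<open>y\<^sup>* y + y y\<^sup>*\<close> is positive; comparing the spectra of
  \<open>y\<^sup>* y\<close> and \<open>y y\<^sup>*\<close> forces \<open>f\<close> to be small.\<close>

theorem cpos_adj_mult: "cpos (adj x * x :: 'u::{cstar_algebra, real_normed_algebra_1})"
proof (rule cpos_limit)
  fix \<delta> :: real
  assume \<delta>: "\<delta> > 0"
  define h where "h = adj x * x"
  have h: "adj h = h" by (simp add: h_def adj_mult adj_adj)
  \<comment> \<open>Chosen so that the final estimate, \<open>norm f\<close> squared at most
    \<epsilon> / 2, gives \<open>norm f \<le> \<delta>\<close>.\<close>
  define \<epsilon> where "\<epsilon> = \<delta> * \<delta>"
  have \<epsilon>: "\<epsilon> > 0" using \<delta> by (simp add: \<epsilon>_def)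
  obtain s where s: "adj s = s" "s * s = h * h + of_real \<epsilon>" "\<And>x. x * (h * h) = h * h * x \<Longrightarrow> x * s = s * x"
      "cpos s"
    using cpos_sqrt[OF cpos_square[OF h] \<epsilon>] by metis
  have hs: "h * s = s * h" by (rule s(3)) (simp add: mult.assoc)
  \<comment> \<open>\<open>s\<close> approximates the absolute value of \<open>h\<close>, so
    \<open>f\<close> and \<open>g\<close> approximate its negative and positive part; their product
    is \<epsilon> / 4 instead of 0.\<close>
  define f where "f = scaleR (1/2) (s - h)"
  define g where "g = scaleR (1/2) (s + h)"
  have fa: "adj f = f" and ga: "adj g = g"
    by (simp_all add: f_def g_def adj_scaleR adj_diff adj_add s(1) h)
  have gf: "g - f = h" "f + g = s"
    by (simp_all add: f_def g_def flip: scaleR_diff_right scaleR_add_right)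
  have fg: "f * g = scaleR (\<epsilon>/4) 1" "g * f = scaleR (\<epsilon>/4) 1"
    by (simp_all add: f_def g_def algebra_simps hs s(2)) (simp_all add: of_real_def)
  \<comment> \<open>Both parts satisfy \<open>k * s = k * k + \<epsilon> / 4\<close>, which is
    positive; multiplying by the positive inverse \<open>v\<close> of \<open>s\<close> leaves
    \<open>k\<close>.\<close>
  have fpos: "cpos k" if k: "adj k = k" "k * s = s * k" "k * s = k * k + of_real (\<epsilon>/4)" for k
  proof -
    obtain v where v: "s * v = 1" "v * s = 1"
    proof -
      have "cpos (h * h)" by (rule cpos_square[OF h])
      then obtain w where w: "(of_real \<epsilon> + h * h) * w = 1" "w * (of_real \<epsilon> + h * h) = 1"
        using cpos_invertible[of UNIV "h * h" \<epsilon>] \<epsilon> by auto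
      have "s * (s * w) = 1" "(w * s) * s = 1" using w s(2) by (simp_all add: add.commute mult.assoc[symmetric]) (simp add: mult.assoc add.commute)
      then show thesis by (intro that[of "s * w"]) (simp_all, metis mult.assoc mult.left_neutral mult.right_neutral)
    qed
    have va: "adj v = v" using v s(1) by (metis adj_mult adj_one mult.assoc mult.left_neutral mult.right_neutral)
    have kv: "k * v = v * k" using v k(2) by (metis mult.assoc mult.left_neutral mult.right_neutral)
    have "cpos (s * (v * v))" using v by (intro cpos_mult s cpos_square va) (simp add: mult.assoc[symmetric], simp add: mult.assoc)
    then have "cpos v" using v by (simp add: mult.assoc[symmetric])
    moreover have "cpos (k * s)" unfolding k(3) using \<epsilon> by (intro cpos_add cpos_square k cpos_of_real) simp
    moreover have "(k * s) * v = v * (k * s)" using kv v by (metis k(2) mult.assoc mult.left_neutral mult.right_neutral)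
    ultimately have "cpos (k * s * v)" using cpos_mult by blast
    then show ?thesis using v by (simp add: mult.assoc)
  qed
  have "cpos f"
    by (rule fpos) (use fa gf(2) fg in \<open>auto simp: algebra_simps of_real_def simp flip: gf(2)\<close>)
  moreover have "cpos g"
    by (rule fpos) (use ga gf(2) fg in \<open>auto simp: algebra_simps of_real_def simp flip: gf(2)\<close>)
  ultimately have f: "cpos f" and g: "cpos g" by auto
  define y where "y = x * f"
  \<comment> \<open>Bounds the term \<open>(\<epsilon> / 4) f\<close>, which the nonzero product
    \<open>f * g\<close> leaves over in \<open>adj y * y\<close>.\<close>
  define \<eta> where "\<eta> = \<epsilon>/4 * norm f"
  have \<eta>: "\<eta> \<ge> 0" using \<epsilon> by (simp add: \<eta>_def)
  have yy: "adj y * y = scaleR (\<epsilon>/4) f - f * f * f"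
  proof -
    have "adj y * y = f * (adj x * x) * f" by (simp add: y_def adj_mult fa mult.assoc)
    also have "\<dots> = f * (g - f) * f" by (simp only: gf h_def)
    also have "\<dots> = scaleR (\<epsilon>/4) f - f * f * f" by (simp add: algebra_simps fg)
    finally show ?thesis .
  qed
  have sum: "cpos (adj y * y + y * adj y)"
  proof -
    \<comment> \<open>Up to sign, twice the real and twice the imaginary part of \<open>y\<close>;
      their squares add up to twice the sum in question.\<close>
    define a where "a = y + adj y"
    define b where "b = scaleC \<i> (y - adj y)"
    have "adj a = a" "adj b = b"
      by (simp_all add: a_def b_def adj_add adj_adj adj_scaleC adj_diff add.commute scaleC_minus_left
          flip: scaleC_minus_right)
    then have "cpos (scaleR (1/2) (a * a + b * b))" by (intro cpos_scaleR cpos_add cpos_square) auto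
    moreover have "b * b = - ((y - adj y) * (y - adj y))"
      by (simp add: b_def scaleC_scaleC scaleC_minus_left scaleC_one flip: scaleC_mult_left scaleC_mult_right)
    then have "a * a + b * b = scaleR 2 (adj y * y + y * adj y)"
      by (simp add: a_def algebra_simps scaleR_2)
    ultimately show ?thesis by simp
  qed
  have f3: "cpos (f * f * f)" using f by (intro cpos_mult) (simp_all add: mult.assoc)
  have \<eta>f: "cpos (of_real \<eta> - scaleR (\<epsilon>/4) f)"
    using cpos_scaleR[OF cpos_norm_minus[OF fa], of "\<epsilon>/4"] \<epsilon>
    by (simp add: \<eta>_def scaleR_diff_right of_real_def)
  \<comment> \<open>By \<open>yy\<close> this collapses to
    \<open>\<eta> + y * adj y\<close>.\<close>
  have "cpos ((adj y * y + y * adj y) + f * f * f + (of_real \<eta> - scaleR (\<epsilon>/4) f))"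
    by (intro cpos_add sum f3 \<eta>f)
  then have yy': "cpos (of_real \<eta> + y * adj y)" by (simp add: yy add.commute)
  \<comment> \<open>The lower bound -\<eta> passes from \<open>y * adj y\<close> to
    \<open>adj y * y\<close> by exchanging the factors in the resolvent.\<close>
  have "\<exists>v. (of_real r - - (adj y * y)) * v = 1 \<and> v * (of_real r - - (adj y * y)) = 1" if r: "r > \<eta>" for r
  proof -
    obtain v where "(of_real (r - \<eta>) + (of_real \<eta> + y * adj y)) * v = 1"
        "v * (of_real (r - \<eta>) + (of_real \<eta> + y * adj y)) = 1"
      using cpos_invertible[OF _ _ _ _ _ yy', of UNIV "r - \<eta>"] r by auto
    then have "(of_real r + y * adj y) * v = 1" "v * (of_real r + y * adj y) = 1" by auto
    then obtain w where "(of_real r + adj y * y) * w = 1" "w * (of_real r + adj y * y) = 1"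
      by (rule invertible_swap[rotated]) (use r \<eta> in auto)
    then show ?thesis by auto
  qed
  moreover have "adj (- (adj y * y)) = - (adj y * y)" by (simp add: adj_minus adj_mult adj_adj)
  ultimately have "cpos (of_real \<eta> - - (adj y * y))" by (intro cpos_of_resolvent)
  then have "cpos ((of_real \<eta> + scaleR (\<epsilon>/4) f - f * f * f) + (of_real \<eta> - scaleR (\<epsilon>/4) f))"
    by (intro cpos_add \<eta>f) (simp add: yy algebra_simps)
  then have "cpos (of_real (2 * \<eta>) - f * f * f)"
    unfolding mult_2 of_real_add by (simp add: algebra_simps)
  then have n3: "norm (f * f * f) \<le> 2 * \<eta>" by (intro cpos_norm_le f3) (use \<eta> in auto)
  have "norm f \<le> \<delta>"
  proof (cases "norm f = 0")
    case False
    then have nf: "norm f > 0" by simp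
    \<comment> \<open>For self-adjoint \<open>f\<close> the C*-identity makes the norm
      multiplicative on the second and fourth power.\<close>
    have n2: "norm (f * f) = (norm f)\<^sup>2" using cstar_identity[of f] fa by simp
    have "norm ((f * f) * (f * f)) = (norm (f * f))\<^sup>2" using cstar_identity[of "f * f"] fa by (simp add: adj_mult)
    then have "(norm f)^4 \<le> norm (f * f * f) * norm f"
      using norm_mult_ineq[of "f * f * f" f] by (simp add: n2 mult.assoc power2_eq_square power4_eq_xxxx)
    also have "\<dots> \<le> 2 * \<eta> * norm f" using n3 by (simp add: mult_right_mono)
    finally have "(norm f)\<^sup>2 * (norm f)\<^sup>2 \<le> \<epsilon>/2 * (norm f)\<^sup>2"
      by (simp add: \<eta>_def power2_eq_square power4_eq_xxxx algebra_simps)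
    then have "(norm f)\<^sup>2 \<le> \<epsilon>/2" by (rule mult_right_le_imp_le) (use nf in simp)
    also have "\<dots> \<le> \<delta>\<^sup>2" using \<delta> by (simp add: \<epsilon>_def power2_eq_square)
    finally show ?thesis by (rule power2_le_imp_le) (use \<delta> in simp)
  qed (use \<delta> in simp)
  then have "cpos (g + (of_real (norm f) - f) + of_real (\<delta> - norm f))"
    by (intro cpos_add g cpos_norm_minus fa cpos_of_real) simp
  also have "g + (of_real (norm f) - f) + of_real (\<delta> - norm f) = (g - f) + of_real \<delta>" by simp
  finally show "cpos (adj x * x + of_real \<delta>)" by (simp only: gf h_def)
qed

section \<open>Finitely supported infinite matrices\<close>

text \<open>As a type, these matrices become an instance of the ring classes, so that ring laws are
  available to the simplifier. The ring has no unit; the blocks \<open>blk N\<close> serve as local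
  units.\<close>

typedef (overloaded) 'r fmat =
  "{x :: nat \<Rightarrow> nat \<Rightarrow> 'r::zero. \<exists>N. \<forall>i j. N \<le> i \<or> N \<le> j \<longrightarrow> x i j = 0}"
  morphisms ent Fmat
  by (rule exI[of _ "\<lambda>i j. 0"]) simp

definition supp :: "nat \<Rightarrow> 'r::zero fmat \<Rightarrow> bool" where
  "supp N x \<longleftrightarrow> (\<forall>i j. N \<le> i \<or> N \<le> j \<longrightarrow> ent x i j = 0)"

lemma suppD: "supp N x \<Longrightarrow> ent x i j \<noteq> 0 \<Longrightarrow> i < N \<and> j < N"
  by (meson supp_def not_less)

lemma ex_supp: "\<exists>N. supp N x"
  using ent[of x] by (simp add: supp_def)

lemma supp_mono: "supp N x \<Longrightarrow> N \<le> K \<Longrightarrow> supp K x"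
  by (meson supp_def le_trans)

lemma ex_supp2: obtains N where "supp N x" "supp N y"
  using ex_supp[of x] ex_supp[of y] by (metis supp_mono nat_le_linear)

lemma ex_supp3: obtains N where "supp N x" "supp N y" "supp N z"
  using ex_supp2[of x y] ex_supp[of z] by (metis supp_mono nat_le_linear)

lemma fmat_eqI: "(\<And>i j. ent x i j = ent y i j) \<Longrightarrow> x = y"
  using ent_inject[of x y] by blast

lemma ent_Fmat: "(\<And>i j. N \<le> i \<or> N \<le> j \<Longrightarrow> f i j = 0) \<Longrightarrow> ent (Fmat f) = f"
  by (rule Fmat_inverse) blast

lemma fmat_eqI_supp:
  assumes "supp N x" "supp N y" "\<And>i j. i < N \<Longrightarrow> j < N \<Longrightarrow> ent x i j = ent y i j"
  shows "x = y"
proof (rule fmat_eqI)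
  show "ent x i j = ent y i j" for i j
    using assms by (cases "i < N \<and> j < N") (auto simp: supp_def not_less)
qed

instantiation fmat :: (ring) ring
begin

definition "0 = Fmat (\<lambda>i j. 0)"
definition "x + y = Fmat (\<lambda>i j. ent x i j + ent y i j)"
definition "x - y = Fmat (\<lambda>i j. ent x i j - ent y i j)"
definition "- x = Fmat (\<lambda>i j. - ent x i j)"
definition "x * y = Fmat (\<lambda>i j. \<Sum>k | ent x i k \<noteq> 0. ent x i k * ent y k j)"

lemma ent_zero [simp]: "ent (0 :: 'a fmat) i j = 0"
  by (simp add: zero_fmat_def ent_Fmat[of 0])

lemma ent_add [simp]: "ent (x + y) i j = ent x i j + ent (y :: 'a fmat) i j"
proof -
  obtain N where "supp N x" "supp N y" by (rule ex_supp2)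
  then show ?thesis unfolding plus_fmat_def by (subst ent_Fmat[of N]) (auto simp: supp_def)
qed

lemma ent_diff [simp]: "ent (x - y) i j = ent x i j - ent (y :: 'a fmat) i j"
proof -
  obtain N where "supp N x" "supp N y" by (rule ex_supp2)
  then show ?thesis unfolding minus_fmat_def by (subst ent_Fmat[of N]) (auto simp: supp_def)
qed

lemma ent_minus [simp]: "ent (- x) i j = - ent (x :: 'a fmat) i j"
proof -
  obtain N where "supp N x" using ex_supp by blast
  then show ?thesis unfolding uminus_fmat_def by (subst ent_Fmat[of N]) (auto simp: supp_def)
qed

lemma ent_mult_supp:
  assumes "supp N x \<or> supp N (y :: 'a fmat)"
  shows "ent (x * y) i j = (\<Sum>k<N. ent x i k * ent y k j)"
proof -
  obtain K where K: "supp K x" "supp K y" by (rule ex_supp2)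
  have eq: "ent (x * y) = (\<lambda>i j. \<Sum>k | ent x i k \<noteq> 0. ent x i k * ent y k j)"
    unfolding times_fmat_def
    by (rule ent_Fmat[of K]) (use K in \<open>auto simp: supp_def intro!: sum.neutral\<close>)
  have fin: "finite {k. ent x i k \<noteq> 0}"
    by (rule finite_subset[of _ "{..<K}"]) (auto dest: suppD[OF K(1)])
  have "(\<Sum>k | ent x i k \<noteq> 0. ent x i k * ent y k j)
      = (\<Sum>k\<in>{k. ent x i k \<noteq> 0} \<union> {..<N}. ent x i k * ent y k j)"
    by (rule sum.mono_neutral_left) (use fin in auto)
  also have "\<dots> = (\<Sum>k<N. ent x i k * ent y k j)"
  proof (rule sum.mono_neutral_right)
    show "\<forall>k\<in>{k. ent x i k \<noteq> 0} \<union> {..<N} - {..<N}. ent x i k * ent y k j = 0"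
    proof
      fix k assume "k \<in> {k. ent x i k \<noteq> 0} \<union> {..<N} - {..<N}"
      then have "N \<le> k" by auto
      then have "ent x i k = 0 \<or> ent y k j = 0" using assms by (auto simp: supp_def)
      then show "ent x i k * ent y k j = 0" by auto
    qed
  qed (use fin in auto)
  finally show ?thesis by (simp add: eq)
qed

lemma supp_zero [simp]: "supp N (0 :: 'a fmat)"
  and supp_add: "supp N x \<Longrightarrow> supp N y \<Longrightarrow> supp N (x + y :: 'a fmat)"
  and supp_diff: "supp N x \<Longrightarrow> supp N y \<Longrightarrow> supp N (x - y :: 'a fmat)"
  by (auto simp: supp_def)

lemma supp_mult: "supp N x \<Longrightarrow> supp N y \<Longrightarrow> supp N (x * y :: 'a fmat)"
  by (subst supp_def) (auto simp: ent_mult_supp[of N x y] intro!: sum.neutral, auto simp: supp_def)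

instance
proof
  fix x y z :: "'a fmat"
  show "x + y + z = x + (y + z)" "x + y = y + x" "0 + x = x" "- x + x = 0" "x - y = x + - y"
    by (rule fmat_eqI; simp add: add.assoc add.commute)+
  obtain N where N: "supp N x" "supp N y" "supp N z" by (rule ex_supp3)
  show "(x + y) * z = x * z + y * z" "x * (y + z) = x * y + x * z"
    by (rule fmat_eqI; simp add: ent_mult_supp[of N] N supp_add sum.distrib distrib_left distrib_right)+
  show "x * y * z = x * (y * z)"
  proof (rule fmat_eqI)
    fix i j
    have "ent (x * y * z) i j = (\<Sum>l<N. \<Sum>k<N. ent x i k * ent y k l * ent z l j)"
      using N by (simp add: ent_mult_supp[of N] supp_mult sum_distrib_right)
    also have "\<dots> = (\<Sum>k<N. \<Sum>l<N. ent x i k * ent y k l * ent z l j)" by (rule sum.swap)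
    also have "\<dots> = ent (x * (y * z)) i j"
      using N by (simp add: ent_mult_supp[of N] supp_mult sum_distrib_left mult.assoc)
    finally show "ent (x * y * z) i j = ent (x * (y * z)) i j" .
  qed
qed

end

lemma ent_sum: "ent (\<Sum>a\<in>I. f a) i j = (\<Sum>a\<in>I. ent (f a :: 'r::ring fmat) i j)"
  by (induction I rule: infinite_finite_induct) auto

instantiation fmat :: (real_normed_algebra) real_normed_algebra
begin

definition "scaleR r x = Fmat (\<lambda>i j. scaleR r (ent x i j))"
text \<open>Submultiplicative, and equivalent to entrywise convergence on matrices of bounded
  size.\<close>

definition "norm x = (\<Sum>(i, j) | ent x i j \<noteq> 0. norm (ent x i j))"
definition "sgn (x :: 'a fmat) = scaleR (inverse (norm x)) x"
definition "dist x (y :: 'a fmat) = norm (x - y)"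
definition [code del]: "(uniformity :: ('a fmat \<times> 'a fmat) filter) =
  (INF e\<in>{0 <..}. principal {(x, y). dist x y < e})"
definition [code del]: "open (U :: 'a fmat set) \<longleftrightarrow>
  (\<forall>x\<in>U. eventually (\<lambda>(x', y). x' = x \<longrightarrow> y \<in> U) uniformity)"

lemma ent_scaleR [simp]: "ent (scaleR r x) i j = scaleR r (ent (x :: 'a fmat) i j)"
proof -
  obtain N where "supp N x" using ex_supp by blast
  then show ?thesis unfolding scaleR_fmat_def by (subst ent_Fmat[of N]) (auto simp: supp_def)
qed

lemma supp_scaleR: "supp N x \<Longrightarrow> supp N (scaleR r x :: 'a fmat)"
  by (auto simp: supp_def)

lemma norm_fmat_supp:
  assumes "supp N (x :: 'a fmat)"
  shows "norm x = (\<Sum>i<N. \<Sum>j<N. norm (ent x i j))"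
proof -
  have "norm x = (\<Sum>(i, j)\<in>{..<N} \<times> {..<N}. norm (ent x i j))"
    unfolding norm_fmat_def
    by (intro sum.mono_neutral_left) (auto dest: suppD[OF assms])
  then show ?thesis by (simp add: sum.cartesian_product)
qed

instance
proof
  fix x y :: "'a fmat" and r s :: real
  show "scaleR r (x + y) = scaleR r x + scaleR r y" "scaleR (r + s) x = scaleR r x + scaleR s x"
    "scaleR r (scaleR s x) = scaleR (r * s) x" "scaleR 1 x = x"
    by (rule fmat_eqI; simp add: algebra_simps)+
  obtain N where N: "supp N x" "supp N y" by (rule ex_supp2)
  show "scaleR r x * y = scaleR r (x * y)" "x * scaleR r y = scaleR r (x * y)"
    by (rule fmat_eqI; simp add: ent_mult_supp[of N] N supp_scaleR scaleR_sum_right)+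
  show "dist x y = norm (x - y)" by (rule dist_fmat_def)
  show "sgn x = scaleR (inverse (norm x)) x" by (rule sgn_fmat_def)
  show "(uniformity :: ('a fmat \<times> 'a fmat) filter) =
      (INF e\<in>{0 <..}. principal {(x, y). dist x y < e})" by (rule uniformity_fmat_def)
  show "open U \<longleftrightarrow> (\<forall>x\<in>U. \<forall>\<^sub>F (x', y) in uniformity. x' = x \<longrightarrow> y \<in> U)" for U :: "'a fmat set"
    by (rule open_fmat_def)
  show "norm x = 0 \<longleftrightarrow> x = 0"
  proof
    assume "norm x = 0"
    then have "\<forall>i<N. \<forall>j<N. ent x i j = 0"
      by (simp add: norm_fmat_supp[OF N(1)] sum_nonneg_eq_0_iff sum_nonneg)
    then show "x = 0" using N by (intro fmat_eqI_supp[of N]) auto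
  qed (simp add: norm_fmat_def)
  show "norm (x + y) \<le> norm x + norm y"
    unfolding norm_fmat_supp[OF N(1)] norm_fmat_supp[OF N(2)] norm_fmat_supp[OF supp_add[OF N]]
    by (simp add: norm_triangle_ineq sum_mono flip: sum.distrib)
  show "norm (scaleR r x) = \<bar>r\<bar> * norm x"
    unfolding norm_fmat_supp[OF N(1)] norm_fmat_supp[OF supp_scaleR[OF N(1)]]
    by (simp add: sum_distrib_left)
  show "norm (x * y) \<le> norm x * norm y"
  proof -
    have "norm (x * y) \<le> (\<Sum>i<N. \<Sum>j<N. \<Sum>k<N. norm (ent x i k) * norm (ent y k j))"
      unfolding norm_fmat_supp[OF supp_mult[OF N]] ent_mult_supp[OF disjI1, OF N(1)]
      by (intro sum_mono order_trans[OF norm_sum] norm_mult_ineq)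
    also have "\<dots> = (\<Sum>i<N. \<Sum>k<N. norm (ent x i k) * (\<Sum>j<N. norm (ent y k j)))"
      unfolding sum_distrib_left by (rule sum.cong[OF refl]) (rule sum.swap)
    also have "\<dots> \<le> (\<Sum>i<N. \<Sum>k<N. norm (ent x i k) * norm y)"
      unfolding norm_fmat_supp[OF N(2)]
      by (intro sum_mono mult_left_mono member_le_sum[of _ _ "\<lambda>k. \<Sum>j<N. norm (ent y k j)"])
        (auto intro: sum_nonneg)
    also have "\<dots> = norm x * norm y"
      unfolding norm_fmat_supp[OF N(1)] sum_distrib_right ..
    finally show ?thesis .
  qed
qed

end

lemma norm_ent_le: "norm (ent x i j) \<le> norm (x :: 'r::real_normed_algebra fmat)"
proof -
  obtain N where N: "supp N x" using ex_supp by blast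
  show ?thesis
  proof (cases "i < N \<and> j < N")
    case True
    then have "norm (ent x i j) \<le> (\<Sum>j<N. norm (ent x i j))" by (intro member_le_sum) auto
    also have "\<dots> \<le> norm x" unfolding norm_fmat_supp[OF N] using True
      by (intro member_le_sum[of _ _ "\<lambda>i. \<Sum>j<N. norm (ent x i j)"]) (auto intro: sum_nonneg)
    finally show ?thesis .
  qed (use N in \<open>auto simp: supp_def not_less\<close>)
qed

lemma bounded_linear_ent: "bounded_linear (\<lambda>x :: 'r::real_normed_algebra fmat. ent x i j)"
  by (rule bounded_linear_intro[where K = 1]) (simp_all add: norm_ent_le)

lemma continuous_on_ent [continuous_intros]:
  "continuous_on S f \<Longrightarrow> continuous_on S (\<lambda>s. ent (f s :: 'r::real_normed_algebra fmat) i j)"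
  by (rule bounded_linear.continuous_on[OF bounded_linear_ent])

lemma tendsto_fmat:
  fixes f :: "'b \<Rightarrow> 'r::real_normed_algebra fmat"
  assumes "\<And>i j. ((\<lambda>s. ent (f s) i j) \<longlongrightarrow> ent l i j) F" "\<And>s. supp N (f s)" "supp N l"
  shows "(f \<longlongrightarrow> l) F"
proof -
  have "((\<lambda>s. norm (f s - l)) \<longlongrightarrow> (\<Sum>i<N. \<Sum>j<N. norm (ent l i j - ent l i j))) F"
    unfolding norm_fmat_supp[OF supp_diff[OF assms(2,3)]] ent_diff
    by (intro tendsto_intros assms)
  then have "((\<lambda>s. norm (f s - l)) \<longlongrightarrow> 0) F" by simp
  then show ?thesis by (rule LIM_zero_cancel[OF tendsto_norm_zero_cancel])
qed

lemma continuous_on_fmat: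
  fixes f :: "'b::topological_space \<Rightarrow> 'r::real_normed_algebra fmat"
  assumes "\<And>i j. continuous_on S (\<lambda>s. ent (f s) i j)" "\<And>s. s \<in> S \<Longrightarrow> supp N (f s)"
  shows "continuous_on S f"
proof -
  have "continuous_on S (\<lambda>s. if s \<in> S then f s else 0)"
    unfolding continuous_on_def
  proof
    fix x assume x: "x \<in> S"
    have "((\<lambda>s. ent (if s \<in> S then f s else 0) i j) \<longlongrightarrow> ent (f x) i j) (at x within S)" for i j
    proof (rule Lim_transform_eventually)
      show "((\<lambda>s. ent (f s) i j) \<longlongrightarrow> ent (f x) i j) (at x within S)"
        using assms(1) x by (simp add: continuous_on_def)
    qed (auto simp: eventually_at_filter)
    then show "((\<lambda>s. if s \<in> S then f s else 0) \<longlongrightarrow> (if x \<in> S then f x else 0)) (at x within S)"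
      using assms x
      by (intro tendsto_fmat[of _ _ _ N]) auto
  qed
  then show ?thesis by (simp cong: continuous_on_cong)
qed

text \<open>The size is fixed because a Cauchy sequence of growing matrices may have no finitely
  supported limit.\<close>

lemma complete_fmat:
  fixes S :: "'r::{real_normed_algebra, banach} set"
  assumes "closed S"
  shows "complete {x. supp N x \<and> (\<forall>i j. ent x i j \<in> S)}"
  unfolding complete_def
proof (intro allI impI)
  fix X :: "nat \<Rightarrow> 'r fmat"
  assume X: "(\<forall>n. X n \<in> {x. supp N x \<and> (\<forall>i j. ent x i j \<in> S)}) \<and> Cauchy X"
  have "\<exists>l. (\<lambda>n. ent (X n) i j) \<longlonglongrightarrow> l" for i j
    using bounded_linear.Cauchy[OF bounded_linear_ent] X Cauchy_convergent
    by (force simp: convergent_def)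
  then obtain L where L: "\<And>i j. (\<lambda>n. ent (X n) i j) \<longlonglongrightarrow> L i j" by metis
  have L0: "L i j = 0" if "N \<le> i \<or> N \<le> j" for i j
  proof -
    have "(\<lambda>n. ent (X n) i j) = (\<lambda>n. 0)" using X that by (auto simp: supp_def)
    then show ?thesis using L[of i j] by (simp add: LIMSEQ_const_iff)
  qed
  have e: "ent (Fmat L) = L" by (rule ent_Fmat[of N]) (rule L0)
  have "X \<longlonglongrightarrow> Fmat L"
    by (rule tendsto_fmat[of _ _ _ N]) (use X L L0 in \<open>auto simp: e supp_def\<close>)
  moreover have "L i j \<in> S" for i j
    using closed_sequentially[OF assms _ L[of i j]] X by auto
  ultimately show "\<exists>l\<in>{x. supp N x \<and> (\<forall>i j. ent x i j \<in> S)}. X \<longlonglongrightarrow> l"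
    using L0 by (intro bexI[of _ "Fmat L"]) (auto simp: e supp_def)
qed

section \<open>Adjoints, shifts and local units of matrices\<close>

definition star :: "'r::cstar_algebra fmat \<Rightarrow> 'r fmat" where
  "star x = Fmat (\<lambda>i j. adj (ent x j i))"

lemma ent_star [simp]: "ent (star x) i j = adj (ent x j i)"
proof -
  obtain N where "supp N x" using ex_supp by blast
  then show ?thesis unfolding star_def by (subst ent_Fmat[of N]) (auto simp: supp_def)
qed

lemma supp_star: "supp N x \<Longrightarrow> supp N (star x)"
  by (auto simp: supp_def)

lemma star_star [simp]: "star (star x) = x"
  and star_add: "star (x + y) = star x + star y"
  and star_diff: "star (x - y) = star x - star y"
  and star_zero [simp]: "star 0 = 0"
  by (auto intro!: fmat_eqI simp: adj_adj adj_add adj_diff)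

lemma star_mult: "star (x * y) = star y * star x"
proof (rule fmat_eqI)
  fix i j
  obtain N where N: "supp N x" "supp N y" by (rule ex_supp2)
  then show "ent (star (x * y)) i j = ent (star y * star x) i j"
    by (simp add: ent_mult_supp[of N] supp_star adj_sum adj_mult)
qed

lemma star_sum: "star (\<Sum>i\<in>I. f i) = (\<Sum>i\<in>I. star (f i))"
  by (induction I rule: infinite_finite_induct) (auto simp: star_add)

text \<open>If \<open>supp K x\<close>, then \<open>x + sh K y\<close> is the block sum of
  \<open>x\<close> and \<open>y\<close>.\<close>

definition sh :: "nat \<Rightarrow> 'r::zero fmat \<Rightarrow> 'r fmat" where
  "sh K x = Fmat (\<lambda>i j. if K \<le> i \<and> K \<le> j then ent x (i - K) (j - K) else 0)"

lemma ent_sh [simp]: "ent (sh K x) i j = (if K \<le> i \<and> K \<le> j then ent x (i - K) (j - K) else 0)"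
proof -
  obtain N where "supp N x" using ex_supp by blast
  then show ?thesis unfolding sh_def by (subst ent_Fmat[of "N + K"]) (auto simp: supp_def)
qed

lemma supp_sh: "supp N x \<Longrightarrow> supp (K + N) (sh K x)"
  by (auto simp: supp_def)

lemma sh_zero [simp]: "sh K 0 = (0 :: 'r::ring fmat)"
  and sh_add: "sh K (x + y) = sh K x + sh K (y :: 'r::ring fmat)"
  by (auto intro!: fmat_eqI)

lemma star_sh: "star (sh K x) = sh K (star x)"
  by (auto intro!: fmat_eqI)

lemma sh_orth:
  assumes "supp N (x :: 'r::ring fmat)" "N \<le> K"
  shows "x * sh K y = 0" "sh K y * x = 0"
proof -
  have "ent (x * sh K y) i j = 0" "ent (sh K y * x) i j = 0" for i j
    unfolding ent_mult_supp[OF disjI1, OF assms(1)] ent_mult_supp[OF disjI2, OF assms(1)]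
    using assms(2) by (auto intro!: sum.neutral)
  then show "x * sh K y = 0" "sh K y * x = 0" by (auto intro!: fmat_eqI)
qed

definition blk :: "nat \<Rightarrow> 'r::ring_1 fmat" where
  "blk N = Fmat (\<lambda>i j. if i = j \<and> i < N then 1 else 0)"

lemma ent_blk [simp]: "ent (blk N :: 'r::ring_1 fmat) i j = (if i = j \<and> i < N then 1 else 0)"
  unfolding blk_def by (subst ent_Fmat[of N]) auto

lemma supp_blk: "supp N (blk N :: 'r::ring_1 fmat)"
  by (auto simp: supp_def)

lemma blk_mult: "supp N x \<Longrightarrow> blk N * x = (x :: 'r::ring_1 fmat)"
  and mult_blk: "supp N x \<Longrightarrow> x * blk N = (x :: 'r::ring_1 fmat)"
proof -
  assume x: "supp N x"
  have "ent (blk N * x) i j = (\<Sum>k<N. if k = i then ent x k j else 0)" for i j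
    unfolding ent_mult_supp[OF disjI2, OF x] by (intro sum.cong) auto
  moreover have "ent (x * blk N) i j = (\<Sum>k<N. if k = j then ent x i k else 0)" for i j
    unfolding ent_mult_supp[OF disjI1, OF x] by (intro sum.cong) auto
  ultimately show "blk N * x = x" "x * blk N = x"
    using x by (auto intro!: fmat_eqI simp: supp_def)
qed

lemma supp_iff_blk: "supp N x \<longleftrightarrow> blk N * x = x \<and> x * blk N = (x :: 'r::ring_1 fmat)"
proof
  assume *: "blk N * x = x \<and> x * blk N = x"
  show "supp N x"
    unfolding supp_def
  proof (intro allI impI)
    fix i j assume "N \<le> i \<or> N \<le> j"
    then show "ent x i j = 0"
    proof
      assume "N \<le> i"
      then have "ent (blk N * x) i j = 0"
        unfolding ent_mult_supp[OF disjI1, OF supp_blk] by (intro sum.neutral) auto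
      with * show ?thesis by simp
    next
      assume "N \<le> j"
      then have "ent (x * blk N) i j = 0"
        unfolding ent_mult_supp[OF disjI2, OF supp_blk] by (intro sum.neutral) auto
      with * show ?thesis by simp
    qed
  qed
qed (simp add: blk_mult mult_blk)

text \<open>A partial isometry with scalar entries that moves the first \<open>N\<close> coordinates
  by \<open>K\<close>; on matrices supported there, conjugation by it is the shift
  \<open>sh K\<close>.\<close>

definition isom :: "nat \<Rightarrow> nat \<Rightarrow> 'r::ring_1 fmat" where
  "isom K N = Fmat (\<lambda>i j. if i = K + j \<and> j < N then 1 else 0)"

lemma ent_isom [simp]: "ent (isom K N :: 'r::ring_1 fmat) i j = (if i = K + j \<and> j < N then 1 else 0)"
  unfolding isom_def by (subst ent_Fmat[of "K + N"]) auto

lemma supp_isom: "supp (K + N) (isom K N :: 'r::ring_1 fmat)"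
  by (auto simp: supp_def)

lemma star_blk [simp]: "star (blk N) = (blk N :: 'r::{cstar_algebra, real_normed_algebra_1} fmat)"
  by (auto intro!: fmat_eqI)

lemma isom_star_isom: "star (isom K N) * isom K N = (blk N :: 'r::{cstar_algebra, real_normed_algebra_1} fmat)"
proof (rule fmat_eqI)
  fix i j
  have "ent (star (isom K N) * isom K N :: 'r fmat) i j
      = (\<Sum>k<K+N. if k = K + i then if i = j \<and> i < N then 1 else 0 else 0)"
    unfolding ent_mult_supp[OF disjI2, OF supp_isom] by (rule sum.cong) auto
  then show "ent (star (isom K N) * isom K N :: 'r fmat) i j = ent (blk N) i j" by auto
qed

lemma isom_mult:
  fixes x :: "'r::{cstar_algebra, real_normed_algebra_1} fmat"
  assumes "supp N x"
  shows "isom K N * x = sh K x * isom K N"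
proof (rule fmat_eqI)
  fix i j
  have "ent (isom K N * x) i j = (\<Sum>k<N. (if i = K + k then 1 else 0) * ent x k j)"
    using assms by (subst ent_mult_supp[of N]) (auto intro: sum.cong)
  also have "\<dots> = (if K \<le> i \<and> i < K + N then ent x (i - K) j else 0)"
  proof -
    have "(\<Sum>k<N. (if i = K + k then 1 else 0) * ent x k j)
        = (\<Sum>k<N. if k = i - K then if K \<le> i then ent x k j else 0 else 0)"
      by (rule sum.cong) auto
    then show ?thesis by auto
  qed
  also have "\<dots> = (\<Sum>k<K+N. if k = K + j then if j < N then ent (sh K x) i k else 0 else 0)"
    using assms by (auto simp: supp_def)
  also have "\<dots> = ent (sh K x * isom K N) i j"
    unfolding ent_mult_supp[OF disjI2, OF supp_isom] by (rule sum.cong) auto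
  finally show "ent (isom K N * x) i j = ent (sh K x * isom K N) i j" .
qed

lemma isom_isom_star:
  "isom K N * star (isom K N) = sh K (blk N :: 'r::{cstar_algebra, real_normed_algebra_1} fmat)"
proof (rule fmat_eqI)
  fix i j
  have "ent (isom K N * star (isom K N :: 'r fmat)) i j = (\<Sum>k<K+N. if k = i - K then if i = j \<and> K \<le> i \<and> i - K < N then 1 else 0 else 0)"
    unfolding ent_mult_supp[OF disjI1, OF supp_isom] by (rule sum.cong) auto
  then show "ent (isom K N * star (isom K N :: 'r fmat)) i j = ent (sh K (blk N)) i j" by auto
qed

lemma sh_isom:
  fixes x :: "'r::{cstar_algebra, real_normed_algebra_1} fmat"
  assumes "supp N x"
  shows "sh K x = isom K N * x * star (isom K N)"
proof -
  have "isom K N * x * star (isom K N) = sh K x * sh K (blk N)"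
    by (simp add: isom_mult[OF assms] mult.assoc isom_isom_star)
  also have "\<dots> = sh K (x * blk N)"
  proof (rule fmat_eqI)
    fix i j
    show "ent (sh K x * sh K (blk N)) i j = ent (sh K (x * blk N)) i j"
    proof (cases "K \<le> i \<and> K \<le> j")
      case True
      have "ent (sh K x * sh K (blk N)) i j = (\<Sum>k<K+N. if k = j then ent (sh K x) i k else 0)"
        unfolding ent_mult_supp[OF disjI1, OF supp_sh[OF assms]] using True
        by (intro sum.cong) auto
      with True show ?thesis using assms by (auto simp: mult_blk supp_def)
    next
      case False
      then show ?thesis unfolding ent_mult_supp[OF disjI1, OF supp_sh[OF assms]]
        by (auto intro!: sum.neutral)
    qed
  qed
  finally show ?thesis by (simp add: mult_blk assms)
qed

lemma sh_mult:
  fixes x :: "'r::{cstar_algebra, real_normed_algebra_1} fmat"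
  shows "sh K (x * y) = sh K x * sh K y"
proof -
  obtain N where N: "supp N x" "supp N y" by (rule ex_supp2)
  have "sh K x * sh K y = isom K N * (x * (star (isom K N) * isom K N)) * y * star (isom K N)"
    by (simp add: sh_isom[OF N(1)] sh_isom[OF N(2)] mult.assoc)
  also have "\<dots> = isom K N * (x * y) * star (isom K N)"
    by (simp add: isom_star_isom N mult_blk mult.assoc)
  also have "\<dots> = sh K (x * y)" by (simp add: sh_isom[OF supp_mult[OF N]])
  finally show ?thesis ..
qed

lemma continuous_on_sh:
  fixes f :: "'b::topological_space \<Rightarrow> 'r::{cstar_algebra, real_normed_algebra_1} fmat"
  assumes "continuous_on S f" "\<And>s. s \<in> S \<Longrightarrow> supp N (f s)"
  shows "continuous_on S (\<lambda>s. sh K (f s))"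
proof (rule continuous_on_fmat[of _ _ "K + N"])
  show "continuous_on S (\<lambda>s. ent (sh K (f s)) i j)" for i j
    by (cases "K \<le> i \<and> K \<le> j") (auto intro: continuous_intros assms)
qed (simp add: supp_sh assms)

section \<open>Lifting along a surjection \<open>C' \<rightarrow> C / A\<close>\<close>

text \<open>The open mapping theorem for the sum map \<open>X \<times> Y \<rightarrow> X + Y\<close>.\<close>

lemma bounded_lift:
  fixes X Y :: "'b::banach set"
  assumes X: "subspace X" "closed X" and Y: "subspace Y" "closed Y"
    and XY: "\<And>z. \<exists>x\<in>X. z - x \<in> Y"
  obtains M where "M > 0" "\<And>z. \<exists>x\<in>X. z - x \<in> Y \<and> norm x \<le> M * norm z"
proof -
  define T where "T r = {z. \<exists>x\<in>X. z - x \<in> Y \<and> norm x \<le> r}" for r :: real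
  have T_diff: "u - v \<in> T (r + s)" if u: "u \<in> T r" and v: "v \<in> T s" for u v r s
  proof -
    obtain x where x: "x \<in> X" "u - x \<in> Y" "norm x \<le> r" using u by (auto simp: T_def)
    obtain y where y: "y \<in> X" "v - y \<in> Y" "norm y \<le> s" using v by (auto simp: T_def)
    have "u - v - (x - y) = (u - x) - (v - y)" by simp
    then have "u - v - (x - y) \<in> Y" using x y Y subspace_diff by metis
    moreover have "norm (x - y) \<le> r + s" using norm_triangle_ineq4[of x y] x y by simp
    moreover have "x - y \<in> X" using X x y subspace_diff by blast
    ultimately show ?thesis unfolding T_def by blast
  qed
  have T_scale: "scaleR c u \<in> T (c * r)" if u: "u \<in> T r" and c: "c \<ge> 0" for u r c
  proof -
    obtain x where x: "x \<in> X" "u - x \<in> Y" "norm x \<le> r" using u by (auto simp: T_def)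
    have "scaleR c u - scaleR c x = scaleR c (u - x)" by (simp add: scaleR_diff_right)
    then have "scaleR c u - scaleR c x \<in> Y" using x Y subspace_scale by metis
    then show ?thesis using x c X subspace_scale
      unfolding T_def by (auto intro!: bexI[of _ "scaleR c x"] mult_left_mono)
  qed
  \<comment> \<open>Baire category: every \<open>z\<close> lies in some \<open>T n\<close>, so the
    closure of one of these sets has an interior point.\<close>
  have "\<exists>n::nat. interior (closure (T (real n))) \<noteq> {}"
  proof (rule ccontr)
    assume "\<not> ?thesis"
    then have "euclidean interior_of \<Union>(range (\<lambda>n::nat. closure (T (real n)))) = {}"
      by (intro Baire_category_alt) (auto simp: completely_metrizable_space_euclidean)
    moreover have "z \<in> \<Union>(range (\<lambda>n::nat. closure (T (real n))))" for z
    proof -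
      obtain x where x: "x \<in> X" "z - x \<in> Y" using XY by blast
      obtain n :: nat where "norm x \<le> real n" using real_arch_simple by blast
      then have "z \<in> T (real n)" using x by (auto simp: T_def)
      then show ?thesis using closure_subset by fastforce
    qed
    then have "\<Union>(range (\<lambda>n::nat. closure (T (real n)))) = UNIV" by blast
    ultimately show False by simp
  qed
  then obtain n :: nat and z0 where "z0 \<in> interior (closure (T (real n)))" by blast
  then obtain e where e: "e > 0" "cball z0 e \<subseteq> closure (T (real n))"
    by (meson mem_interior_cball)
  define R where "R = 2 * real n / e"
  have R: "R \<ge> 0" using e by (simp add: R_def)
  \<comment> \<open>Elements of \<open>T n\<close> near \<open>z0 + w\<close> and near
    \<open>z0\<close> have a difference close to \<open>w\<close>, which is \<open>z\<close>
    rescaled to norm \<open>e\<close>; scaling back gives an approximant of \<open>z\<close> whose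
    lift is controlled.\<close>
  have approx: "\<exists>t\<in>T (R * norm z). norm (z - t) \<le> norm z / 2" for z
  proof (cases "z = 0")
    case True
    have "0 \<in> T 0" using X Y subspace_0 by (auto simp: T_def intro!: bexI[of _ 0])
    then show ?thesis using True by auto
  next
    case False
    define c where "c = norm z / e"
    have c: "c > 0" using False e by (simp add: c_def)
    define w where "w = scaleR (1 / c) z"
    have nw: "norm w = e" using False e by (simp add: w_def c_def)
    have "z0 + w \<in> closure (T (real n))" "z0 \<in> closure (T (real n))"
      using e nw by (auto simp: subset_iff dist_norm)
    then obtain u v where u: "u \<in> T (real n)" "dist u (z0 + w) < e / 4"
      and v: "v \<in> T (real n)" "dist v z0 < e / 4"
      unfolding closure_approachable using e by (meson divide_pos_pos zero_less_numeral)
    have uv: "u - v \<in> T (2 * real n)" using T_diff[OF u(1) v(1)] by simp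
    have "norm (w - (u - v)) = norm ((v - z0) - (u - (z0 + w)))" by (simp add: algebra_simps)
    also have "\<dots> \<le> e / 2" using norm_triangle_ineq4[of "v - z0" "u - (z0 + w)"] u v
      by (simp add: dist_norm)
    finally have wuv: "norm (w - (u - v)) \<le> e / 2" .
    have "z - scaleR c (u - v) = scaleR c (w - (u - v))"
      using c by (simp add: w_def scaleR_diff_right)
    then have "norm (z - scaleR c (u - v)) \<le> c * (e / 2)" using wuv c by simp
    also have "\<dots> = norm z / 2" using e by (simp add: c_def)
    finally have "norm (z - scaleR c (u - v)) \<le> norm z / 2" .
    moreover have "scaleR c (u - v) \<in> T (c * (2 * real n))" using T_scale[OF uv] c by simp
    moreover have "c * (2 * real n) = R * norm z" by (simp add: c_def R_def)
    ultimately show ?thesis by metis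
  qed
  \<comment> \<open>Successive approximation: each correction at least halves the residual
    \<open>r k\<close>, so the lifts \<open>g k\<close> are summable. \<open>2 * R\<close> is the
    geometric series, and the summand 1 keeps the constant positive.\<close>
  have "\<exists>x\<in>X. z - x \<in> Y \<and> norm x \<le> (2 * R + 1) * norm z" for z
  proof -
    obtain f where f: "\<And>z. f z \<in> T (R * norm z)" "\<And>z. norm (z - f z) \<le> norm z / 2"
      using approx by metis
    define r where "r k = ((\<lambda>z. z - f z) ^^ k) z" for k
    have r0: "r 0 = z" and rS: "r (Suc k) = r k - f (r k)" for k by (simp_all add: r_def)
    have nr: "norm (r k) \<le> norm z * (1/2) ^ k" for k
    proof (induction k)
      case (Suc k)
      have "norm (r (Suc k)) \<le> norm (r k) / 2" using f(2) by (simp add: rS)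
      with Suc show ?case by simp
    qed (simp add: r0)
    have "\<exists>x\<in>X. f (r k) - x \<in> Y \<and> norm x \<le> R * norm (r k)" for k using f(1)[of "r k"] by (simp add: T_def)
    then obtain g where g: "\<And>k. g k \<in> X" "\<And>k. f (r k) - g k \<in> Y" "\<And>k. norm (g k) \<le> R * norm (r k)" by metis
    have ng: "norm (g k) \<le> R * norm z * (1/2) ^ k" for k
      using order_trans[OF g(3) mult_left_mono[OF nr R]] by (simp add: mult.assoc)
    have sg: "summable (\<lambda>k. R * norm z * (1/2) ^ k)" by (intro summable_mult summable_geometric) simp
    have sng: "summable (\<lambda>k. norm (g k))" by (rule summable_comparison_test'[OF sg, of 0]) (use ng in simp)
    define x where "x = suminf g"
    have lim: "(\<lambda>m. \<Sum>k<m. g k) \<longlonglongrightarrow> x"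
      unfolding x_def by (rule summable_LIMSEQ) (rule summable_norm_cancel[OF sng])
    have "x \<in> X" by (rule closed_sequentially[OF X(2) _ lim]) (intro subspace_sum X g)
    moreover have "z - x \<in> Y"
    proof (rule closed_sequentially[OF Y(2)])
      show "(\<Sum>k<m. f (r k) - g k) \<in> Y" for m by (intro subspace_sum Y g)
      have "(\<Sum>k<m. f (r k)) = z - r m" for m by (induction m) (auto simp: r0 rS)
      then have "(\<lambda>m. \<Sum>k<m. f (r k) - g k) = (\<lambda>m. z - r m - (\<Sum>k<m. g k))"
        by (simp add: sum_subtractf)
      moreover have "r \<longlonglongrightarrow> 0"
      proof (rule Lim_null_comparison)
        show "(\<lambda>k. norm z * (1/2) ^ k) \<longlonglongrightarrow> 0"
          by (intro tendsto_mult_right_zero LIMSEQ_power_zero) simp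
      qed (use nr in simp)
      ultimately show "(\<lambda>m. \<Sum>k<m. f (r k) - g k) \<longlonglongrightarrow> z - x"
        using lim by (auto intro!: tendsto_eq_intros)
    qed
    moreover have "norm x \<le> (2 * R + 1) * norm z"
    proof -
      have "norm x \<le> (\<Sum>k. norm (g k))" unfolding x_def by (rule summable_norm[OF sng])
      also have "\<dots> \<le> (\<Sum>k. R * norm z * (1/2) ^ k)" by (rule suminf_le[OF ng sng sg])
      also have "\<dots> = R * norm z * 2" by (simp add: suminf_mult suminf_geometric)
      also have "\<dots> \<le> (2 * R + 1) * norm z" by (simp add: algebra_simps)
      finally show ?thesis .
    qed
    ultimately show ?thesis by blast
  qed
  then show thesis using R by (intro that[of "2 * R + 1"]) auto
qed

section \<open>Matrices over the unitizations of subalgebras and ideals\<close>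

lemma complex_subspace_subspace: "complex_subspace S \<Longrightarrow> subspace S"
  unfolding complex_subspace_def subspace_def by (metis scaleC_of_real)

lemma subspace_cstar: "cstar_subalgebra B \<Longrightarrow> subspace B"
  and subspace_ideal: "closed_ideal A \<Longrightarrow> subspace A"
  by (simp_all add: cstar_subalgebra_def closed_ideal_def complex_subspace_subspace)

lemma cstar_subalgebra_UNIV: "cstar_subalgebra UNIV"
  by (simp add: cstar_subalgebra_def complex_subspace_def)

definition MB :: "'a::cstar_algebra set \<Rightarrow> 'a unitz fmat \<Rightarrow> bool" where
  "MB B x \<longleftrightarrow> (\<forall>i j. vect (ent x i j) \<in> B)"

text \<open>The kernel of the map to matrices over the unitization of the quotient by
  \<open>A\<close>; congruence modulo \<open>A\<close> is \<open>MI A (x - y)\<close>.\<close>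

definition MI :: "'a::cstar_algebra set \<Rightarrow> 'a unitz fmat \<Rightarrow> bool" where
  "MI A x \<longleftrightarrow> (\<forall>i j. scal (ent x i j) = 0 \<and> vect (ent x i j) \<in> A)"

lemma vect_sum: "vect (\<Sum>i\<in>I. f i) = (\<Sum>i\<in>I. vect (f i :: 'a::cstar_algebra unitz))"
  and scal_sum: "scal (\<Sum>i\<in>I. f i) = (\<Sum>i\<in>I. scal (f i :: 'a::cstar_algebra unitz))"
  by (induction I rule: infinite_finite_induct) auto

lemma MB_UNIV [simp]: "MB UNIV x"
  by (simp add: MB_def)

lemma MB_mono: "MB B x \<Longrightarrow> B \<subseteq> B' \<Longrightarrow> MB B' x"
  by (auto simp: MB_def)

lemma MB_Int: "MB (A \<inter> B) x \<longleftrightarrow> MB A x \<and> MB B x"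
  by (auto simp: MB_def)

context
  fixes B :: "'a::cstar_algebra set"
  assumes B: "cstar_subalgebra B"
begin

lemma MB_0 [simp]: "MB B 0"
  using B subspace_cstar[OF B, THEN subspace_0] by (simp add: MB_def)

lemma MB_add: "MB B x \<Longrightarrow> MB B y \<Longrightarrow> MB B (x + y)"
  using B subspace_cstar[OF B, THEN subspace_add] by (simp add: MB_def)

lemma MB_diff: "MB B x \<Longrightarrow> MB B y \<Longrightarrow> MB B (x - y)"
  using B subspace_cstar[OF B, THEN subspace_diff] by (simp add: MB_def)

lemma MB_minus: "MB B x \<Longrightarrow> MB B (- x)"
  using B subspace_cstar[OF B, THEN subspace_neg] by (simp add: MB_def)

lemma MB_scaleR: "MB B x \<Longrightarrow> MB B (scaleR r x)"
  using B subspace_cstar[OF B, THEN subspace_scale] by (simp add: MB_def)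

lemma MB_mult:
  assumes "MB B x" "MB B y"
  shows "MB B (x * y)"
proof -
  obtain N where N: "supp N x" using ex_supp by blast
  show ?thesis unfolding MB_def ent_mult_supp[OF disjI1, OF N] vect_sum
    using assms B subspace_cstar[OF B]
    by (auto simp: MB_def cstar_subalgebra_def complex_subspace_def intro!: subspace_sum)
qed

lemma MB_star: "MB B x \<Longrightarrow> MB B (star x)"
  using B by (simp add: MB_def cstar_subalgebra_def)

lemma MB_blk [simp]: "MB B (blk N)"
  using subspace_cstar[OF B, THEN subspace_0] by (auto simp: MB_def)

lemma MB_isom [simp]: "MB B (isom K N)"
  using subspace_cstar[OF B, THEN subspace_0] by (auto simp: MB_def)

lemma MB_sh: "MB B x \<Longrightarrow> MB B (sh K x)"
  using subspace_cstar[OF B, THEN subspace_0] by (auto simp: MB_def)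

lemma closed_vect: "closed {u. vect u \<in> B}"
proof -
  have "closed (vect -` B)"
    using B linear_continuous_on[OF bounded_linear_vect, of UNIV]
    by (intro closed_vimage) (auto simp: cstar_subalgebra_def continuous_on_eq_continuous_at)
  then show ?thesis by (simp add: vimage_def)
qed

lemma vect_closed_ops:
  "vect (1 :: 'a unitz) \<in> B"
  "vect u \<in> B \<Longrightarrow> vect v \<in> B \<Longrightarrow> vect (u + v) \<in> B \<and> vect (u * v) \<in> B"
  "vect u \<in> B \<Longrightarrow> vect (scaleR r u) \<in> B"
  "vect u \<in> B \<Longrightarrow> vect (adj u) \<in> B"
  using B subspace_cstar[OF B]
  by (auto simp: subspace_0 subspace_add subspace_scale cstar_subalgebra_def complex_subspace_def)

end

context
  fixes A :: "'a::cstar_algebra set"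
  assumes A: "closed_ideal A"
begin

lemma MI_0 [simp]: "MI A 0"
  using subspace_ideal[OF A, THEN subspace_0] by (simp add: MI_def)

lemma MI_add: "MI A x \<Longrightarrow> MI A y \<Longrightarrow> MI A (x + y)"
  using subspace_ideal[OF A, THEN subspace_add] by (simp add: MI_def)

lemma MI_diff: "MI A x \<Longrightarrow> MI A y \<Longrightarrow> MI A (x - y)"
  using subspace_ideal[OF A, THEN subspace_diff] by (simp add: MI_def)

lemma MI_minus: "MI A x \<Longrightarrow> MI A (- x)"
  using subspace_ideal[OF A, THEN subspace_neg] by (simp add: MI_def)

lemma MI_scaleR: "MI A x \<Longrightarrow> MI A (scaleR r x)"
  using subspace_ideal[OF A, THEN subspace_scale] by (simp add: MI_def)

lemma MI_mult:
  assumes "MI A x"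
  shows "MI A (x * y)" "MI A (y * x)"
proof -
  obtain N where N: "supp N x" using ex_supp by blast
  have *: "scaleC k a + a * b \<in> A" "scaleC k a + b * a \<in> A" if "a \<in> A" for k a b
    using that A subspace_ideal[OF A]
    by (auto simp: closed_ideal_def complex_subspace_def intro: subspace_add)
  have x: "scal (ent x i j) = 0" "vect (ent x i j) \<in> A" for i j using assms by (auto simp: MI_def)
  have "scal (ent (x * y) i j) = 0" "scal (ent (y * x) i j) = 0" for i j
    by (simp_all add: ent_mult_supp[of N] N scal_sum x)
  moreover have "vect (ent (x * y) i j) \<in> A" "vect (ent (y * x) i j) \<in> A" for i j
    unfolding ent_mult_supp[OF disjI1, OF N] ent_mult_supp[OF disjI2, OF N] vect_sum
    by (rule subspace_sum[OF subspace_ideal[OF A]]; simp add: x *)+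
  ultimately show "MI A (x * y)" "MI A (y * x)" by (simp_all add: MI_def)
qed

lemma MI_cong_mult: "MI A (x - x') \<Longrightarrow> MI A (y - y') \<Longrightarrow> MI A (x * y - x' * y')"
  using MI_add[OF MI_mult(1)[of "x - x'" y] MI_mult(2)[of "y - y'" x']]
  by (simp add: left_diff_distrib right_diff_distrib)

lemma MI_cong_trans: "MI A (x - y) \<Longrightarrow> MI A (y - z) \<Longrightarrow> MI A (x - z)"
  using MI_add[of "x - y" "y - z"] by simp

lemma MI_cong_sym: "MI A (x - y) \<Longrightarrow> MI A (y - x)"
  using MI_minus[of "x - y"] by simp

text \<open>The device for descending to \<open>A\<close>: scalar parts are unrestricted in
  \<open>MB\<close>, and vector parts change only by elements of \<open>A\<close>.\<close>

lemma MB_of_cong: "MI A (x - y) \<Longrightarrow> MB A y \<Longrightarrow> MB A x"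
proof -
  assume "MI A (x - y)" "MB A y"
  then have "vect (ent x i j) - vect (ent y i j) \<in> A" "vect (ent y i j) \<in> A" for i j
    by (auto simp: MI_def MB_def)
  then have "vect (ent x i j) \<in> A" for i j
    using subspace_add[OF subspace_ideal[OF A]] by (metis diff_add_cancel)
  then show "MB A x" by (simp add: MB_def)
qed

end

lemma lift_fmat:
  fixes A C' :: "'a::cstar_algebra set"
  assumes A: "closed_ideal A" and C': "cstar_subalgebra C'" and AC: "\<And>z. \<exists>x\<in>C'. z - x \<in> A"
  obtains M where "M > 0"
    "\<And>N z. supp N z \<Longrightarrow> \<exists>x. MB C' x \<and> MI A (z - x) \<and> supp N x \<and> norm x \<le> M * norm z"
proof -
  obtain M where M: "M > 0" "\<And>z. \<exists>x\<in>C'. z - x \<in> A \<and> norm x \<le> M * norm z"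
    using bounded_lift[of C' A] subspace_cstar[OF C'] subspace_ideal[OF A] A C' AC
    by (auto simp: closed_ideal_def cstar_subalgebra_def)
  obtain f where f: "\<And>z. f z \<in> C'" "\<And>z. z - f z \<in> A" "\<And>z. norm (f z) \<le> M * norm z"
    using M(2) by metis
  define g where "g u = Unitz (scal u) (f (vect u))" for u
  \<comment> \<open>The norm bound forces the lift of 0 to be 0, so lifting entry by entry does not
    enlarge the support.\<close>
  have f0: "f 0 = 0" using f(3)[of 0] by simp
  have g0: "g 0 = 0" by (rule unitz.expand) (simp add: g_def f0)
  have ng: "norm (g u) \<le> (1 + 2 * M) * norm u" for u
  proof -
    have "norm (g u) \<le> cmod (scal u) + norm (f (vect u))" using norm_unitz_le[of "g u"] by (simp add: g_def)
    also have "\<dots> \<le> norm u + M * (2 * norm u)"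
      using order_trans[OF f(3)[of "vect u"] mult_left_mono[OF norm_vect_le]] M(1) norm_scal_le[of u]
      by (simp add: add_mono)
    finally show ?thesis by (simp add: algebra_simps)
  qed
  have "\<exists>x. MB C' x \<and> MI A (z - x) \<and> supp N x \<and> norm x \<le> (1 + 2 * M) * norm z" if z: "supp N z" for N z
  proof -
    define x where "x = Fmat (\<lambda>i j. g (ent z i j))"
    have e: "ent x = (\<lambda>i j. g (ent z i j))"
      unfolding x_def by (rule ent_Fmat[of N]) (use z g0 in \<open>auto simp: supp_def\<close>)
    have sx: "supp N x" using z g0 by (auto simp: supp_def e)
    have "MB C' x" by (simp add: MB_def e g_def f)
    moreover have "MI A (z - x)" by (simp add: MI_def e g_def f)
    moreover have "norm x \<le> (1 + 2 * M) * norm z"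
      unfolding norm_fmat_supp[OF sx] norm_fmat_supp[OF z] sum_distrib_left e by (intro sum_mono ng)
    ultimately show ?thesis using sx by blast
  qed
  then show thesis using M(1) by (intro that[of "1 + 2 * M"]) auto
qed

section \<open>Idempotents are similar to projections\<close>

definition sgl :: "nat \<Rightarrow> 'r::zero \<Rightarrow> 'r fmat" where
  "sgl n a = Fmat (\<lambda>i j. if i = n \<and> j = n then a else 0)"

lemma ent_sgl [simp]: "ent (sgl n a) i j = (if i = n \<and> j = n then a else 0)"
  unfolding sgl_def by (subst ent_Fmat[of "Suc n"]) auto

lemma supp_sgl: "n < N \<Longrightarrow> supp N (sgl n a)"
  by (auto simp: supp_def)

lemma sgl_add: "sgl n a + sgl n b = sgl n (a + b :: 'r::ring)"
  by (auto intro!: fmat_eqI)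

lemma ent_sgl_mult: "ent (sgl n a * x) i j = (if i = n then a * ent x n j else (0 :: 'r::ring_1))"
proof -
  have "ent (sgl n a * x) i j = (\<Sum>k<Suc n. if k = n then if i = n then a * ent x n j else 0 else 0)"
    unfolding ent_mult_supp[OF disjI1, OF supp_sgl[OF lessI]] by (rule sum.cong) auto
  then show ?thesis by (auto simp del: sum.lessThan_Suc)
qed

lemma ent_mult_sgl: "ent (x * sgl n a) i j = (if j = n then ent x i n * a else (0 :: 'r::ring_1))"
proof -
  have "ent (x * sgl n a) i j = (\<Sum>k<Suc n. if k = n then if j = n then ent x i n * a else 0 else 0)"
    unfolding ent_mult_supp[OF disjI2, OF supp_sgl[OF lessI]] by (rule sum.cong) auto
  then show ?thesis by (auto simp del: sum.lessThan_Suc)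
qed

lemma sgl_mult: "sgl n a * sgl n b = sgl n (a * b :: 'r::ring_1)"
  by (rule fmat_eqI) (simp add: ent_sgl_mult)

lemma sgl_corner: "sgl n 1 * x * sgl n 1 = sgl n (ent x n n :: 'r::ring_1)"
  by (rule fmat_eqI) (simp add: ent_sgl_mult ent_mult_sgl)

lemma star_sgl_1 [simp]: "star (sgl n 1) = (sgl n 1 :: 'r::{cstar_algebra, real_normed_algebra_1} fmat)"
  by (auto intro!: fmat_eqI)

lemma blk_sum: "blk N = (\<Sum>k<N. sgl k 1 :: 'r::ring_1 fmat)"
proof (rule fmat_eqI)
  fix i j
  have "(\<Sum>k<N. if i = k \<and> j = k then 1 else (0 :: 'r)) = (\<Sum>k<N. if k = i then if i = j then 1 else 0 else 0)"
    by (rule sum.cong) auto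
  then show "ent (blk N) i j = ent (\<Sum>k<N. sgl k 1 :: 'r fmat) i j" by (auto simp: ent_sum)
qed

lemma cpos_ent_mult_star:
  "cpos (ent (v * star v) k k :: 'r::{cstar_algebra, real_normed_algebra_1})"
proof -
  obtain N where "supp N v" using ex_supp by blast
  then have "ent (v * star v) k k = (\<Sum>j<N. adj (adj (ent v k j)) * adj (ent v k j))"
    by (simp add: ent_mult_supp[of N] adj_adj)
  then show ?thesis by (simp add: cpos_sum cpos_adj_mult)
qed

text \<open>The rows of \<open>x\<close> are added one at a time; the inverse is updated by the
  Sherman--Morrison formula, whose denominator \<open>1 + c\<close> is invertible because \<open>c\<close> is positive.\<close>

lemma one_plus_star_mult_invertible:
  fixes x :: "'a::cstar_algebra unitz fmat"
  assumes B: "cstar_subalgebra B" and x: "MB B x" "supp N x"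
  obtains w where "MB B w" "supp N w" "(blk N + star x * x) * w = blk N" "w * (blk N + star x * x) = blk N"
proof -
  define G where "G n = blk N + (\<Sum>k<n. star x * sgl k 1 * x)" for n
  have MBsgl: "MB B (sgl n a)" if "vect a \<in> B" for n a
    using subspace_cstar[OF B, THEN subspace_0] that by (auto simp: MB_def)
  have starG: "star (G n) = G n" for n
    by (simp add: G_def star_add star_sum star_mult mult.assoc)
  have suppG: "supp N (G n)" if "n \<le> N" for n
    using that unfolding G_def
    by (induction n) (auto intro!: supp_add supp_mult supp_star x supp_sgl supp_blk simp flip: add.assoc)
  have "\<exists>w. MB B w \<and> supp N w \<and> G n * w = blk N \<and> w * G n = blk N" if "n \<le> N" for n
    using that
  proof (induction n)
    case 0
    then show ?case
      by (intro exI[of _ "blk N"]) (simp add: G_def supp_blk blk_mult MB_blk[OF B])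
  next
    case (Suc n)
    then obtain w where w: "MB B w" "supp N w" "G n * w = blk N" "w * G n = blk N" by auto
    have sG: "supp N (G n)" using Suc suppG by simp
    have "star w * G n = blk N" using arg_cong[OF w(3), of star] by (simp add: star_mult starG)
    then have "star w * (G n * w) = blk N * w" by (simp add: mult.assoc[symmetric])
    then have sw: "star w = w" using w by (simp add: blk_mult mult_blk supp_star)
    define r where "r = sgl n 1 * x"
    have sr: "supp N r" using Suc by (simp add: r_def supp_mult supp_sgl x)
    have MBr: "MB B r" unfolding r_def by (intro MB_mult B MBsgl x) (simp add: subspace_0 subspace_cstar[OF B])
    have er: "sgl n 1 * r = r" by (simp add: r_def sgl_mult flip: mult.assoc)
    have rr: "star r * r = star x * sgl n 1 * x"
      by (simp add: r_def star_mult mult.assoc) (simp add: sgl_mult flip: mult.assoc)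
    have GS: "G (Suc n) = G n + star r * r" by (simp add: G_def rr add.assoc)
    define v where "v = r * w"
    define c where "c = ent (r * w * star r) n n"
    have e1: "star r * sgl n 1 = star r" using arg_cong[OF er, of star] by (simp add: star_mult)
    have rwr: "r * w * star r = sgl n c"
    proof -
      have "sgl n 1 * (r * w * star r) * sgl n 1 = (sgl n 1 * r) * w * (star r * sgl n 1)"
        by (simp add: mult.assoc)
      then have "r * w * star r = sgl n 1 * (r * w * star r) * sgl n 1" by (simp only: er e1)
      then show ?thesis by (simp add: sgl_corner c_def)
    qed
    \<comment> \<open>Since \<open>w\<close> inverts \<open>G n\<close>, inserting
      \<open>G n\<close> and expanding it displays the corner entry \<open>c\<close> as a sum of
      diagonal entries of products of a matrix with its adjoint.\<close>
    have "r * w * star r = v * G n * star v"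
      by (simp add: v_def star_mult sw mult.assoc) (simp add: w blk_mult supp_star sr supp_mult flip: mult.assoc)
    also have "\<dots> = v * star v + (\<Sum>k<n. (v * star x * sgl k 1) * star (v * star x * sgl k 1))"
    proof -
      have "(v * star x * sgl k 1) * star (v * star x * sgl k 1) = v * (star x * sgl k 1 * x) * star v" for k
        by (simp add: star_mult mult.assoc) (simp add: sgl_mult flip: mult.assoc)
      moreover have "v * blk N = v" by (simp add: v_def mult.assoc mult_blk w)
      ultimately show ?thesis
        by (simp add: G_def distrib_left distrib_right sum_distrib_left sum_distrib_right)
    qed
    finally have "c = ent (v * star v) n n
        + (\<Sum>k<n. ent ((v * star x * sgl k 1) * star (v * star x * sgl k 1)) n n)"
      by (simp add: c_def ent_sum)
    then have "cpos c" by (simp only:) (intro cpos_add cpos_sum cpos_ent_mult_star)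
    moreover have cB: "vect c \<in> B"
    proof -
      have "MB B (r * w * star r)" by (intro MB_mult MB_star B MBr w)
      then show ?thesis by (simp add: MB_def c_def)
    qed
    ultimately obtain d where d: "vect d \<in> B" "(of_real 1 + c) * d = 1" "d * (of_real 1 + c) = 1"
      using cpos_invertible[OF closed_vect[OF B], of c 1] vect_closed_ops[OF B] by auto
    define D where "D = sgl n d"
    have D1: "D + sgl n c * D = sgl n 1" "D + D * sgl n c = sgl n 1"
      using d by (simp_all add: D_def sgl_mult sgl_add algebra_simps)
    define X where "X = w * star r * D * r * w"
    define w' where "w' = w - X"
    have "star r * r * X = star r * (r * w * star r) * D * r * w"
      by (simp add: X_def mult.assoc)
    also have "\<dots> = star r * sgl n c * D * r * w" by (simp only: rwr)
    also have "\<dots> = star r * (sgl n c * D) * r * w" by (simp only: mult.assoc)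
    also have "sgl n c * D = sgl n 1 - D" using D1(1) by (simp add: eq_diff_eq add.commute)
    also have "star r * (sgl n 1 - D) * r * w = star r * r * w - star r * D * r * w"
      by (simp add: right_diff_distrib left_diff_distrib e1)
    finally have SX: "star r * r * X = star r * r * w - star r * D * r * w" .
    have "G n * X = (G n * w) * star r * D * r * w" by (simp add: X_def mult.assoc)
    then have GX: "G n * X = star r * D * r * w" by (simp add: w(3) blk_mult supp_star sr)
    have "G (Suc n) * w' = G n * w + star r * r * w - (G n * X + star r * r * X)"
      by (simp add: GS w'_def distrib_right right_diff_distrib)
    then have 1: "G (Suc n) * w' = blk N" by (simp add: SX GX w(3))
    have "X * (star r * r) = w * star r * D * (r * w * star r) * r"
      by (simp add: X_def mult.assoc)
    also have "\<dots> = w * star r * D * sgl n c * r" by (simp only: rwr)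
    also have "\<dots> = w * star r * (D * sgl n c) * r" by (simp only: mult.assoc)
    also have "D * sgl n c = sgl n 1 - D" using D1(2) by (simp add: eq_diff_eq add.commute)
    also have "w * star r * (sgl n 1 - D) * r = w * (star r * sgl n 1) * r - w * star r * D * r"
      by (simp add: right_diff_distrib left_diff_distrib mult.assoc)
    finally have XS: "X * (star r * r) = w * (star r * r) - w * star r * D * r"
      by (simp add: e1 mult.assoc)
    have "X * G n = w * star r * D * r * (w * G n)" by (simp add: X_def mult.assoc)
    also have "\<dots> = w * star r * D * (r * blk N)" by (simp only: w(4) mult.assoc)
    finally have XG: "X * G n = w * star r * D * r" by (simp add: mult_blk sr)
    have "w' * G (Suc n) = w * G n + w * (star r * r) - (X * G n + X * (star r * r))"
      by (simp add: GS w'_def distrib_left left_diff_distrib)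
    then have 2: "w' * G (Suc n) = blk N" by (simp add: XS XG w(4))
    have "MB B w'" unfolding w'_def X_def D_def by (intro MB_diff MB_mult MB_star B w MBr MBsgl d)
    moreover have "supp N w'" unfolding w'_def X_def D_def using Suc
      by (intro supp_diff supp_mult supp_star w sr supp_sgl) auto
    ultimately show ?case using 1 2 by blast
  qed
  from this[OF order_refl] obtain w where w: "MB B w" "supp N w" "G N * w = blk N" "w * G N = blk N" by auto
  have "G N = blk N + star x * blk N * x"
    by (simp add: G_def blk_sum[of N] sum_distrib_left sum_distrib_right)
  also have "star x * blk N * x = star x * x" using x by (simp add: mult_blk supp_star)
  finally show thesis using w that by simp
qed

text \<open>With \<open>f = star e\<close> and \<open>z = 1 + star (f - e) * (f - e)\<close>, the
  element \<open>z\<close> commutes with \<open>e\<close> and \<open>f\<close>, and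
  \<open>z * e = e * f * e\<close>. Hence \<open>e * f * w\<close>, where \<open>w\<close> inverts
  \<open>z\<close>, is a self-adjoint idempotent with the same range as \<open>e\<close>, which is
  what \<open>e * p = p\<close> and \<open>p * e = e\<close> express.\<close>

lemma idempotent_projection:
  fixes e :: "'a::cstar_algebra unitz fmat"
  assumes B: "cstar_subalgebra B" and e: "MB B e" "e * e = e"
  obtains p where "MB B p" "star p = p" "p * p = p" "e * p = p" "p * e = e"
proof -
  obtain N where N: "supp N e" using ex_supp by blast
  define f where "f = star e"
  have ff: "f * f = f" using arg_cong[OF e(2), of star] by (simp add: f_def star_mult)
  have sf: "supp N f" by (simp add: f_def supp_star N)
  have MBx: "MB B (f - e)" unfolding f_def by (intro MB_diff MB_star B e)
  obtain w where w: "MB B w" "supp N w" "(blk N + star (f - e) * (f - e)) * w = blk N"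
      "w * (blk N + star (f - e) * (f - e)) = blk N"
    using one_plus_star_mult_invertible[OF B MBx supp_diff[OF sf N]] by metis
  define z where "z = blk N + (e - f) * (f - e)"
  have wz: "z * w = blk N" "w * z = blk N" using w by (simp_all add: z_def f_def star_diff)
  have be: "blk N * e = e" "e * blk N = e" "blk N * f = f" "f * blk N = f" "blk N * w = w" "w * blk N = w"
    using N sf w(2) by (simp_all add: blk_mult mult_blk)
  have ze: "z * e = e * f * e" "e * z = e * f * e" "z * f = f * e * f" "f * z = f * e * f"
    by (simp_all add: z_def algebra_simps be e(2) ff) (simp_all add: e(2) ff flip: mult.assoc)
  have comm: "w * y = y * w" if "z * y = y * z" "blk N * y = y" "y * blk N = y" for y
  proof -
    have "w * y = w * (y * (z * w))" by (simp only: wz that(3))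
    also have "\<dots> = w * ((z * y) * w)" by (simp only: that(1) mult.assoc)
    also have "\<dots> = (w * z) * y * w" by (simp only: mult.assoc)
    also have "\<dots> = y * w" by (simp only: wz that(2))
    finally show ?thesis .
  qed
  have we: "w * e = e * w" and wf: "w * f = f * w" by (rule comm; simp add: be ze)+
  have sz: "star z = z" by (simp add: z_def star_add star_mult star_diff f_def)
  have "star w * z = blk N" using arg_cong[OF wz(1), of star] by (simp add: star_mult sz)
  then have "star w * (z * w) = blk N * w" by (simp add: mult.assoc[symmetric])
  then have sw: "star w = w" using wz w by (simp add: mult_blk blk_mult supp_star)
  define p where "p = e * f * w"
  show thesis
  proof (rule that)
    show "MB B p" unfolding p_def f_def by (intro MB_mult MB_star B e w)
    have "star p = w * e * f" by (simp add: p_def star_mult sw f_def mult.assoc)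
    also have "\<dots> = p" by (simp add: p_def we mult.assoc wf)
    finally show "star p = p" .
    have "p * p = e * f * (w * e) * f * w" by (simp add: p_def mult.assoc)
    also have "\<dots> = (e * f * e) * (w * f) * w" by (simp add: we mult.assoc)
    also have "\<dots> = (z * e) * (f * w) * w" by (simp only: ze wf)
    also have "\<dots> = (e * f * e) * f * w * w" by (simp add: ze mult.assoc)
    also have "\<dots> = e * (f * e * f) * w * w" by (simp add: mult.assoc)
    also have "\<dots> = e * (f * z) * w * w" by (simp only: ze(4))
    also have "\<dots> = e * f * (z * w) * w" by (simp only: mult.assoc)
    finally show "p * p = p" by (simp add: wz be mult.assoc p_def)
    show "e * p = p" by (simp add: p_def e(2) flip: mult.assoc)
    have "p * e = e * f * (w * e)" by (simp add: p_def mult.assoc)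
    also have "\<dots> = (e * f * e) * w" by (simp add: we mult.assoc)
    also have "\<dots> = (e * z) * w" by (simp only: ze(2))
    also have "\<dots> = e * (z * w)" by (simp only: mult.assoc)
    finally show "p * e = e" by (simp add: wz be)
  qed
qed

section \<open>Triples and their equivalence\<close>

text \<open>Counterparts for \<open>fmat\<close> of the notions behind \<open>K0\<close>. Direct sums become sums of
  orthogonal triples; up to isomorphism every direct sum has this form, which makes
  commutativity and associativity trivial.\<close>

type_synonym 'a mtriple = "'a unitz fmat \<times> 'a unitz fmat \<times> 'a unitz fmat"

definition prj :: "'a::cstar_algebra set \<Rightarrow> 'a unitz fmat \<Rightarrow> bool" where
  "prj B p \<longleftrightarrow> MB B p \<and> star p = p \<and> p * p = p"

definition inv2 :: "'a::cstar_algebra set \<Rightarrow> 'a unitz fmat \<Rightarrow> 'a unitz fmat \<Rightarrow> 'a unitz fmat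
    \<Rightarrow> 'a unitz fmat \<Rightarrow> bool" where
  "inv2 B p q a b \<longleftrightarrow> MB B a \<and> MB B b \<and> q * a = a \<and> a * p = a \<and> p * b = b \<and> b * q = b
    \<and> a * b = q \<and> b * a = p"

definition imor :: "'a::cstar_algebra set \<Rightarrow> 'a unitz fmat \<Rightarrow> 'a unitz fmat \<Rightarrow> 'a unitz fmat \<Rightarrow> bool" where
  "imor B p q a \<longleftrightarrow> (\<exists>b. inv2 B p q a b)"

definition conn :: "'a::cstar_algebra set \<Rightarrow> 'a unitz fmat \<Rightarrow> 'a unitz fmat \<Rightarrow> bool" where
  "conn B p a \<longleftrightarrow> (\<exists>h :: real \<Rightarrow> 'a unitz fmat. continuous_on {0..1} h \<and> h 0 = a \<and> h 1 = p \<and>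
    (\<forall>s\<in>{0..1}. imor B p p (h s)))"

definition Gam :: "'a::cstar_algebra set \<Rightarrow> 'a set \<Rightarrow> 'a mtriple set" where
  "Gam B' B = {(p, q, a). prj B' p \<and> prj B' q \<and> imor B p q a}"

definition isoT :: "'a::cstar_algebra set \<Rightarrow> 'a mtriple \<Rightarrow> 'a mtriple \<Rightarrow> bool" where
  "isoT B' t t' \<longleftrightarrow> (case t of (p, q, a) \<Rightarrow> case t' of (p', q', a') \<Rightarrow>
     (\<exists>c d. imor B' p p' c \<and> imor B' q q' d \<and> d * a = a' * c))"

definition elem :: "'a::cstar_algebra set \<Rightarrow> 'a mtriple \<Rightarrow> bool" where
  "elem B t \<longleftrightarrow> (case t of (p, q, a) \<Rightarrow> p = q \<and> conn B p a)"

definition orth :: "'a::cstar_algebra mtriple \<Rightarrow> 'a mtriple \<Rightarrow> bool" where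
  "orth t t' \<longleftrightarrow> (case t of (p, q, a) \<Rightarrow> case t' of (p', q', a') \<Rightarrow>
     p * p' = 0 \<and> p' * p = 0 \<and> q * q' = 0 \<and> q' * q = 0)"

definition shT :: "nat \<Rightarrow> 'a::cstar_algebra mtriple \<Rightarrow> 'a mtriple" where
  "shT K t = (case t of (p, q, a) \<Rightarrow> (sh K p, sh K q, sh K a))"

definition suppT :: "nat \<Rightarrow> 'a::cstar_algebra mtriple \<Rightarrow> bool" where
  "suppT K t \<longleftrightarrow> (case t of (p, q, a) \<Rightarrow> supp K p \<and> supp K q \<and> supp K a)"

definition eqv :: "'a::cstar_algebra set \<Rightarrow> 'a set \<Rightarrow> 'a mtriple \<Rightarrow> 'a mtriple \<Rightarrow> bool" where
  "eqv B' B t u \<longleftrightarrow> t \<in> Gam B' B \<and> u \<in> Gam B' B \<and> (\<exists>e e'. e \<in> Gam B' B \<and> e' \<in> Gam B' B \<and>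
     elem B e \<and> elem B e' \<and> orth t e \<and> orth u e' \<and> isoT B' (t + e) (u + e'))"

lemma connE:
  assumes "conn B p a"
  obtains h :: "real \<Rightarrow> 'a::cstar_algebra unitz fmat" where "continuous_on {0..1} h" "h 0 = a" "h 1 = p" "\<forall>s\<in>{0..1}. imor B p p (h s)"
  using assms unfolding conn_def by (elim exE conjE)

lemma ex_suppT: "\<exists>N. suppT N t"
  by (cases t) (metis ex_supp3 suppT_def case_prod_conv)

lemma suppT_mono: "suppT N t \<Longrightarrow> N \<le> K \<Longrightarrow> suppT K t"
  by (auto simp: suppT_def intro: supp_mono)

lemma ex_suppT_list: "\<exists>N\<ge>M. \<forall>t\<in>set ts. suppT N t"
proof (induction ts)
  case (Cons t ts)
  then obtain N where N: "N \<ge> M" "\<forall>t\<in>set ts. suppT N t" by blast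
  obtain K where K: "suppT K t" using ex_suppT by blast
  show ?case
    by (intro exI[of _ "max N K"]) (use N K in \<open>auto intro: suppT_mono\<close>)
qed auto

lemma orth_sym: "orth t u \<Longrightarrow> orth u t"
  by (auto simp: orth_def split: prod.splits)

lemma orth_add_left: "orth t v \<Longrightarrow> orth u v \<Longrightarrow> orth (t + u) v"
  and orth_add_right: "orth v t \<Longrightarrow> orth v u \<Longrightarrow> orth v (t + u)"
  by (auto simp: orth_def distrib_left distrib_right split: prod.splits)

lemma orth_zero [simp]: "orth t 0" "orth 0 t"
  by (auto simp: orth_def zero_prod_def split: prod.splits)

lemma orth_shT: "suppT N t \<Longrightarrow> N \<le> K \<Longrightarrow> orth t (shT K u)"
  by (auto simp: orth_def suppT_def shT_def sh_orth split: prod.splits)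

lemma shT_zero [simp]: "shT K 0 = 0"
  by (simp add: shT_def zero_prod_def)

lemma inv2_sym: "inv2 B p q a b \<Longrightarrow> inv2 B q p b a"
  by (simp add: inv2_def)

lemma inv2D:
  assumes "inv2 B p q a b"
  shows "MB B a" "MB B b" "q * a = a" "a * p = a" "p * b = b" "b * q = b" "a * b = q" "b * a = p"
  using assms by (auto simp: inv2_def)

lemma inv2_idem:
  assumes "inv2 B p q a b"
  shows "p * p = p" "q * q = q"
proof -
  have "p * (b * a) = (p * b) * a" "q * (a * b) = (q * a) * b" by (simp_all only: mult.assoc)
  then show "p * p = p" "q * q = q" by (simp_all only: inv2D[OF assms])
qed

lemma inv2_mono: "inv2 B p q a b \<Longrightarrow> B \<subseteq> B' \<Longrightarrow> inv2 B' p q a b"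
  by (auto simp: inv2_def intro: MB_mono)

lemma imor_mono: "imor B p q a \<Longrightarrow> B \<subseteq> B' \<Longrightarrow> imor B' p q a"
  by (auto simp: imor_def intro: inv2_mono)

lemma prj_mono: "prj B p \<Longrightarrow> B \<subseteq> B' \<Longrightarrow> prj B' p"
  by (auto simp: prj_def intro: MB_mono)

lemma conn_mono: "conn B p a \<Longrightarrow> B \<subseteq> B' \<Longrightarrow> conn B' p a"
  by (erule connE, unfold conn_def) (intro exI conjI ballI, assumption+, blast intro: imor_mono)

lemma isoT_mono: "isoT B t u \<Longrightarrow> B \<subseteq> B' \<Longrightarrow> isoT B' t u"
  unfolding isoT_def by (auto split: prod.splits) (meson imor_mono)

lemma Gam_mono: "t \<in> Gam B' B \<Longrightarrow> B' \<subseteq> D' \<Longrightarrow> B \<subseteq> D \<Longrightarrow> t \<in> Gam D' D"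
  by (auto simp: Gam_def intro: prj_mono imor_mono)

lemma elem_mono: "elem B t \<Longrightarrow> B \<subseteq> B' \<Longrightarrow> elem B' t"
  by (auto simp: elem_def intro: conn_mono split: prod.splits)

lemma eqv_mono: "eqv B' B t u \<Longrightarrow> B' \<subseteq> D' \<Longrightarrow> B \<subseteq> D \<Longrightarrow> eqv D' D t u"
  unfolding eqv_def by (meson Gam_mono elem_mono isoT_mono)

lemma imor_supp: "imor B p q a \<Longrightarrow> supp N p \<Longrightarrow> supp N q \<Longrightarrow> supp N a"
proof -
  assume "imor B p q a" "supp N p" "supp N q"
  then have "q * a = a" "a * p = a" "blk N * q = q" "p * blk N = p"
    by (auto simp: imor_def inv2_def blk_mult mult_blk)
  then have "blk N * a = a" "a * blk N = a" by (metis mult.assoc)+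
  then show ?thesis by (simp add: supp_iff_blk)
qed

context
  fixes B :: "'a::cstar_algebra set"
  assumes B: "cstar_subalgebra B"
begin

lemma inv2_comp:
  assumes "inv2 B p q a b" "inv2 B q r c d"
  shows "inv2 B p r (c * a) (b * d)"
proof -
  note 1 = inv2D[OF assms(1)] and 2 = inv2D[OF assms(2)]
  have "c * a * (b * d) = c * (a * b) * d" "b * d * (c * a) = b * (d * c) * a"
    by (simp_all only: mult.assoc)
  then have "c * a * (b * d) = r" "b * d * (c * a) = p" by (simp_all add: 1 2)
  moreover have "r * (c * a) = c * a" "p * (b * d) = b * d"
    using 1 2 by (simp_all flip: mult.assoc)
  moreover have "c * a * p = c * a" "b * d * r = b * d" using 1 2 by (simp_all add: mult.assoc)
  moreover have "MB B (c * a)" "MB B (b * d)" using 1 2 MB_mult[OF B] by auto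
  ultimately show ?thesis by (simp add: inv2_def)
qed

lemma imor_comp: "imor B p q a \<Longrightarrow> imor B q r c \<Longrightarrow> imor B p r (c * a)"
  unfolding imor_def using inv2_comp by blast

lemma inv2_id: "MB B p \<Longrightarrow> p * p = p \<Longrightarrow> inv2 B p p p p"
  by (simp add: inv2_def)

lemma imor_id: "prj B p \<Longrightarrow> imor B p p p"
  unfolding imor_def using inv2_id by (auto simp: prj_def)

lemma inv2_sum:
  assumes "inv2 B p q a b" "inv2 B p' q' a' b'"
    and "p * p' = 0" "p' * p = 0" "q * q' = 0" "q' * q = 0"
  shows "inv2 B (p + p') (q + q') (a + a') (b + b')"
proof -
  note 1 = inv2D[OF assms(1)] and 2 = inv2D[OF assms(2)]
  \<comment> \<open>A product vanishes if a zero product \<open>u * v\<close> can be inserted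
    between its factors; all mixed terms below are of this kind.\<close>
  have *: "x * y = 0" if "x * u = x" "v * y = y" "u * v = 0" for x y u v :: "'a unitz fmat"
  proof -
    have "x * y = x * (u * v) * y" using that(1,2) by (metis mult.assoc)
    with that show ?thesis by simp
  qed
  have ii: "p * p = p" "q * q = q" "p' * p' = p'" "q' * q' = q'"
    by (fact inv2_idem[OF assms(1)] inv2_idem[OF assms(2)])+
  have z: "a * b' = 0" "a' * b = 0" "b * a' = 0" "b' * a = 0"
    "q * a' = 0" "q' * a = 0" "a * p' = 0" "a' * p = 0" "p * b' = 0" "p' * b = 0" "b * q' = 0" "b' * q = 0"
    by (fact *[OF 1(4) 2(5) assms(3)] *[OF 2(4) 1(5) assms(4)] *[OF 1(6) 2(3) assms(5)]
        *[OF 2(6) 1(3) assms(6)] *[OF ii(2) 2(3) assms(5)] *[OF ii(4) 1(3) assms(6)]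
        *[OF 1(4) ii(3) assms(3)] *[OF 2(4) ii(1) assms(4)] *[OF ii(1) 2(5) assms(3)]
        *[OF ii(3) 1(5) assms(4)] *[OF 1(6) ii(4) assms(5)] *[OF 2(6) ii(2) assms(6)])+
  show ?thesis unfolding inv2_def using MB_add[OF B] 1 2 by (simp add: distrib_left distrib_right z)
qed

lemma imor_sum:
  "imor B p q a \<Longrightarrow> imor B p' q' a' \<Longrightarrow> p * p' = 0 \<Longrightarrow> p' * p = 0 \<Longrightarrow> q * q' = 0 \<Longrightarrow> q' * q = 0 \<Longrightarrow>
    imor B (p + p') (q + q') (a + a')"
  unfolding imor_def using inv2_sum by blast

lemma inv2_sh: "inv2 B p q a b \<Longrightarrow> inv2 B (sh K p) (sh K q) (sh K a) (sh K b)"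
  unfolding inv2_def using MB_sh[OF B] by (auto simp flip: sh_mult)

lemma imor_sh: "imor B p q a \<Longrightarrow> imor B (sh K p) (sh K q) (sh K a)"
  unfolding imor_def using inv2_sh by blast

text \<open>The implementing partial isometry has scalar entries, so a shift is an isomorphism over
  every \<open>B\<close>, in particular over the smaller algebra of a pair.\<close>

lemma inv2_isom:
  assumes p: "MB B p" "p * p = p" "supp N p"
  shows "inv2 B p (sh K p) (isom K N * p) (p * star (isom K N))"
proof -
  have a: "sh K p * (isom K N * p) = isom K N * p"
  proof -
    have "sh K p * (isom K N * p) = (sh K p * isom K N) * p" by (simp only: mult.assoc)
    also have "\<dots> = isom K N * (p * p)" by (simp only: isom_mult[OF p(3), symmetric] mult.assoc)
    finally show ?thesis by (simp only: p)
  qed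
  have s: "p * star (isom K N) * sh K p = p * star (isom K N)"
  proof -
    have "p * star (isom K N) * sh K p = p * ((star (isom K N) * isom K N) * p) * star (isom K N)"
      by (simp add: sh_isom[OF p(3)] mult.assoc)
    then show ?thesis by (simp add: isom_star_isom blk_mult p)
  qed
  have "isom K N * p * (p * star (isom K N)) = isom K N * (p * p) * star (isom K N)"
    by (simp only: mult.assoc)
  then have ab: "isom K N * p * (p * star (isom K N)) = sh K p" by (simp add: p sh_isom[OF p(3)])
  have "p * star (isom K N) * (isom K N * p) = p * ((star (isom K N) * isom K N) * p)"
    by (simp only: mult.assoc)
  then have "p * star (isom K N) * (isom K N * p) = p" by (simp add: isom_star_isom blk_mult p)
  moreover have "isom K N * p * p = isom K N * p" by (simp add: p mult.assoc)
  moreover have "p * (p * star (isom K N)) = p * star (isom K N)" by (simp add: p flip: mult.assoc)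
  moreover have "MB B (isom K N * p)" "MB B (p * star (isom K N))"
    using MB_mult[OF B] MB_star[OF B] MB_isom[OF B] p by auto
  ultimately show ?thesis unfolding inv2_def using a s ab by blast
qed

lemma prj_sum: "prj B p \<Longrightarrow> prj B q \<Longrightarrow> p * q = 0 \<Longrightarrow> q * p = 0 \<Longrightarrow> prj B (p + q)"
  using MB_add[OF B] by (simp add: prj_def star_add distrib_left distrib_right)

lemma prj_sh: "prj B p \<Longrightarrow> prj B (sh K p)"
  using MB_sh[OF B] by (simp add: prj_def star_sh flip: sh_mult)

lemma prj_zero [simp]: "prj B 0"
  using B by (simp add: prj_def)

lemma imor_zero [simp]: "imor B 0 0 0"
  using imor_id[of 0] by simp

lemma conn_id: "prj B p \<Longrightarrow> conn B p p"
  unfolding conn_def by (intro exI[of _ "\<lambda>s. p"]) (simp add: imor_id)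

lemma conn_sum:
  assumes "conn B p a" "conn B q b" "p * q = 0" "q * p = 0"
  shows "conn B (p + q) (a + b)"
proof -
  obtain h :: "real \<Rightarrow> 'a unitz fmat" where h: "continuous_on {0..1} h" "h 0 = a" "h 1 = p" "\<forall>s\<in>{0..1}. imor B p p (h s)"
    using assms(1) by (rule connE)
  obtain k :: "real \<Rightarrow> 'a unitz fmat" where k: "continuous_on {0..1} k" "k 0 = b" "k 1 = q" "\<forall>s\<in>{0..1}. imor B q q (k s)"
    using assms(2) by (rule connE)
  show ?thesis unfolding conn_def
    by (intro exI[of _ "\<lambda>s. h s + k s"]) (use h k assms in \<open>auto intro!: continuous_intros imor_sum\<close>)
qed

lemma conn_sh:
  assumes "conn B p a"
  shows "conn B (sh K p) (sh K a)"
proof -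
  obtain h :: "real \<Rightarrow> 'a unitz fmat" where h: "continuous_on {0..1} h" "h 0 = a" "h 1 = p" "\<forall>s\<in>{0..1}. imor B p p (h s)"
    using assms by (rule connE)
  obtain N where N: "supp N p" using ex_supp by blast
  have "continuous_on {0..1} (\<lambda>s. sh K (h s))"
    by (rule continuous_on_sh[OF h(1), of N]) (use imor_supp[OF _ N N] h(4) in blast)
  then show ?thesis unfolding conn_def
    by (intro exI[of _ "\<lambda>s. sh K (h s)"]) (use h in \<open>auto intro: imor_sh\<close>)
qed

end

section \<open>Equivalence of triples for a pair of algebras\<close>

locale pair =
  fixes B' B :: "'a::cstar_algebra set"
  assumes B': "cstar_subalgebra B'" and B: "cstar_subalgebra B" and sub: "B' \<subseteq> B"
begin

lemma Gam_add: "t \<in> Gam B' B \<Longrightarrow> u \<in> Gam B' B \<Longrightarrow> orth t u \<Longrightarrow> t + u \<in> Gam B' B"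
  by (auto simp: Gam_def orth_def intro: prj_sum[OF B'] imor_sum[OF B])

lemma Gam_sh: "t \<in> Gam B' B \<Longrightarrow> shT K t \<in> Gam B' B"
  by (auto simp: Gam_def shT_def intro: prj_sh[OF B'] imor_sh[OF B])

lemma Gam_zero [simp]: "0 \<in> Gam B' B"
  using B B' by (simp add: Gam_def zero_prod_def)

lemma elem_zero [simp]: "elem B 0"
  using conn_id[OF B, of 0] B by (simp add: elem_def zero_prod_def)

lemma elem_add: "elem B t \<Longrightarrow> elem B u \<Longrightarrow> orth t u \<Longrightarrow> elem B (t + u)"
  by (auto simp: elem_def orth_def intro: conn_sum[OF B])

lemma elem_sh: "elem B t \<Longrightarrow> elem B (shT K t)"
  by (auto simp: elem_def shT_def intro: conn_sh[OF B])

lemma Gam_refl: "prj B' p \<Longrightarrow> (p, p, p) \<in> Gam B' B"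
  using imor_id[OF B] prj_mono[OF _ sub] by (simp add: Gam_def)

lemma elem_refl: "prj B' p \<Longrightarrow> elem B (p, p, p)"
  using conn_id[OF B] prj_mono[OF _ sub] by (simp add: elem_def)

lemma isoT_refl:
  assumes "t \<in> Gam B' B"
  shows "isoT B' t t"
proof -
  obtain p q a where t: "t = (p, q, a)" by (cases t)
  with assms have "imor B' p p p" "imor B' q q q" "q * a = a * p"
    by (auto simp: Gam_def imor_def[of B p q] inv2_def intro: imor_id[OF B'])
  then show ?thesis by (auto simp: isoT_def t)
qed

lemma isoT_sym:
  assumes "isoT B' t u" "t \<in> Gam B' B" "u \<in> Gam B' B"
  shows "isoT B' u t"
proof -
  obtain p q a where t: "t = (p, q, a)" by (cases t)
  obtain p' q' a' where u: "u = (p', q', a')" by (cases u)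
  obtain c d c' d' where c: "inv2 B' p p' c c'" and d: "inv2 B' q q' d d'" and da: "d * a = a' * c"
    using assms(1) by (auto simp: isoT_def t u imor_def)
  have a: "q * a = a" "a' * p' = a'" using assms(2,3) by (auto simp: Gam_def t u imor_def inv2_def)
  have "d' * a' = d' * (a' * (c * c'))" using inv2D(7)[OF c] a by simp
  also have "\<dots> = d' * (d * a) * c'" by (simp only: da mult.assoc)
  also have "\<dots> = (d' * d) * a * c'" by (simp only: mult.assoc)
  also have "\<dots> = a * c'" using inv2D(8)[OF d] a by simp
  finally show ?thesis using inv2_sym[OF c] inv2_sym[OF d] by (auto simp: isoT_def t u imor_def)
qed

lemma isoT_trans:
  assumes "isoT B' t u" "isoT B' u v"
  shows "isoT B' t v"
proof -
  obtain p q a where t: "t = (p, q, a)" by (cases t)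
  obtain p' q' a' where u: "u = (p', q', a')" by (cases u)
  obtain p'' q'' a'' where v: "v = (p'', q'', a'')" by (cases v)
  obtain c d where c: "imor B' p p' c" and d: "imor B' q q' d" and da: "d * a = a' * c"
    using assms(1) by (auto simp: isoT_def t u)
  obtain c' d' where c': "imor B' p' p'' c'" and d': "imor B' q' q'' d'" and da': "d' * a' = a'' * c'"
    using assms(2) by (auto simp: isoT_def v u)
  have "d' * d * a = a'' * (c' * c)" by (metis da da' mult.assoc)
  then show ?thesis using imor_comp[OF B' c c'] imor_comp[OF B' d d'] by (auto simp: isoT_def t v)
qed

lemma isoT_add:
  assumes t: "isoT B' t t'" and u: "isoT B' u u'" and o: "orth t u" "orth t' u'"
    and G: "t \<in> Gam B' B" "t' \<in> Gam B' B" "u \<in> Gam B' B" "u' \<in> Gam B' B"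
  shows "isoT B' (t + u) (t' + u')"
proof -
  obtain p q a where t1: "t = (p, q, a)" by (cases t)
  obtain p' q' a' where t2: "t' = (p', q', a')" by (cases t')
  obtain r s b where u1: "u = (r, s, b)" by (cases u)
  obtain r' s' b' where u2: "u' = (r', s', b')" by (cases u')
  obtain c d where c: "imor B' p p' c" and d: "imor B' q q' d" and da: "d * a = a' * c"
    using t by (auto simp: isoT_def t1 t2)
  obtain g h where g: "imor B' r r' g" and h: "imor B' s s' h" and hb: "h * b = b' * g"
    using u by (auto simp: isoT_def u1 u2)
  have z: "p * r = 0" "r * p = 0" "q * s = 0" "s * q = 0" "p' * r' = 0" "r' * p' = 0" "q' * s' = 0" "s' * q' = 0"
    using o by (auto simp: orth_def t1 t2 u1 u2)
  have "q * a = a" "s * b = b" "a' * p' = a'" "b' * r' = b'"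
    using G by (auto simp: Gam_def t1 t2 u1 u2 imor_def inv2_def)
  moreover have "d * q = d" "h * s = h" "p' * c = c" "r' * g = g"
    using c d g h by (auto simp: imor_def inv2_def)
  ultimately have "d * b = d * (q * s) * b" "h * a = h * (s * q) * a" "a' * g = a' * (p' * r') * g"
    "b' * c = b' * (r' * p') * c" by (metis mult.assoc)+
  then have "(d + h) * (a + b) = (a' + b') * (c + g)"
    by (simp add: z distrib_left distrib_right da hb)
  then show ?thesis using imor_sum[OF B' c g] imor_sum[OF B' d h] z
    by (auto simp: isoT_def t1 t2 u1 u2)
qed

lemma isoT_shT:
  assumes "t \<in> Gam B' B"
  shows "isoT B' t (shT K t)"
proof -
  obtain p q a where t: "t = (p, q, a)" by (cases t)
  obtain N where N: "supp N p" "supp N q" "supp N a" by (rule ex_supp3)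
  have pq: "prj B' p" "prj B' q" and a: "q * a = a" "a * p = a"
    using assms by (auto simp: Gam_def t imor_def inv2_def)
  have "imor B' p (sh K p) (isom K N * p)" "imor B' q (sh K q) (isom K N * q)"
    using inv2_isom[OF B'] pq N unfolding imor_def prj_def by blast+
  moreover have "isom K N * q * a = sh K a * (isom K N * p)"
  proof -
    have "sh K a * (isom K N * p) = (sh K a * isom K N) * p" by (simp only: mult.assoc)
    also have "\<dots> = isom K N * (a * p)" by (simp only: isom_mult[OF N(3), symmetric] mult.assoc)
    finally show ?thesis by (simp add: a mult.assoc)
  qed
  ultimately show ?thesis by (auto simp: isoT_def t shT_def)
qed

lemma eqv_Gam: "eqv B' B t u \<Longrightarrow> t \<in> Gam B' B \<and> u \<in> Gam B' B"
  by (simp add: eqv_def)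

lemma eqvI:
  "t \<in> Gam B' B \<Longrightarrow> u \<in> Gam B' B \<Longrightarrow> e \<in> Gam B' B \<Longrightarrow> e' \<in> Gam B' B \<Longrightarrow> elem B e \<Longrightarrow> elem B e' \<Longrightarrow>
    orth t e \<Longrightarrow> orth u e' \<Longrightarrow> isoT B' (t + e) (u + e') \<Longrightarrow> eqv B' B t u"
  unfolding eqv_def by blast

lemma isoT_eqv: "isoT B' t u \<Longrightarrow> t \<in> Gam B' B \<Longrightarrow> u \<in> Gam B' B \<Longrightarrow> eqv B' B t u"
  using eqvI[of t u 0 0] by simp

lemma eqv_refl: "t \<in> Gam B' B \<Longrightarrow> eqv B' B t t"
  by (simp add: isoT_eqv isoT_refl)

lemma eqv_sym: "eqv B' B t u \<Longrightarrow> eqv B' B u t"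
  unfolding eqv_def by (meson isoT_sym Gam_add)

lemma eqv_add_elem:
  assumes "t \<in> Gam B' B" "e \<in> Gam B' B" "elem B e" "orth t e"
  shows "eqv B' B (t + e) t"
proof -
  have "isoT B' (t + e + 0) (t + e)" using isoT_refl[OF Gam_add] assms by simp
  then show ?thesis using assms Gam_add by (intro eqvI[of _ _ 0 e]) auto
qed

text \<open>The stabilizing triples may be shifted arbitrarily far and so become orthogonal to
  anything given beforehand; transitivity and additivity rest on this.\<close>

lemma eqv_far:
  assumes "eqv B' B t u"
  obtains e e' where "e \<in> Gam B' B" "e' \<in> Gam B' B" "elem B e" "elem B e'"
    "\<And>K. suppT K t \<Longrightarrow> suppT K u \<Longrightarrow> isoT B' (t + shT K e) (u + shT K e')"
proof -
  obtain e e' where e: "e \<in> Gam B' B" "e' \<in> Gam B' B" "elem B e" "elem B e'" "orth t e" "orth u e'"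
      "isoT B' (t + e) (u + e')" and tu: "t \<in> Gam B' B" "u \<in> Gam B' B"
    using assms by (auto simp: eqv_def)
  have "isoT B' (t + shT K e) (u + shT K e')" if K: "suppT K t" "suppT K u" for K
  proof -
    have ot: "orth t (shT K e)" "orth u (shT K e')" using K orth_shT by blast+
    have "isoT B' (shT K e) e" by (rule isoT_sym[OF isoT_shT]) (use e Gam_sh in auto)
    then have "isoT B' (t + shT K e) (t + e)"
      using isoT_add[OF isoT_refl[OF tu(1)] _ ot(1) e(5)] tu e Gam_sh by blast
    moreover have "isoT B' (u + e') (u + shT K e')"
      using isoT_add[OF isoT_refl[OF tu(2)] isoT_shT[OF e(2)] e(6) ot(2)] tu e Gam_sh by blast
    ultimately show ?thesis using e(7) isoT_trans by blast
  qed
  with e that show thesis by blast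
qed

text \<open>Adding \<open>f1\<close> to the first isomorphism and \<open>e1'\<close> to the second
  makes both pass through \<open>u + e1' + f1\<close>. Shifting \<open>f\<close> and
  \<open>f'\<close> past the supports of \<open>e1\<close> and \<open>e1'\<close> makes all these
  sums orthogonal.\<close>

lemma eqv_trans:
  assumes "eqv B' B t u" "eqv B' B u v"
  shows "eqv B' B t v"
proof -
  obtain e e' where e: "e \<in> Gam B' B" "e' \<in> Gam B' B" "elem B e" "elem B e'"
    "\<And>K. suppT K t \<Longrightarrow> suppT K u \<Longrightarrow> isoT B' (t + shT K e) (u + shT K e')"
    using eqv_far[OF assms(1)] by metis
  obtain f f' where f: "f \<in> Gam B' B" "f' \<in> Gam B' B" "elem B f" "elem B f'"
    "\<And>K. suppT K u \<Longrightarrow> suppT K v \<Longrightarrow> isoT B' (u + shT K f) (v + shT K f')"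
    using eqv_far[OF assms(2)] by metis
  have G: "t \<in> Gam B' B" "u \<in> Gam B' B" "v \<in> Gam B' B" using assms by (auto simp: eqv_def)
  obtain N where N: "suppT N t" "suppT N u" "suppT N v"
    using ex_suppT_list[of 0 "[t, u, v]"] by auto
  define e1 e1' where "e1 = shT N e" and "e1' = shT N e'"
  have E: "e1 \<in> Gam B' B" "e1' \<in> Gam B' B" "elem B e1" "elem B e1'"
    by (auto simp: e1_def e1'_def e Gam_sh elem_sh)
  obtain M where M: "M \<ge> N" "suppT M e1" "suppT M e1'"
    using ex_suppT_list[of N "[e1, e1']"] by auto
  have M': "suppT M t" "suppT M u" "suppT M v" using N M suppT_mono by blast+
  define f1 f1' where "f1 = shT M f" and "f1' = shT M f'"
  have F: "f1 \<in> Gam B' B" "f1' \<in> Gam B' B" "elem B f1" "elem B f1'"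
    by (auto simp: f1_def f1'_def f Gam_sh elem_sh)
  have O: "orth t e1" "orth u e1'" "orth v e1'"
    "orth t f1" "orth u f1" "orth v f1'" "orth e1 f1" "orth e1' f1" "orth e1' f1'"
    using N M M' by (auto simp: e1_def e1'_def f1_def f1'_def intro: orth_shT[OF _ order_refl])
  have S: "t + e1 \<in> Gam B' B" "u + e1' \<in> Gam B' B" "u + f1 \<in> Gam B' B" "v + f1' \<in> Gam B' B"
    by (intro Gam_add G E F O)+
  have 1: "isoT B' ((t + e1) + f1) ((u + e1') + f1)"
    using e(5)[OF N(1,2)] unfolding e1_def[symmetric] e1'_def[symmetric]
    by (rule isoT_add[OF _ isoT_refl[OF F(1)] orth_add_left[OF O(4,7)] orth_add_left[OF O(5,8)]
        S(1,2) F(1) F(1)])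
  have 2: "isoT B' ((u + f1) + e1') ((v + f1') + e1')"
    using f(5)[OF M'(2,3)] unfolding f1_def[symmetric] f1'_def[symmetric]
    by (rule isoT_add[OF _ isoT_refl[OF E(2)] orth_add_left[OF O(2) orth_sym[OF O(8)]]
        orth_add_left[OF O(3) orth_sym[OF O(9)]] S(3,4) E(2) E(2)])
  have eq: "(u + e1') + f1 = (u + f1) + e1'" "(v + f1') + e1' = v + (e1' + f1')"
    "(t + e1) + f1 = t + (e1 + f1)" by (simp_all add: ac_simps)
  have "isoT B' (t + (e1 + f1)) (v + (e1' + f1'))"
    using isoT_trans[OF 1[unfolded eq(1)] 2] unfolding eq .
  then show ?thesis
    by (rule eqvI[OF G(1,3) Gam_add[OF E(1) F(1) O(7)] Gam_add[OF E(2) F(2) O(9)]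
        elem_add[OF E(3) F(3) O(7)] elem_add[OF E(4) F(4) O(9)]
        orth_add_right[OF O(1,4)] orth_add_right[OF O(3,6)]])
qed

lemma eqv_add:
  assumes "eqv B' B t t'" "eqv B' B u u'" and o: "orth t u" "orth t' u'"
  shows "eqv B' B (t + u) (t' + u')"
proof -
  obtain e e' where e: "e \<in> Gam B' B" "e' \<in> Gam B' B" "elem B e" "elem B e'"
    "\<And>K. suppT K t \<Longrightarrow> suppT K t' \<Longrightarrow> isoT B' (t + shT K e) (t' + shT K e')"
    using eqv_far[OF assms(1)] by metis
  obtain f f' where f: "f \<in> Gam B' B" "f' \<in> Gam B' B" "elem B f" "elem B f'"
    "\<And>K. suppT K u \<Longrightarrow> suppT K u' \<Longrightarrow> isoT B' (u + shT K f) (u' + shT K f')"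
    using eqv_far[OF assms(2)] by metis
  have G: "t \<in> Gam B' B" "u \<in> Gam B' B" "t' \<in> Gam B' B" "u' \<in> Gam B' B"
    using assms by (auto simp: eqv_def)
  obtain N where N: "suppT N t" "suppT N u" "suppT N t'" "suppT N u'"
    using ex_suppT_list[of 0 "[t, u, t', u']"] by auto
  define e1 e1' where "e1 = shT N e" and "e1' = shT N e'"
  have E: "e1 \<in> Gam B' B" "e1' \<in> Gam B' B" "elem B e1" "elem B e1'"
    by (auto simp: e1_def e1'_def e Gam_sh elem_sh)
  obtain M where M: "M \<ge> N" "suppT M e1" "suppT M e1'"
    using ex_suppT_list[of N "[e1, e1']"] by auto
  have M': "suppT M t" "suppT M u" "suppT M t'" "suppT M u'" using N M suppT_mono by blast+
  define f1 f1' where "f1 = shT M f" and "f1' = shT M f'"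
  have F: "f1 \<in> Gam B' B" "f1' \<in> Gam B' B" "elem B f1" "elem B f1'"
    by (auto simp: f1_def f1'_def f Gam_sh elem_sh)
  have O: "orth t e1" "orth u e1" "orth t' e1'" "orth u' e1'"
    "orth t f1" "orth u f1" "orth t' f1'" "orth u' f1'" "orth e1 f1" "orth e1' f1'"
    using N M M' by (auto simp: e1_def e1'_def f1_def f1'_def intro: orth_shT[OF _ order_refl])
  have S: "t + e1 \<in> Gam B' B" "t' + e1' \<in> Gam B' B" "u + f1 \<in> Gam B' B" "u' + f1' \<in> Gam B' B"
    by (intro Gam_add G E F O)+
  have oo: "orth (t + e1) (u + f1)" "orth (t' + e1') (u' + f1')"
    by (intro orth_add_left orth_add_right o O orth_sym[OF O(2)] orth_sym[OF O(4)])+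
  have "isoT B' ((t + e1) + (u + f1)) ((t' + e1') + (u' + f1'))"
    using e(5)[OF N(1,3)] f(5)[OF M'(2,4)]
    unfolding e1_def[symmetric] e1'_def[symmetric] f1_def[symmetric] f1'_def[symmetric]
    by (rule isoT_add[OF _ _ oo S])
  moreover have "(t + e1) + (u + f1) = (t + u) + (e1 + f1)" "(t' + e1') + (u' + f1') = (t' + u') + (e1' + f1')"
    by (simp_all add: ac_simps)
  ultimately have "isoT B' ((t + u) + (e1 + f1)) ((t' + u') + (e1' + f1'))" by (simp only:)
  then show ?thesis
    by (rule eqvI[OF Gam_add[OF G(1,2) o(1)] Gam_add[OF G(3,4) o(2)]
        Gam_add[OF E(1) F(1) O(9)] Gam_add[OF E(2) F(2) O(10)]
        elem_add[OF E(3) F(3) O(9)] elem_add[OF E(4) F(4) O(10)]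
        orth_add_left[OF orth_add_right[OF O(1,5)] orth_add_right[OF O(2,6)]]
        orth_add_left[OF orth_add_right[OF O(3,7)] orth_add_right[OF O(4,8)]]])
qed

lemma eqv_shT: "t \<in> Gam B' B \<Longrightarrow> eqv B' B t (shT K t)"
  by (simp add: isoT_eqv isoT_shT Gam_sh)

end

section \<open>Inverses of classes\<close>

context
  fixes B :: "'a::cstar_algebra set"
  assumes B: "cstar_subalgebra B"
begin

lemma inv2_minus: "inv2 B p q a b \<Longrightarrow> inv2 B p q (- a) (- b)"
  unfolding inv2_def using MB_minus[OF B] by simp

lemma inv2_unipotent:
  assumes "MB B r" "r * r = r" "MB B x" "r * x = x" "x * r = x" "x * x = 0"
  shows "inv2 B r r (r + x) (r - x)"
  unfolding inv2_def using assms MB_add[OF B] MB_diff[OF B]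
  by (simp add: distrib_left distrib_right left_diff_distrib right_diff_distrib)

end

context pair
begin

text \<open>After its target is permuted, the sum becomes the automorphism
  \<open>\<alpha> - \<beta>\<close> of \<open>p + q'\<close>, a quarter turn, which is joined to the
  identity through products of unipotents.\<close>

lemma eqv_inverse:
  assumes t: "(p, q, a) \<in> Gam B' B" and b: "inv2 B p q a b" and N: "suppT N (p, q, a)"
  shows "eqv B' B ((p, q, a) + shT N (q, p, b)) 0"
proof -
  define V where "V = (isom N N :: 'a unitz fmat)"
  define p' q' b' where "p' = sh N p" and "q' = sh N q" and "b' = sh N b"
  have pq: "prj B' p" "prj B' q" "MB B' p" "MB B' q" "p * p = p" "q * q = q"
    using t by (auto simp: Gam_def prj_def)
  have N: "supp N p" "supp N q" "supp N a" using N by (auto simp: suppT_def)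
  have Nb: "supp N b" using imor_supp[of B q p b N] inv2_sym[OF b] N by (auto simp: imor_def)
  note b1 = inv2D[OF b]
  have iq: "inv2 B' q q' (V * q) (q * star V)" unfolding q'_def V_def by (rule inv2_isom[OF B' pq(4,6) N(2)])
  have ip: "inv2 B' p p' (V * p) (p * star V)" unfolding p'_def V_def by (rule inv2_isom[OF B' pq(3,5) N(1)])
  note q1 = inv2D[OF iq] and p1 = inv2D[OF ip]
  define \<alpha> \<beta> where "\<alpha> = V * q * a" and "\<beta> = b * (q * star V)"
  have i: "inv2 B p q' \<alpha> \<beta>"
    unfolding \<alpha>_def \<beta>_def by (rule inv2_comp[OF B b inv2_mono[OF iq sub]])
  note i1 = inv2D[OF i]
  define r where "r = p + q'"
  have o: "p * q' = 0" "q' * p = 0" "q * p' = 0" "p' * q = 0" "q * b' = 0" "p' * a = 0"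
    unfolding p'_def q'_def b'_def using sh_orth[OF _ order_refl] N by auto
  have *: "x * y = 0" if "x * u = x" "v * y = y" "u * v = 0" for x y u v :: "'a unitz fmat"
  proof -
    have "x * y = x * (u * v) * y" using that(1,2) by (metis mult.assoc)
    with that show ?thesis by simp
  qed
  have qq: "q' * q' = q'" using inv2_idem[OF iq] by simp
  have z: "p * \<alpha> = 0" "\<alpha> * q' = 0" "q' * \<beta> = 0" "\<beta> * p = 0" "\<alpha> * \<alpha> = 0" "\<beta> * \<beta> = 0"
    by (fact *[OF pq(5) i1(3) o(1)] *[OF i1(4) qq o(1)] *[OF qq i1(5) o(2)] *[OF i1(6) pq(5) o(2)]
        *[OF i1(4) i1(3) o(1)] *[OF i1(6) i1(5) o(2)])+
  have pr: "prj B' r" unfolding r_def q'_def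
    by (rule prj_sum[OF B' pq(1) prj_sh[OF B' pq(2)] o(1,2)[unfolded q'_def]])
  then have rr: "MB B r" "r * r = r" using prj_mono[OF pr sub] by (auto simp: prj_def)
  have ra: "r * \<alpha> = \<alpha>" "\<alpha> * r = \<alpha>" "r * \<beta> = \<beta>" "\<beta> * r = \<beta>"
    by (simp_all add: r_def distrib_left distrib_right z i1)
  \<comment> \<open>At s = 1 this is the factorization of the quarter turn into three unipotents;
    each factor is invertible for every s because \<alpha> and \<beta> square to zero.\<close>
  define h where "h s = (r - scaleR s \<beta>) * ((r + scaleR s \<alpha>) * (r - scaleR s \<beta>))" for s :: real
  have hinv: "imor B r r (h s)" for s
  proof -
    have 1: "imor B r r (r + scaleR s \<alpha>)" unfolding imor_def
      using inv2_unipotent[OF B rr, of "scaleR s \<alpha>"] ra z i1 MB_scaleR[OF B] by auto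
    have 2: "imor B r r (r - scaleR s \<beta>)" unfolding imor_def
      using inv2_unipotent[OF B rr, of "scaleR (- s) \<beta>"] ra z i1 MB_scaleR[OF B] MB_minus[OF B] by auto
    show ?thesis unfolding h_def by (rule imor_comp[OF B imor_comp[OF B 2 1] 2])
  qed
  have h0: "h 0 = r" by (simp add: h_def rr)
  have "(r + \<alpha>) * (r - \<beta>) = r + \<alpha> - \<beta> - q'"
    by (simp add: distrib_right right_diff_distrib rr ra i1)
  then have ab: "(r + \<alpha>) * (r - \<beta>) = p + \<alpha> - \<beta>" by (simp add: r_def)
  have "h 1 = (r - \<beta>) * (p + \<alpha> - \<beta>)" by (simp add: h_def ab)
  also have "\<dots> = r * p + \<alpha> - \<beta> - p"
    by (simp add: left_diff_distrib distrib_left right_diff_distrib ra z i1)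
  also have "r * p = p" by (simp add: r_def distrib_right pq o)
  finally have h1: "h 1 = \<alpha> - \<beta>" by simp
  have "conn B r (\<alpha> - \<beta>)" unfolding conn_def
  proof (intro exI[of _ "\<lambda>s. h (1 - s)"] conjI ballI)
    show "continuous_on {0..1} (\<lambda>s. h (1 - s))" unfolding h_def by (intro continuous_intros)
  qed (auto simp: h0 h1 hinv)
  then have el: "elem B (r, r, \<alpha> - \<beta>)" by (simp add: elem_def)
  have Gr: "(r, r, \<alpha> - \<beta>) \<in> Gam B' B" using pr hinv[of 1] by (simp add: Gam_def h1)
  \<comment> \<open>Identifies \<open>q + p'\<close> with \<open>q' + p\<close> over
    \<open>B'\<close>. The minus sign turns the exchange into the rotation that \<open>h\<close>
    reaches.\<close>
  define d where "d = V * q - p * star V"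
  have id: "imor B' (q + p') (q' + p) d"
    using imor_sum[OF B' _ _ o(3,4) o(2,1), of "V * q" "- (p * star V)"] iq inv2_minus[OF B' inv2_sym[OF ip]]
    by (auto simp: imor_def d_def)
  have da: "d * (a + b') = (\<alpha> - \<beta>) * r"
  proof -
    have "p * star V * a = p * star V * p' * a" by (simp only: p1(6))
    then have 1: "p * star V * a = 0" by (simp add: mult.assoc o)
    have 2: "V * q * b' = 0" by (simp add: mult.assoc o)
    have "p * star V * b' = p * ((star V * V) * b) * star V"
      by (simp only: b'_def V_def sh_isom[OF Nb] mult.assoc)
    also have "\<dots> = b * star V" by (simp add: V_def isom_star_isom blk_mult Nb b1)
    also have "\<dots> = \<beta>" by (simp add: \<beta>_def b1 flip: mult.assoc)
    finally have 3: "p * star V * b' = \<beta>" .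
    have 4: "V * q * a = \<alpha>" by (simp only: \<alpha>_def)
    show ?thesis by (simp add: d_def left_diff_distrib distrib_left 1 2 3 4 ra)
  qed
  have eq: "(p, q, a) + shT N (q, p, b) = (r, q + p', a + b')"
    by (simp add: shT_def r_def p'_def q'_def b'_def)
  have sG: "(p, q, a) + shT N (q, p, b) \<in> Gam B' B"
  proof (intro Gam_add Gam_sh t)
    show "(q, p, b) \<in> Gam B' B" using pq inv2_sym[OF b] by (auto simp: Gam_def imor_def)
    show "orth (p, q, a) (shT N (q, p, b))"
      using N by (intro orth_shT[of N]) (auto simp: suppT_def)
  qed
  have "isoT B' ((p, q, a) + shT N (q, p, b)) (r, r, \<alpha> - \<beta>)"
    unfolding eq isoT_def using imor_id[OF B' pr] id da by (auto simp: r_def add.commute)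
  then have "eqv B' B ((p, q, a) + shT N (q, p, b)) (r, r, \<alpha> - \<beta>)"
    by (rule isoT_eqv[OF _ sG Gr])
  moreover have "eqv B' B (r, r, \<alpha> - \<beta>) 0"
    using eqv_add_elem[OF Gam_zero Gr el] by simp
  ultimately show ?thesis by (rule eqv_trans)
qed

end

section \<open>Excision\<close>

text \<open>The corner of \<open>P\<close> at a fixed matrix size is complete, so the Neumann series
  applies there with \<open>P\<close> as the unit.\<close>

lemma neumann_corner:
  fixes P :: "'a::cstar_algebra unitz fmat"
  assumes B: "cstar_subalgebra B" and P: "MB B P" "P * P = P"
    and x: "MB B x" "P * x = x" "x * P = x" "norm x < 1"
  obtains y where "inv2 B P P (P - x) (P + y)" "norm y \<le> norm x + norm x * norm y"
proof -
  obtain N where N: "supp N P" "supp N x" by (rule ex_supp2)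
  define S where "S = {y. supp N y \<and> (\<forall>i j. ent y i j \<in> {u. vect u \<in> B})} \<inter> {y. P * y = y} \<inter> {y. y * P = y}"
  have mem: "y \<in> S \<longleftrightarrow> supp N y \<and> MB B y \<and> P * y = y \<and> y * P = y" for y
    by (auto simp: S_def MB_def)
  have "closed {y. P * y = y}" "closed {y. y * P = y}"
    by (intro closed_Collect_eq continuous_intros)+
  then have "complete S" unfolding S_def
    by (intro complete_Int_closed complete_fmat closed_vect[OF B])
  moreover have "0 \<in> S" using B by (simp add: mem)
  moreover have "u + v \<in> S \<and> u * v \<in> S" if "u \<in> S" "v \<in> S" for u v
    using that MB_add[OF B] MB_mult[OF B] unfolding mem
    by (simp add: supp_add supp_mult distrib_left distrib_right) (simp add: mult.assoc, simp flip: mult.assoc)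
  moreover have "x \<in> S" using x N by (simp add: mem)
  ultimately obtain y where y: "y \<in> S" "y = x + x * y" "y = x + y * x"
    using neumann[of S x] x(4) by metis
  have y': "MB B y" "P * y = y" "y * P = y" using y(1) by (auto simp: mem)
  have "(P - x) * (P + y) = P + (y - (x + x * y))" "(P + y) * (P - x) = P + (y - (x + y * x))"
    by (simp_all add: distrib_left distrib_right left_diff_distrib right_diff_distrib P x y')
  then have "(P - x) * (P + y) = P" "(P + y) * (P - x) = P" using y(2,3) by simp_all
  then have "inv2 B P P (P - x) (P + y)"
    unfolding inv2_def using MB_add[OF B] MB_diff[OF B] x y' P
    by (simp add: distrib_left distrib_right left_diff_distrib right_diff_distrib)
  moreover have "norm y \<le> norm x + norm x * norm y"
    using norm_triangle_ineq[of x "x * y"] norm_mult_ineq[of x y] y(2) by simp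
  ultimately show thesis by (rule that)
qed

text \<open>The algebra C is the whole type, and \<open>AC\<close> says that C' maps onto the
  quotient by \<open>A\<close>.\<close>

locale excision =
  fixes A C' :: "'a::cstar_algebra set"
  assumes ideal: "closed_ideal A" and A: "cstar_subalgebra A" and C': "cstar_subalgebra C'"
    and AC: "\<And>z. \<exists>x\<in>C'. z - x \<in> A"
begin

abbreviation "A' \<equiv> A \<inter> C'"

lemma A': "cstar_subalgebra A'"
  using A C' by (auto simp: cstar_subalgebra_def complex_subspace_def)

sublocale small: pair A' A
  by unfold_locales (use A A' in auto)

sublocale big: pair C' UNIV
  by unfold_locales (use C' cstar_subalgebra_UNIV in auto)

text \<open>For a projection \<open>P\<close> over \<open>A'\<close>, \<open>connI P\<close> is a path-connected normal subgroup of the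
  invertibles of \<open>P M(C~) P\<close>, so \<open>factors P\<close> is a subgroup too. It contains a neighbourhood of
  \<open>P\<close> and hence every invertible that is homotopic to \<open>P\<close>.\<close>

definition connI :: "'a unitz fmat \<Rightarrow> 'a unitz fmat \<Rightarrow> bool" where
  "connI P w \<longleftrightarrow> (\<exists>h :: real \<Rightarrow> 'a unitz fmat. continuous_on {0..1} h \<and> h 0 = w \<and> h 1 = P \<and>
    (\<forall>s\<in>{0..1}. imor UNIV P P (h s) \<and> MI A (h s - P)))"

definition factors :: "'a unitz fmat \<Rightarrow> 'a unitz fmat \<Rightarrow> bool" where
  "factors P w \<longleftrightarrow> (\<exists>l \<pi>. imor C' P P l \<and> connI P \<pi> \<and> w = l * \<pi>)"

lemma connIE:
  assumes "connI P w"
  obtains h :: "real \<Rightarrow> 'a unitz fmat" where "continuous_on {0..1} h" "h 0 = w" "h 1 = P"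
    "\<forall>s\<in>{0..1}. imor UNIV P P (h s)" "\<forall>s\<in>{0..1}. MI A (h s - P)"
  using assms unfolding connI_def by blast

lemma connI_D: "connI P w \<Longrightarrow> imor UNIV P P w" "connI P w \<Longrightarrow> MI A (w - P)"
  unfolding connI_def by force+

text \<open>The identity \<open>v - P = - ((w - P) * v)\<close> makes the inverse congruent to
  \<open>P\<close> as well, so invertibility over C descends to \<open>A\<close>.\<close>

lemma MB_inverse_cong:
  assumes w: "inv2 UNIV P P w v" and I: "MI A (w - P)" and P: "MB A P"
  shows "inv2 A P P w v"
proof -
  have "v - P = - ((w - P) * v)" using inv2D[OF w] by (simp add: left_diff_distrib)
  then have "MI A (v - P)" using MI_minus[OF ideal MI_mult(1)[OF ideal I]] by simp
  then have "MB A w" "MB A v" using MB_of_cong[OF ideal] I P by blast+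
  then show ?thesis using w by (simp add: inv2_def)
qed

lemma connI_conn:
  assumes "connI P w" "MB A P"
  shows "conn A P w"
proof -
  obtain h :: "real \<Rightarrow> 'a unitz fmat" where h: "continuous_on {0..1} h" "h 0 = w" "h 1 = P"
    "\<forall>s\<in>{0..1}. imor UNIV P P (h s)" "\<forall>s\<in>{0..1}. MI A (h s - P)"
    using assms(1) by (rule connIE)
  have "\<forall>s\<in>{0..1}. imor A P P (h s)"
    using h(4,5) MB_inverse_cong[OF _ _ assms(2)] unfolding imor_def by meson
  then show ?thesis unfolding conn_def using h(1,2,3) by blast
qed

context
  fixes P :: "'a unitz fmat"
  assumes P: "prj A' P"
begin

lemma PP: "P * P = P" "MB A' P" "MB C' P" "MB A P"
  using P by (auto simp: prj_def MB_Int)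

lemma imor_P: "imor C' P P P" "imor UNIV P P P"
  using imor_id[OF C'] imor_id[OF cstar_subalgebra_UNIV] PP P by (auto simp: prj_def)

lemma connI_id: "connI P P"
  unfolding connI_def by (intro exI[of _ "\<lambda>s. P"]) (simp add: imor_P ideal)

lemma connI_mult:
  assumes "connI P v" "connI P w"
  shows "connI P (v * w)"
proof -
  obtain h :: "real \<Rightarrow> 'a unitz fmat" where h: "continuous_on {0..1} h" "h 0 = v" "h 1 = P"
    "\<forall>s\<in>{0..1}. imor UNIV P P (h s)" "\<forall>s\<in>{0..1}. MI A (h s - P)"
    using assms(1) by (rule connIE)
  obtain k :: "real \<Rightarrow> 'a unitz fmat" where k: "continuous_on {0..1} k" "k 0 = w" "k 1 = P"
    "\<forall>s\<in>{0..1}. imor UNIV P P (k s)" "\<forall>s\<in>{0..1}. MI A (k s - P)"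
    using assms(2) by (rule connIE)
  have "MI A (h s * k s - P)" if "s \<in> {0..1}" for s
    using MI_cong_mult[OF ideal, of "h s" P "k s" P] h(5) k(5) that PP by simp
  then show ?thesis unfolding connI_def
    by (intro exI[of _ "\<lambda>s. h s * k s"])
      (use h k PP in \<open>auto intro!: continuous_intros imor_comp[OF cstar_subalgebra_UNIV]\<close>)
qed

lemma connI_conj:
  assumes "connI P w" and l: "inv2 UNIV P P l l'"
  shows "connI P (l' * w * l)"
proof -
  obtain h :: "real \<Rightarrow> 'a unitz fmat" where h: "continuous_on {0..1} h" "h 0 = w" "h 1 = P"
    "\<forall>s\<in>{0..1}. imor UNIV P P (h s)" "\<forall>s\<in>{0..1}. MI A (h s - P)"
    using assms(1) by (rule connIE)
  note l1 = inv2D[OF l]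
  have "MI A (l' * h s * l - P)" if "s \<in> {0..1}" for s
  proof -
    have "MI A (l' * (h s - P) * l)" using h(5) that MI_mult[OF ideal] by blast
    also have "l' * (h s - P) * l = l' * h s * l - P"
      by (simp add: left_diff_distrib right_diff_distrib l1)
    finally show ?thesis .
  qed
  moreover have "imor UNIV P P (l' * h s * l)" if "s \<in> {0..1}" for s
    using h(4) that l inv2_sym[OF l] imor_comp[OF cstar_subalgebra_UNIV] unfolding imor_def[symmetric]
    by (metis imor_def)
  moreover have "l' * P * l = P" using l1 by simp
  ultimately show ?thesis unfolding connI_def
    by (intro exI[of _ "\<lambda>s. l' * h s * l"]) (use h in \<open>auto intro!: continuous_intros\<close>)
qed

text \<open>\<open>v * h (1 - s)\<close> is a translate of the reversed path; it joins
  \<open>v\<close> to \<open>v * w = P\<close>.\<close>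

lemma connI_inv:
  assumes "connI P w" and v: "inv2 UNIV P P w v"
  shows "connI P v"
proof -
  obtain h :: "real \<Rightarrow> 'a unitz fmat" where h: "continuous_on {0..1} h" "h 0 = w" "h 1 = P"
    "\<forall>s\<in>{0..1}. imor UNIV P P (h s)" "\<forall>s\<in>{0..1}. MI A (h s - P)"
    using assms(1) by (rule connIE)
  note v1 = inv2D[OF v]
  have I: "MI A (v * h s - P)" if "s \<in> {0..1}" for s
  proof -
    have "MI A (v * ((h s - P) - (w - P)))"
      using h(5) that connI_D(2)[OF assms(1)] MI_mult[OF ideal] MI_diff[OF ideal] by blast
    then show ?thesis by (simp add: right_diff_distrib v1)
  qed
  have J: "imor UNIV P P (v * h s)" if "s \<in> {0..1}" for s
    using h(4) that inv2_sym[OF v] imor_comp[OF cstar_subalgebra_UNIV, of P P "h s" P v]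
    unfolding imor_def by blast
  have "continuous_on {0..1} (\<lambda>s. v * h (1 - s))"
    by (intro continuous_intros continuous_on_compose2[OF h(1)]) auto
  then show ?thesis unfolding connI_def
    by (intro exI[of _ "\<lambda>s. v * h (1 - s)"]) (use h I J v1 in auto)
qed

lemma factors_mult:
  assumes "factors P v" "factors P w"
  shows "factors P (v * w)"
proof -
  obtain l \<pi> where 1: "imor C' P P l" "connI P \<pi>" "v = l * \<pi>" using assms(1) by (auto simp: factors_def)
  obtain k \<tau> where 2: "imor C' P P k" "connI P \<tau>" "w = k * \<tau>" using assms(2) by (auto simp: factors_def)
  obtain k' where k: "inv2 C' P P k k'" using 2 by (auto simp: imor_def)
  have p: "\<pi> * P = \<pi>" using connI_D(1)[OF 1(2)] by (auto simp: imor_def inv2_def)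
  have "(l * k) * ((k' * \<pi> * k) * \<tau>) = l * (k * k') * \<pi> * k * \<tau>" by (simp only: mult.assoc)
  also have "\<dots> = v * w"
    using inv2D[OF k] 1 by (simp add: 2 imor_def inv2_def mult.assoc) (metis inv2D(4) mult.assoc)
  finally have "v * w = (l * k) * ((k' * \<pi> * k) * \<tau>)" ..
  moreover have "imor C' P P (l * k)" using imor_comp[OF C' 2(1) 1(1)] .
  moreover have "connI P ((k' * \<pi> * k) * \<tau>)"
    by (intro connI_mult connI_conj 1 2 inv2_mono[OF k]) simp
  ultimately show ?thesis unfolding factors_def by blast
qed

lemma factors_inv:
  assumes "factors P w" and v: "inv2 UNIV P P w v"
  shows "factors P v"
proof -
  obtain l \<pi> where 1: "imor C' P P l" "connI P \<pi>" "w = l * \<pi>" using assms(1) by (auto simp: factors_def)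
  obtain l' where l: "inv2 C' P P l l'" using 1 by (auto simp: imor_def)
  obtain \<pi>' where p: "inv2 UNIV P P \<pi> \<pi>'" using connI_D(1)[OF 1(2)] by (auto simp: imor_def)
  note l1 = inv2D[OF l] and p1 = inv2D[OF p] and v1 = inv2D[OF v]
  have "w * (\<pi>' * l') = l * (\<pi> * \<pi>') * l'" by (simp only: 1(3) mult.assoc)
  then have "v = v * (w * (\<pi>' * l'))" using p1 l1 v1 by simp
  also have "\<dots> = (v * w) * \<pi>' * l'" by (simp only: mult.assoc)
  also have "\<dots> = \<pi>' * l'" using v1 p1 by simp
  also have "\<dots> = (l' * l) * \<pi>' * l'" using l1 p1 by simp
  also have "\<dots> = l' * (l * \<pi>' * l')" by (simp only: mult.assoc)
  finally have "v = l' * (l * \<pi>' * l')" .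
  moreover have "connI P (l * \<pi>' * l')"
    using connI_conj[OF connI_inv[OF 1(2) p]] inv2_sym[OF inv2_mono[OF l]] by blast
  moreover have "imor C' P P l'" using inv2_sym[OF l] by (auto simp: imor_def)
  ultimately show ?thesis unfolding factors_def by blast
qed

text \<open>Write \<open>w = P + z\<close>. A small lift \<open>x\<close> of \<open>z\<close> makes
  \<open>P + x\<close> invertible over C', and \<open>w\<close> is \<open>P + x\<close> times
  \<open>P + n\<close> with \<open>n\<close> small and in the ideal; the segment from
  \<open>P + n\<close> to \<open>P\<close> consists of invertibles.\<close>

lemma factors_near:
  obtains \<delta> where "\<delta> > 0" "\<And>w. P * w = w \<Longrightarrow> w * P = w \<Longrightarrow> norm (w - P) < \<delta> \<Longrightarrow> factors P w"
proof -
  obtain M where M: "M > 0" "\<And>N z. supp N z \<Longrightarrow> \<exists>x. MB C' x \<and> MI A (z - x) \<and> supp N x \<and> norm x \<le> M * norm z"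
    using lift_fmat[OF ideal C' AC] by metis
  define Q where "Q = norm P + 1"
  have Q: "Q > 0" "norm P \<le> Q" by (simp_all add: Q_def add_nonneg_pos)
  define \<mu> where "\<mu> = Q * M * Q"
  have \<mu>: "\<mu> > 0" using Q M by (simp add: \<mu>_def)
  \<comment> \<open>\<mu> bounds the compressed lift: \<open>norm x \<le> \<mu> * norm z\<close>.
    The first term gives \<open>norm x < 1/2\<close>, hence \<open>norm y \<le> 1\<close> and
    \<open>norm (P + y) \<le> Q\<close>; the second then gives \<open>norm n < 1\<close>.\<close>
  define \<delta> where "\<delta> = min (1 / (2 * \<mu>)) (1 / (Q * (1 + \<mu>)))"
  have \<delta>: "\<delta> > 0" using \<mu> Q by (simp add: \<delta>_def)
  have "factors P w" if w: "P * w = w" "w * P = w" "norm (w - P) < \<delta>" for w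
  proof -
    define z where "z = w - P"
    have z: "P * z = z" "z * P = z" using w PP by (simp_all add: z_def left_diff_distrib right_diff_distrib)
    have "norm z < 1 / (2 * \<mu>)" "norm z < 1 / (Q * (1 + \<mu>))" using w(3) by (auto simp: z_def \<delta>_def)
    then have nz: "\<mu> * norm z < 1/2" "Q * (1 + \<mu>) * norm z < 1"
      using \<mu> Q by (simp_all add: pos_less_divide_eq add_pos_pos ac_simps)
    obtain N where "supp N z" using ex_supp by blast
    then obtain x0 where x0: "MB C' x0" "MI A (z - x0)" "norm x0 \<le> M * norm z" using M(2) by blast
    define x where "x = P * x0 * P"
    have x: "MB C' x" "P * x = x" "x * P = x"
      unfolding x_def using MB_mult[OF C'] x0 PP by (auto simp: mult.assoc) (simp add: PP flip: mult.assoc)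
    have zx: "MI A (z - x)"
    proof -
      have "MI A (P * (z - x0) * P)" using MI_mult[OF ideal] x0 by blast
      then show ?thesis by (simp add: x_def left_diff_distrib right_diff_distrib z)
    qed
    have "norm x \<le> norm P * norm x0 * norm P"
      unfolding x_def by (intro order_trans[OF norm_mult_ineq] mult_right_mono norm_mult_ineq norm_ge_zero)
    also have "\<dots> \<le> Q * (M * norm z) * Q" using Q x0 M by (intro mult_mono) auto
    finally have nx: "norm x \<le> \<mu> * norm z" by (simp add: \<mu>_def ac_simps)
    then have nx2: "norm (- x) < 1 / 2" using nz by simp
    have nx1: "norm (- x) < 1" using nx2 by linarith
    have mx: "MB C' (- x)" "P * - x = - x" "- x * P = - x" using x MB_minus[OF C'] by auto
    obtain y where y: "inv2 C' P P (P - (- x)) (P + y)" "norm y \<le> norm (- x) + norm (- x) * norm y"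
      using neumann_corner[OF C' PP(3,1) mx nx1] by metis
    have "norm (- x) * norm y \<le> 1/2 * norm y" using nx2 by (intro mult_right_mono) auto
    then have ny: "norm y \<le> 1" using y(2) nx2 by linarith
    define n where "n = (P + y) * (z - x)"
    have l: "inv2 C' P P (P + x) (P + y)" using y(1) by simp
    note l1 = inv2D[OF l]
    have n: "MI A n" "P * n = n" "n * P = n"
      unfolding n_def using MI_mult[OF ideal zx] l1 x z
      by (simp_all add: mult.assoc left_diff_distrib) (simp flip: mult.assoc)
    have "norm n \<le> norm (P + y) * norm (z - x)" unfolding n_def by (rule norm_mult_ineq)
    also have "\<dots> \<le> Q * (norm z + \<mu> * norm z)"
      using norm_triangle_ineq[of P y] norm_triangle_ineq4[of z x] ny nx Q
      by (intro mult_mono) (auto simp: Q_def)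
    also have "\<dots> = Q * (1 + \<mu>) * norm z" by (simp add: algebra_simps)
    finally have nn: "norm n < 1" using nz by linarith
    have inv: "imor UNIV P P (P + scaleR s n)" if s: "s \<in> {0..1}" for s
    proof -
      have "norm (scaleR (- s) n) \<le> norm n" using s by (simp add: mult_left_le_one_le)
      then have "norm (scaleR (- s) n) < 1" using nn by simp
      then obtain y' where "inv2 UNIV P P (P - scaleR (- s) n) (P + y')"
        using neumann_corner[OF cstar_subalgebra_UNIV _ PP(1), of "scaleR (- s) n"] n by (metis MB_UNIV mult_scaleR_left mult_scaleR_right)
      then show ?thesis by (auto simp: imor_def)
    qed
    have cI: "connI P (P + n)" unfolding connI_def
    proof (intro exI[of _ "\<lambda>s. P + scaleR (1 - s) n"] conjI ballI)
      show "continuous_on {0..1} (\<lambda>s. P + scaleR (1 - s) n)" by (intro continuous_intros)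
      fix s :: real assume "s \<in> {0..1}"
      then show "imor UNIV P P (P + scaleR (1 - s) n)" by (intro inv) auto
      show "MI A (P + scaleR (1 - s) n - P)" using MI_scaleR[OF ideal n(1)] by simp
    qed auto
    have "(P + x) * n = ((P + x) * (P + y)) * (z - x)" by (simp only: n_def mult.assoc)
    also have "\<dots> = z - x" using l1 x z by (simp add: right_diff_distrib)
    finally have "(P + x) * (P + n) = P + x + (z - x)" using l1 by (simp add: distrib_left)
    then have "w = (P + x) * (P + n)" by (simp add: z_def)
    moreover have "imor C' P P (P + x)" using l by (auto simp: imor_def)
    ultimately show ?thesis unfolding factors_def using cI by blast
  qed
  with \<delta> show thesis by (rule that)
qed

text \<open>Along the path \<open>factors P\<close> is locally constant: \<open>h t\<close> is
  \<open>h s * (v * h t)\<close>, whose second factor is near \<open>P\<close> for t near s. At the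
  end point \<open>P\<close> it holds.\<close>

lemma factors_path:
  assumes "conn UNIV P w"
  shows "factors P w"
proof -
  obtain h :: "real \<Rightarrow> 'a unitz fmat" where h: "continuous_on {0..1} h" "h 0 = w" "h 1 = P"
    "\<forall>s\<in>{0..1}. imor UNIV P P (h s)" using assms by (rule connE)
  obtain \<delta> where \<delta>: "\<delta> > 0" "\<And>w. P * w = w \<Longrightarrow> w * P = w \<Longrightarrow> norm (w - P) < \<delta> \<Longrightarrow> factors P w"
    using factors_near by blast
  have loc: "\<forall>\<^sub>F t in at s within {0..1}. factors P (h s) = factors P (h t)" if s: "s \<in> {0..1}" for s
  proof -
    obtain v where v: "inv2 UNIV P P (h s) v" using h(4) s unfolding imor_def by blast
    note v1 = inv2D[OF v]
    have "continuous_on {0..1} (\<lambda>t. v * h t)" using h(1) by (intro continuous_intros)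
    then have "((\<lambda>t. v * h t) \<longlongrightarrow> v * h s) (at s within {0..1})" using s by (simp add: continuous_on_def)
    then have "((\<lambda>t. v * h t) \<longlongrightarrow> P) (at s within {0..1})" by (simp only: v1)
    then have "\<forall>\<^sub>F t in at s within {0..1}. dist (v * h t) P < \<delta>" using \<delta>(1) by (rule tendstoD)
    moreover have "\<forall>\<^sub>F t in at s within {0..1}. t \<in> {0..1}" by (auto simp: eventually_at_filter)
    ultimately show ?thesis
    proof eventually_elim
      case (elim t)
      obtain u where u: "inv2 UNIV P P (h t) u" using h(4) elim(2) unfolding imor_def by blast
      note u1 = inv2D[OF u]
      have f: "factors P (v * h t)"
      proof (rule \<delta>(2))
        show "P * (v * h t) = v * h t" using v1 by (simp flip: mult.assoc)
        show "v * h t * P = v * h t" using u1 by (simp add: mult.assoc)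
      qed (use elim(1) in \<open>simp add: dist_norm\<close>)
      have e1: "h s * (v * h t) = h t" using v1 u1 by (simp flip: mult.assoc)
      have i: "inv2 UNIV P P (v * h t) (u * h s)"
        by (rule inv2_comp[OF cstar_subalgebra_UNIV u inv2_sym[OF v]])
      have "h t * (u * h s) = h s" using v1 u1 by (simp flip: mult.assoc)
      then show ?case using factors_mult[OF _ f] factors_mult[OF _ factors_inv[OF f i]] e1 by metis
    qed
  qed
  have "factors P (h 0) = factors P (h 1)"
    by (rule connected_local_const[of "{0..1::real}" 0 1 "\<lambda>s. factors P (h s)"]) (use loc in auto)
  moreover have "factors P P" unfolding factors_def
    using imor_P connI_id PP by (intro exI[of _ P]) auto
  ultimately show ?thesis using h by simp
qed

end

end

section \<open>Complements of projections, and injectivity\<close>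

lemma prj_blk: "cstar_subalgebra B \<Longrightarrow> prj B (blk N)"
  by (simp add: prj_def blk_mult supp_blk)

lemma prj_compl:
  assumes B: "cstar_subalgebra B" and p: "prj B p" "supp N p"
  shows "prj B (blk N - p)" "supp N (blk N - p)" "p * (blk N - p) = 0" "(blk N - p) * p = 0"
proof -
  have "blk N * p = p" "p * blk N = p" "p * p = p" "blk N * blk N = (blk N :: 'a unitz fmat)"
    using p by (auto simp: blk_mult mult_blk prj_def supp_blk)
  then show "prj B (blk N - p)" "p * (blk N - p) = 0" "(blk N - p) * p = 0"
    using B p MB_diff[OF B] by (auto simp: prj_def star_diff left_diff_distrib right_diff_distrib)
  show "supp N (blk N - p)" using p by (intro supp_diff supp_blk)
qed

lemma conn_conj:
  assumes B: "cstar_subalgebra B" and h: "conn B R w" and c: "inv2 B P R c c'"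
  shows "conn B P (c' * w * c)"
proof -
  obtain h :: "real \<Rightarrow> 'a unitz fmat" where h: "continuous_on {0..1} h" "h 0 = w" "h 1 = R"
    "\<forall>s\<in>{0..1}. imor B R R (h s)" using h by (rule connE)
  have "imor B P R c" "imor B R P c'" using c inv2_sym[OF c] by (auto simp: imor_def)
  then have i: "imor B P P (c' * h s * c)" if "s \<in> {0..1}" for s
    using imor_comp[OF B imor_comp[OF B _ h(4)[rule_format, OF that]]] by (simp add: mult.assoc)
  have "c' * R * c = P" using inv2D[OF c] by simp
  then show ?thesis unfolding conn_def
    by (intro exI[of _ "\<lambda>s. c' * h s * c"]) (use h i in \<open>auto intro!: continuous_intros\<close>)
qed

context excision
begin

lemma kernel_trivial:
  assumes x: "x \<in> Gam A' A" and eq: "eqv C' UNIV x 0"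
  shows "eqv A' A x 0"
proof -
  obtain p q a where x1: "x = (p, q, a)" by (cases x)
  have pq: "prj A' p" "prj A' q" and "imor A p q a" using x by (auto simp: x1 Gam_def)
  then obtain b where b: "inv2 A p q a b" by (auto simp: imor_def)
  have xC: "x \<in> Gam C' UNIV" using x by (rule Gam_mono) auto
  obtain e e' where e: "e \<in> Gam C' UNIV" "e' \<in> Gam C' UNIV" "elem UNIV e" "elem UNIV e'"
    "\<And>K. suppT K x \<Longrightarrow> suppT K (0 :: 'a mtriple) \<Longrightarrow> isoT C' (x + shT K e) (0 + shT K e')"
    using big.eqv_far[OF eq] by metis
  obtain K where K: "suppT K x" using ex_suppT by blast
  have "suppT K (0 :: 'a mtriple)" by (simp add: suppT_def zero_prod_def)
  then have iso0: "isoT C' (x + shT K e) (shT K e')" using e(5)[OF K] by simp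
  obtain s0 k0 where e1: "e = (s0, s0, k0)" and k0: "conn UNIV s0 k0"
    using e(3) by (cases e) (auto simp: elem_def)
  have s0: "prj C' s0" using e(1) by (simp add: e1 Gam_def)
  obtain m where m: "supp m s0" using ex_supp by blast
  \<comment> \<open>\<open>s0\<close> is a projection over C' only. Its complement in
    \<open>blk m\<close> completes it to a scalar one, so that the stabilized triple starts at a
    projection over A'.\<close>
  define F0 where "F0 = blk m - s0"
  note F0 = prj_compl[OF C' s0 m, folded F0_def]
  define F where "F = sh K F0"
  have prF: "prj C' F" unfolding F_def by (rule prj_sh[OF C' F0(1)])
  define FT where "FT = (F, F, F)"
  have FT: "FT \<in> Gam C' UNIV" "elem UNIV FT"
    unfolding FT_def using prF by (rule big.Gam_refl, rule big.elem_refl)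
  define s k where "s = sh K s0" and "k = sh K k0"
  have she: "shT K e = (s, s, k)" by (simp add: e1 shT_def s_def k_def)
  have prs: "prj C' s" unfolding s_def by (rule prj_sh[OF C' s0])
  have sF: "s * F = 0" "F * s = 0" unfolding s_def F_def
    using arg_cong[OF F0(3), of "sh K"] arg_cong[OF F0(4), of "sh K"] by (simp_all add: sh_mult)
  have FTe: "FT = shT K (F0, F0, F0)" by (simp add: FT_def F_def shT_def)
  have o1: "orth x (shT K e)" "orth x FT" unfolding FTe by (rule orth_shT[OF K order_refl])+
  have o2: "orth (shT K e) FT" unfolding she FT_def orth_def using sF by simp
  obtain L where L: "suppT L (shT K e')" using ex_suppT by blast
  define FT' where "FT' = shT L FT"
  have FT': "FT' \<in> Gam C' UNIV" "elem UNIV FT'"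
    unfolding FT'_def by (rule big.Gam_sh[OF FT(1)], rule big.elem_sh[OF FT(2)])
  have o3: "orth (shT K e') FT'" unfolding FT'_def by (rule orth_shT[OF L order_refl])
  have iso1: "isoT C' ((x + shT K e) + FT) (shT K e' + FT')"
    by (rule big.isoT_add[OF iso0 _ orth_add_left[OF o1(2) o2] o3])
      (simp_all add: FT'_def big.isoT_shT FT big.Gam_sh e xC big.Gam_add o1)
  have "elem UNIV (shT K e' + FT')" by (rule big.elem_add[OF big.elem_sh[OF e(4)] FT'(2) o3])
  then obtain R h where R: "shT K e' + FT' = (R, R, h)" and h: "conn UNIV R h"
    by (cases "shT K e' + FT'") (auto simp: elem_def)
  define S where "S = sh K (blk m :: 'a unitz fmat)"
  have SF: "S = s + F" by (simp add: S_def s_def F_def F0_def flip: sh_add)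
  have prS: "prj A' S" "prj C' S" unfolding S_def
    using prj_sh[OF A' prj_blk[OF A']] prj_sh[OF C' prj_blk[OF C']] by auto
  define ka where "ka = k + F"
  have kS: "conn UNIV S ka" unfolding SF ka_def
  proof (rule conn_sum[OF cstar_subalgebra_UNIV _ conn_id[OF cstar_subalgebra_UNIV] sF])
    show "conn UNIV s k" unfolding s_def k_def by (rule conn_sh[OF cstar_subalgebra_UNIV k0])
    show "prj UNIV F" using prF by (rule prj_mono) simp
  qed
  have iso2: "isoT C' (p + S, q + S, a + ka) (R, R, h)"
    using iso1 unfolding R by (simp add: x1 she FT_def SF ka_def add.assoc)
  define P Q where "P = p + S" and "Q = q + S"
  obtain c d where cd: "imor C' P R c" "imor C' Q R d" "d * (a + ka) = h * c"
    using iso2 by (auto simp: isoT_def P_def Q_def)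
  obtain c' where c: "inv2 C' P R c c'" using cd by (auto simp: imor_def)
  obtain d' where d: "inv2 C' Q R d d'" using cd by (auto simp: imor_def)
  have "supp K p" "supp K q" using K by (auto simp: x1 suppT_def)
  then have pS: "p * S = 0" "S * p = 0" "q * S = 0" "S * q = 0"
    unfolding S_def using sh_orth[OF _ order_refl] by auto
  have prP: "prj A' P" "prj A' Q" unfolding P_def Q_def using prj_sum[OF A' _ prS(1)] pq pS by auto
  have prPC: "prj UNIV P" using prP(1) by (rule prj_mono) simp
  define \<alpha> where "\<alpha> = a + S"
  define \<beta> where "\<beta> = b + S"
  have prSA: "prj A S" using prS(1) by (rule prj_mono) simp
  have ab: "inv2 A P Q \<alpha> \<beta>" unfolding P_def Q_def \<alpha>_def \<beta>_def
    by (rule inv2_sum[OF A b inv2_id[OF A] pS]) (use prSA in \<open>auto simp: prj_def\<close>)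
  \<comment> \<open>Splits off the stabilizing part: \<open>a + ka\<close> is
    \<open>\<alpha> * \<kappa>\<close> with \<alpha> over \<open>A\<close> and \<kappa> homotopic to
    \<open>P\<close>.\<close>
  define \<kappa> where "\<kappa> = p + ka"
  have prp: "prj UNIV p" using pq(1) by (rule prj_mono) simp
  have kP: "conn UNIV P \<kappa>" unfolding P_def \<kappa>_def
    by (rule conn_sum[OF cstar_subalgebra_UNIV conn_id[OF cstar_subalgebra_UNIV prp] kS pS(1,2)])
  have kaS: "S * ka = ka"
  proof -
    obtain H :: "real \<Rightarrow> 'a unitz fmat" where "H 0 = ka" "\<forall>s\<in>{0..1}. imor UNIV S S (H s)"
      using kS by (rule connE)
    then have "imor UNIV S S ka" by fastforce
    then show ?thesis by (auto simp: imor_def inv2_def)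
  qed
  have ap: "a * p = a" using b by (simp add: inv2_def)
  have "a * ka = a * (p * S) * ka" using ap kaS by (metis mult.assoc)
  then have aka: "a * ka = 0" by (simp add: pS)
  have \<alpha>\<kappa>: "\<alpha> * \<kappa> = a + ka"
    by (simp add: \<alpha>_def \<kappa>_def distrib_left distrib_right ap aka pS kaS)
  define w where "w = c' * h * c"
  have w: "conn UNIV P w" unfolding w_def
    by (rule conn_conj[OF cstar_subalgebra_UNIV h inv2_mono[OF c]]) simp
  \<comment> \<open>The two components of the isomorphism combine to \<open>g\<close> from
    \<open>Q\<close> to \<open>P\<close>, and \<open>g * \<alpha> * \<kappa>\<close> is the
    conjugate \<open>w\<close> of \<open>h\<close>. Hence \<open>g * \<alpha>\<close> is a quotient
    of two elements homotopic to \<open>P\<close>.\<close>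
  define g where "g = c' * d"
  define gi where "gi = d' * c"
  have g: "inv2 C' Q P g gi" unfolding g_def gi_def by (rule inv2_comp[OF C' d inv2_sym[OF c]])
  have "g * \<alpha> * \<kappa> = c' * (d * (a + ka))" by (simp only: g_def \<alpha>\<kappa> mult.assoc)
  then have gw: "g * \<alpha> * \<kappa> = w" by (simp only: cd w_def mult.assoc)
  have "imor UNIV P P \<kappa>"
  proof -
    obtain H :: "real \<Rightarrow> 'a unitz fmat" where "H 0 = \<kappa>" "\<forall>s\<in>{0..1}. imor UNIV P P (H s)"
      using kP by (rule connE)
    then show ?thesis by fastforce
  qed
  then obtain \<kappa>' where \<kappa>': "inv2 UNIV P P \<kappa> \<kappa>'" by (auto simp: imor_def)
  have "factors P (w * \<kappa>')"
    by (intro factors_mult[OF prP(1)] factors_path[OF prP(1) w] factors_inv[OF prP(1) factors_path[OF prP(1) kP] \<kappa>'])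
  moreover have "w * \<kappa>' = g * \<alpha>"
  proof -
    have "w * \<kappa>' = g * (\<alpha> * (\<kappa> * \<kappa>'))" by (simp only: gw[symmetric] mult.assoc)
    then show ?thesis using inv2D[OF \<kappa>'] inv2D[OF ab] by simp
  qed
  ultimately obtain l \<pi> where l: "imor C' P P l" and pi: "connI P \<pi>" and gl: "g * \<alpha> = l * \<pi>"
    by (auto simp: factors_def)
  obtain l' where l': "inv2 C' P P l l'" using l by (auto simp: imor_def)
  \<comment> \<open>Over C' by construction, and over \<open>A\<close> because it equals
    \<open>\<pi> * \<beta>\<close>; its inverse is likewise
    \<open>\<alpha> * \<pi>'\<close>.\<close>
  define g' where "g' = l' * g"
  define gi' where "gi' = gi * l"
  have g': "inv2 C' Q P g' gi'" unfolding g'_def gi'_def by (rule inv2_comp[OF C' g inv2_sym[OF l']])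
  have PA: "MB A P" using prP(1) by (auto simp: prj_def MB_Int)
  obtain \<pi>' where "inv2 UNIV P P \<pi> \<pi>'" using connI_D(1)[OF pi] by (auto simp: imor_def)
  then have \<pi>': "inv2 A P P \<pi> \<pi>'" by (rule MB_inverse_cong[OF _ connI_D(2)[OF pi] PA])
  note ab1 = inv2D[OF ab] and p1 = inv2D[OF \<pi>'] and g1 = inv2D[OF g'] and l1 = inv2D[OF l']
  have "g' * \<alpha> = l' * l * \<pi>" by (simp only: g'_def gl mult.assoc)
  then have ga: "g' * \<alpha> = \<pi>" using l1 p1 by simp
  have "g' = g' * \<alpha> * \<beta>" using g1 ab1 by (simp add: mult.assoc)
  then have "MB A g'" using ga p1 ab1 MB_mult[OF A] by metis
  moreover have "gi' = gi' * (g' * \<alpha>) * \<pi>'" using g1 p1 ga by (simp add: mult.assoc)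
  then have "gi' = (gi' * g') * \<alpha> * \<pi>'" by (simp only: mult.assoc)
  then have "gi' = \<alpha> * \<pi>'" using g1 ab1 by simp
  then have "MB A gi'" using p1 ab1 MB_mult[OF A] by metis
  ultimately have gA: "imor A' Q P g'" using g' by (auto simp: imor_def inv2_def MB_Int)
  have ST: "(S, S, S) \<in> Gam A' A" "elem A (S, S, S)"
    using prS(1) by (rule small.Gam_refl, rule small.elem_refl)
  have xS: "x + (S, S, S) = (P, Q, \<alpha>)" by (simp add: x1 P_def Q_def \<alpha>_def)
  have oS: "orth x (S, S, S)" using pS by (simp add: orth_def x1)
  have G1: "(P, Q, \<alpha>) \<in> Gam A' A" using small.Gam_add[OF x ST(1) oS] by (simp only: xS)
  have G2: "(P, P, \<pi>) \<in> Gam A' A" using prP \<pi>' by (auto simp: Gam_def imor_def)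
  have "eqv A' A x (P, Q, \<alpha>)" using small.eqv_sym[OF small.eqv_add_elem[OF x ST oS]] by (simp only: xS)
  moreover have "g' * \<alpha> = \<pi> * P" by (simp only: ga p1)
  then have "isoT A' (P, Q, \<alpha>) (P, P, \<pi>)"
    unfolding isoT_def prod.case using imor_id[OF A' prP(1)] gA by blast
  then have "eqv A' A (P, Q, \<alpha>) (P, P, \<pi>)" by (rule small.isoT_eqv[OF _ G1 G2])
  moreover have "eqv A' A (P, P, \<pi>) 0"
    using small.eqv_add_elem[OF small.Gam_zero G2] connI_conn[OF pi PA] by (simp add: elem_def)
  ultimately show ?thesis using small.eqv_trans by blast
qed

lemma injective:
  assumes x: "x \<in> Gam A' A" and y: "y \<in> Gam A' A" and xy: "eqv C' UNIV x y"
  shows "eqv A' A x y"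
proof -
  obtain p q a where y1: "y = (p, q, a)" by (cases y)
  obtain b where b: "inv2 A p q a b" using y by (auto simp: y1 Gam_def imor_def)
  have yi: "(q, p, b) \<in> Gam A' A" using y inv2_sym[OF b] by (auto simp: y1 Gam_def imor_def)
  obtain N where N: "suppT N x" "suppT N y" using ex_suppT_list[of 0 "[x, y]"] by auto
  define z where "z = shT N (q, p, b)"
  have z: "z \<in> Gam A' A" unfolding z_def by (rule small.Gam_sh[OF yi])
  have o: "orth x z" "orth y z" unfolding z_def using N orth_shT by blast+
  have yz: "eqv A' A (y + z) 0"
    using small.eqv_inverse[OF y[unfolded y1] b N(2)[unfolded y1]] by (simp add: y1 z_def)
  have zC: "z \<in> Gam C' UNIV" using z by (rule Gam_mono) auto
  have "eqv C' UNIV (x + z) (y + z)" by (rule big.eqv_add[OF xy big.eqv_refl[OF zC] o])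
  moreover have "eqv C' UNIV (y + z) 0" using yz by (rule eqv_mono) auto
  ultimately have "eqv C' UNIV (x + z) 0" by (rule big.eqv_trans)
  then have xz: "eqv A' A (x + z) 0" by (rule kernel_trivial[OF small.Gam_add[OF x z o(1)]])
  obtain M where M: "suppT M x" "suppT M z" "suppT M y" using ex_suppT_list[of 0 "[x, z, y]"] by auto
  \<comment> \<open>\<open>x\<close> and \<open>y\<close> may occupy the same block, so a shifted
    copy of \<open>y\<close> is used to cancel \<open>z\<close> in
    \<open>x + z + y'\<close>.\<close>
  define y' where "y' = shT M y"
  have y': "y' \<in> Gam A' A" unfolding y'_def by (rule small.Gam_sh[OF y])
  have o': "orth x y'" "orth z y'" "orth y y'" unfolding y'_def using M orth_shT by blast+
  have yy': "eqv A' A y y'" unfolding y'_def by (rule small.eqv_shT[OF y])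
  have zy: "eqv A' A (z + y') 0"
  proof -
    have "eqv A' A (z + y') (z + y)"
      by (rule small.eqv_add[OF small.eqv_refl[OF z] small.eqv_sym[OF yy'] o'(2) orth_sym[OF o(2)]])
    with yz show ?thesis using small.eqv_trans by (metis add.commute)
  qed
  have "eqv A' A (x + (z + y')) (x + 0)"
    by (rule small.eqv_add[OF small.eqv_refl[OF x] zy orth_add_right[OF o(1) o'(1)]]) simp
  then have "eqv A' A x ((x + z) + y')" using small.eqv_sym by (simp add: add.assoc)
  moreover have "eqv A' A ((x + z) + y') (0 + y')"
    by (rule small.eqv_add[OF xz small.eqv_refl[OF y'] orth_add_left[OF o'(1,2)]]) simp
  ultimately show ?thesis using small.eqv_trans small.eqv_sym[OF yy'] by (metis add_0)
qed

section \<open>Surjectivity\<close>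

lemma surjective:
  assumes t: "t \<in> Gam C' UNIV"
  obtains u where "u \<in> Gam A' A" "eqv C' UNIV t u"
proof -
  note U = cstar_subalgebra_UNIV[where 'a = 'a]
  obtain p q a where t1: "t = (p, q, a)" by (cases t)
  obtain b where b: "inv2 UNIV p q a b" using t by (auto simp: t1 Gam_def imor_def)
  have pq: "prj C' p" "prj C' q" using t by (auto simp: t1 Gam_def)
  obtain N where N: "suppT N t" using ex_suppT by blast
  then have sN: "supp N p" "supp N q" "supp N a" by (auto simp: t1 suppT_def)
  \<comment> \<open>Together with its complement \<open>q\<close> becomes scalar; the complement is
    shifted by \<open>N\<close> so that one and the same summand is orthogonal to both
    \<open>p\<close> and \<open>q\<close>.\<close>
  define qc where "qc = blk N - q"
  note qc = prj_compl[OF C' pq(2) sN(2), folded qc_def]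
  define qs where "qs = sh N qc"
  have prqs: "prj C' qs" unfolding qs_def by (rule prj_sh[OF C' qc(1)])
  have E: "(qs, qs, qs) \<in> Gam C' UNIV" "elem UNIV (qs, qs, qs)"
    using prqs by (rule big.Gam_refl, rule big.elem_refl)
  have "(qs, qs, qs) = shT N (qc, qc, qc)" by (simp add: qs_def shT_def)
  then have oE: "orth t (qs, qs, qs)" using orth_shT[OF N order_refl] by metis
  have o: "p * qs = 0" "qs * p = 0" "q * qs = 0" "qs * q = 0" using oE by (auto simp: orth_def t1)
  define e where "e = p + qs"
  define q1 where "q1 = q + qs"
  define a1 where "a1 = a + qs"
  have tE: "t + (qs, qs, qs) = (e, q1, a1)" by (simp add: t1 e_def q1_def a1_def)
  have G1: "(e, q1, a1) \<in> Gam C' UNIV" using big.Gam_add[OF t E(1) oE] by (simp only: tE)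
  have t_eq: "eqv C' UNIV t (e, q1, a1)" using big.eqv_sym[OF big.eqv_add_elem[OF t E oE]] by (simp only: tE)
  have pre: "prj C' e" using G1 by (simp add: Gam_def)
  have "imor UNIV e q1 a1" using G1 by (simp add: Gam_def)
  then obtain b1 where ab1: "inv2 UNIV e q1 a1 b1" by (auto simp: imor_def)
  \<comment> \<open>\<open>p + qs\<close> is supported in the first 2 N coordinates, so
    \<open>f\<close>, which occupies the next \<open>N\<close>, is orthogonal to it.\<close>
  define L where "L = N + N"
  define f where "f = sh L (blk N :: 'a unitz fmat)"
  have pjf: "prj A' f" "prj C' f" "prj A f" unfolding f_def
    using prj_sh[OF A' prj_blk[OF A']] prj_sh[OF C' prj_blk[OF C']] prj_sh[OF A prj_blk[OF A]] by auto
  have "supp L qs" unfolding L_def qs_def by (rule supp_sh[OF qc(2)])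
  then have se: "supp L e" unfolding e_def using sN(1) by (intro supp_add) (auto simp: L_def intro: supp_mono)
  have ef: "e * f = 0" "f * e = 0" unfolding f_def using sh_orth[OF se order_refl] by auto
  \<comment> \<open>\<open>q\<close> and \<open>qc\<close> are complementary in
    \<open>blk N\<close>. Taking \<open>qs\<close> back to \<open>qc\<close> and then moving both by
    \<open>L\<close> carries \<open>q1\<close> onto \<open>f\<close>.\<close>
  obtain d where d: "imor C' q1 f d"
  proof -
    have 1: "imor C' q (sh L q) (isom L N * q)" "imor C' qc (sh L qc) (isom L N * qc)"
      "imor C' qc (sh N qc) (isom N N * qc)"
      using inv2_isom[OF C', of q N] inv2_isom[OF C', of qc N] pq(2) qc(1,2) sN unfolding imor_def prj_def by blast+
    from 1(3) obtain v where "inv2 C' qc qs (isom N N * qc) v" by (auto simp: imor_def qs_def)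
    then have "imor C' qs qc v" using inv2_sym unfolding imor_def by blast
    then have 2: "imor C' qs (sh L qc) (isom L N * qc * v)" using imor_comp[OF C' _ 1(2)] by blast
    have "sh L q * sh L qc = 0" "sh L qc * sh L q = 0" using qc(3,4) by (simp_all flip: sh_mult)
    then have "imor C' (q + qs) (sh L q + sh L qc) (isom L N * q + isom L N * qc * v)"
      using imor_sum[OF C' 1(1) 2 o(3,4)] by blast
    moreover have "sh L q + sh L qc = f" by (simp add: f_def qc_def flip: sh_add)
    ultimately show thesis using that by (simp add: q1_def)
  qed
  obtain d' where dd: "inv2 C' q1 f d d'" using d by (auto simp: imor_def)
  define a2 where "a2 = d * a1"
  define b2 where "b2 = b1 * d'"
  have ab2: "inv2 UNIV e f a2 b2" unfolding a2_def b2_def by (rule inv2_comp[OF U ab1 inv2_mono[OF dd]]) simp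
  note i2 = inv2D[OF ab2]
  have G2: "(e, f, a2) \<in> Gam C' UNIV" using pre pjf ab2 by (auto simp: Gam_def imor_def)
  have "d * a1 = a2 * e" by (simp only: i2 a2_def[symmetric])
  then have "isoT C' (e, q1, a1) (e, f, a2)"
    unfolding isoT_def prod.case using imor_id[OF C' pre] d by blast
  then have eq2: "eqv C' UNIV (e, q1, a1) (e, f, a2)" by (rule big.isoT_eqv[OF _ G1 G2])
  have lift: "\<exists>x. MB C' x \<and> MI A (z - x)" for z :: "'a unitz fmat"
    using lift_fmat[OF ideal C' AC] ex_supp[of z] by metis
  obtain a0 b0 where a0: "MB C' a0" "MI A (a2 - a0)" and b0: "MB C' b0" "MI A (b2 - b0)" using lift by metis
  have ee: "e * e = e" "f * f = f" "MB C' e" "MB C' f" using pre pjf by (auto simp: prj_def)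
  define \<alpha> where "\<alpha> = f * a0 * e"
  define \<beta> where "\<beta> = e * b0 * f"
  have \<alpha>: "f * \<alpha> = \<alpha>" "\<alpha> * e = \<alpha>" and \<beta>: "e * \<beta> = \<beta>" "\<beta> * f = \<beta>"
    unfolding \<alpha>_def \<beta>_def by (simp_all add: mult.assoc ee) (simp_all add: ee flip: mult.assoc)
  have MB\<alpha>: "MB C' \<alpha>" "MB C' \<beta>" unfolding \<alpha>_def \<beta>_def using MB_mult[OF C'] a0 b0 ee by auto
  have c\<alpha>: "MI A (a2 - \<alpha>)" and c\<beta>: "MI A (b2 - \<beta>)"
  proof -
    have "MI A (f * (a2 - a0) * e)" "MI A (e * (b2 - b0) * f)" using MI_mult[OF ideal] a0 b0 by blast+
    then show "MI A (a2 - \<alpha>)" "MI A (b2 - \<beta>)"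
      by (simp_all add: \<alpha>_def \<beta>_def left_diff_distrib right_diff_distrib i2)
  qed
  define m where "m = e - \<beta> * \<alpha>"
  have m: "MI A m" using MI_cong_mult[OF ideal c\<beta> c\<alpha>] i2 by (simp add: m_def)
  have c\<alpha>\<beta>: "MI A (f - \<alpha> * \<beta>)" using MI_cong_mult[OF ideal c\<alpha> c\<beta>] i2 by simp
  have *: "x * y = 0" if "x * u = x" "v * y = y" "u * v = 0" for x y u v :: "'a unitz fmat"
  proof -
    have "x * y = x * (u * v) * y" using that(1,2) by (metis mult.assoc)
    with that show ?thesis by simp
  qed
  have z: "e * \<alpha> = 0" "\<alpha> * f = 0" "f * \<beta> = 0" "\<beta> * e = 0" "\<alpha> * \<alpha> = 0" "\<beta> * \<beta> = 0"
    by (fact *[OF ee(1) \<alpha>(1) ef(1)] *[OF \<alpha>(2) ee(2) ef(1)] *[OF ee(2) \<beta>(1) ef(2)]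
        *[OF \<beta>(2) ee(1) ef(2)] *[OF \<alpha>(2) \<alpha>(1) ef(1)] *[OF \<beta>(2) \<beta>(1) ef(2)])+
  define r where "r = f + e"
  have r: "r * r = r" "MB C' r" "r * \<alpha> = \<alpha>" "\<alpha> * r = \<alpha>" "r * \<beta> = \<beta>" "\<beta> * r = \<beta>" "r * e = e" "e * r = e"
    using MB_add[OF C'] ee by (simp_all add: r_def distrib_left distrib_right z \<alpha> \<beta> ef)
  \<comment> \<open>Invertible over C' because every factor is unipotent, although \<alpha> and
    \<beta> invert each other only modulo the ideal, with defect \<open>m\<close> on the side of
    \<open>e\<close>. Without defects, \<open>W\<close> would be \<open>\<alpha> - \<beta>\<close>
    and conjugate \<open>e\<close> to \<open>f\<close>.\<close>
  define W where "W = (r + \<alpha>) * (r - \<beta>) * (r + \<alpha>)"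
  define W' where "W' = (r - \<alpha>) * (r + \<beta>) * (r - \<alpha>)"
  have WW: "inv2 C' r r W W'"
  proof -
    have 1: "inv2 C' r r (r + \<alpha>) (r - \<alpha>)" using inv2_unipotent[OF C' r(2,1) MB\<alpha>(1)] r z by simp
    have 2: "inv2 C' r r (r - \<beta>) (r + \<beta>)"
      using inv2_sym[OF inv2_unipotent[OF C' r(2,1) MB\<alpha>(2)]] r z by simp
    show ?thesis using inv2_comp[OF C' 1 inv2_comp[OF C' 2 1]] by (simp add: W_def W'_def mult.assoc)
  qed
  note W1 = inv2D[OF WW]
  have We: "W * e = \<alpha> + (r + \<alpha>) * m"
  proof -
    have "(r - \<beta>) * ((r + \<alpha>) * e) = \<alpha> + m"
      by (simp add: distrib_left distrib_right left_diff_distrib r \<alpha> z m_def)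
    then have "W * e = (r + \<alpha>) * (\<alpha> + m)" by (simp only: W_def mult.assoc)
    then show ?thesis by (simp add: distrib_left distrib_right r z)
  qed
  have eW: "e * W' = \<beta> + m"
  proof -
    have "e * W' = ((e * (r - \<alpha>)) * (r + \<beta>)) * (r - \<alpha>)" by (simp only: W'_def mult.assoc)
    also have "e * (r - \<alpha>) = e" by (simp add: right_diff_distrib r z)
    also have "e * (r + \<beta>) = e + \<beta>" by (simp add: distrib_left r \<beta>)
    also have "(e + \<beta>) * (r - \<alpha>) = \<beta> + m" by (simp add: distrib_right right_diff_distrib r z m_def)
    finally show ?thesis .
  qed
  have cWe: "MI A (W * e - \<alpha>)" and ceW: "MI A (e * W' - \<beta>)"
    using MI_mult(2)[OF ideal m] m by (simp_all add: We eW)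
  define e2 where "e2 = W * e * W'"
  have "e2 = (W * e) * (e * W')" by (simp add: e2_def mult.assoc ee flip: mult.assoc[of e e W'])
  then have "MI A (e2 - \<alpha> * \<beta>)" using MI_cong_mult[OF ideal cWe ceW] by simp
  then have ce2: "MI A (e2 - f)" using MI_cong_trans[OF ideal _ MI_cong_sym[OF ideal c\<alpha>\<beta>]] by blast
  have fA: "MB A f" using pjf by (simp add: prj_def)
  have MBe2: "MB A' e2"
    using MB_of_cong[OF ideal ce2 fA] MB_mult[OF C'] W1 ee unfolding MB_Int e2_def by blast
  have e2W: "e2 * W = W * e"
  proof -
    have "e2 * W = W * (e * (W' * W))" by (simp only: e2_def mult.assoc)
    then show ?thesis by (simp only: W1 r)
  qed
  have "e2 * e2 = (e2 * W) * e * W'" by (simp add: e2_def mult.assoc)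
  also have "\<dots> = W * (e * e) * W'" by (simp only: e2W mult.assoc)
  finally have e2e2: "e2 * e2 = e2" by (simp add: ee e2_def)
  obtain p2 where p2: "MB A' p2" "star p2 = p2" "p2 * p2 = p2" "e2 * p2 = p2" "p2 * e2 = e2"
    using idempotent_projection[OF A' MBe2 e2e2] by metis
  have prp2: "prj A' p2" "prj C' p2" using p2 by (auto simp: prj_def MB_Int)
  define c where "c = W * e"
  \<comment> \<open>\<open>W\<close> conjugates \<open>e\<close> to the idempotent
    \<open>e2\<close>, which has the range of the projection \<open>p2\<close>; the factor
    \<open>p2\<close> makes \<open>c'\<close> inverse to \<open>c\<close> as a morphism from
    \<open>e\<close> to \<open>p2\<close>.\<close>
  define c' where "c' = e * W' * p2"
  have cc: "inv2 C' e p2 c c'"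
  proof -
    have "p2 * c = p2 * (e2 * W)" by (simp only: c_def e2W)
    also have "\<dots> = (p2 * e2) * W" by (simp only: mult.assoc)
    finally have 1: "p2 * c = c" by (simp only: p2 c_def e2W)
    have "c * c' = W * (e * e) * W' * p2" by (simp only: c_def c'_def mult.assoc)
    then have 2: "c * c' = p2" by (simp add: ee p2 flip: e2_def)
    have "c' * c = e * W' * (p2 * c)" by (simp only: c'_def mult.assoc)
    also have "\<dots> = e * (W' * W) * e" by (simp only: 1) (simp only: c_def mult.assoc)
    finally have 3: "c' * c = e" by (simp only: W1 r ee)
    have 4: "c * e = c" "e * c' = c'" "c' * p2 = c'"
      by (simp_all add: c_def c'_def mult.assoc ee p2) (simp add: ee flip: mult.assoc)
    have 5: "MB C' c" "MB C' c'" unfolding c_def c'_def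
      using MB_mult[OF C'] W1 ee prp2 by (auto simp: prj_def)
    show ?thesis unfolding inv2_def using 1 2 3 4 5 by blast
  qed
  define a3 where "a3 = a2 * c'"
  define b3 where "b3 = c * b2"
  have ab3: "inv2 UNIV p2 f a3 b3" unfolding a3_def b3_def
    by (rule inv2_comp[OF U inv2_mono[OF inv2_sym[OF cc]] ab2]) simp
  \<comment> \<open>Modulo the ideal, \<open>a3\<close> is \<open>f * p2\<close> and
    \<open>b3\<close> is \<open>f\<close>, both over the unitization of \<open>A\<close>; this puts
    the transported triple into \<open>Gam A' A\<close>.\<close>
  have fpA: "MB A (f * p2)" using MB_mult[OF A fA] p2 by (auto simp: MB_Int)
  have MI_0': "MI A (y - y)" for y :: "'a unitz fmat" using ideal by simp
  have "MI A (a2 * (e * W') - \<alpha> * \<beta>)" by (rule MI_cong_mult[OF ideal c\<alpha> ceW])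
  then have "MI A (a2 * (e * W') - f)" using MI_cong_trans[OF ideal _ MI_cong_sym[OF ideal c\<alpha>\<beta>]] by blast
  then have "MI A (a2 * (e * W') * p2 - f * p2)" by (rule MI_cong_mult[OF ideal _ MI_0'])
  then have "MI A (a3 - f * p2)" by (simp only: a3_def c'_def mult.assoc)
  then have a3A: "MB A a3" by (rule MB_of_cong[OF ideal _ fpA])
  have "MI A (b3 - \<alpha> * \<beta>)" unfolding b3_def c_def by (rule MI_cong_mult[OF ideal cWe c\<beta>])
  then have "MI A (b3 - f)" using MI_cong_trans[OF ideal _ MI_cong_sym[OF ideal c\<alpha>\<beta>]] by blast
  then have b3A: "MB A b3" by (rule MB_of_cong[OF ideal _ fA])
  have u: "(p2, f, a3) \<in> Gam A' A"
    using prp2 pjf ab3 a3A b3A by (auto simp: Gam_def imor_def inv2_def)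
  have uC: "(p2, f, a3) \<in> Gam C' UNIV" using u by (rule Gam_mono) auto
  have "imor C' e p2 c" using cc by (auto simp: imor_def)
  moreover have "f * a2 = a3 * c"
  proof -
    have "a3 * c = a2 * (c' * c)" by (simp only: a3_def mult.assoc)
    then show ?thesis by (simp only: inv2D[OF cc] i2)
  qed
  ultimately have "isoT C' (e, f, a2) (p2, f, a3)"
    unfolding isoT_def prod.case using imor_id[OF C' pjf(2)] by blast
  then have "eqv C' UNIV (e, f, a2) (p2, f, a3)" by (rule big.isoT_eqv[OF _ G2 uC])
  then have "eqv C' UNIV t (p2, f, a3)" using t_eq eq2 big.eqv_trans by blast
  with u show thesis by (rule that)
qed

end

section \<open>Transfer to finitely supported functions\<close>

definition Uf :: "'a::cstar_algebra unitz fmat \<Rightarrow> 'a umat" where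
  "Uf x = (\<lambda>i j. (scal (ent x i j), vect (ent x i j)))"

definition Ff :: "'a::cstar_algebra umat \<Rightarrow> 'a unitz fmat" where
  "Ff x = Fmat (\<lambda>i j. Unitz (fst (x i j)) (snd (x i j)))"

lemma Uf_zero_iff: "Uf x i j = 0 \<longleftrightarrow> ent x i j = 0"
  by (auto simp: Uf_def zero_prod_def intro: unitz.expand)

lemma supp_in_Uf [simp]: "supp_in N (Uf x) \<longleftrightarrow> supp N x"
  by (simp add: supp_in_def supp_def Uf_zero_iff)

lemma fin_supp_Uf [simp]: "fin_supp (Uf x)"
  by (simp add: fin_supp_def ex_supp)

lemma Uf_inject [simp]: "Uf x = Uf y \<longleftrightarrow> x = y"
  by (auto simp: Uf_def fun_eq_iff intro!: fmat_eqI unitz.expand)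

lemma ent_Ff:
  assumes "fin_supp x"
  shows "ent (Ff x) i j = Unitz (fst (x i j)) (snd (x i j))"
proof -
  obtain N where "supp_in N x" using assms by (auto simp: fin_supp_def)
  then show ?thesis unfolding Ff_def by (subst ent_Fmat[of N]) (auto simp: supp_in_def zero_unitz_def)
qed

lemma Uf_Ff: "fin_supp x \<Longrightarrow> Uf (Ff x) = x"
  by (simp add: Uf_def ent_Ff)

lemma mat_in_Uf [simp]: "mat_in B (Uf x) \<longleftrightarrow> MB B x"
proof -
  have "snd (Uf x i j) = vect (ent x i j)" for i j by (simp add: Uf_def)
  then show ?thesis by (simp add: mat_in_def MB_def)
qed

lemma mat_inE: "mat_in B x \<Longrightarrow> \<exists>y. x = Uf y"
  by (metis mat_in_def Uf_Ff)

lemma madj_Uf [simp]: "madj (Uf x) = Uf (star x)"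
  by (simp add: madj_def Uf_def uadj_def)

lemma supp_mbound: "supp (mbound (Uf x)) x"
proof -
  have "supp_in (mbound (Uf x)) (Uf x)"
    unfolding mbound_def using fin_supp_Uf[of x] unfolding fin_supp_def by (rule LeastI_ex)
  then show ?thesis by simp
qed

lemma mmult_Uf [simp]: "mmult (Uf x) (Uf y) = Uf (x * y)"
proof (intro ext)
  fix i j
  define N where "N = max (mbound (Uf x)) (mbound (Uf y))"
  have "supp N x" using supp_mbound by (rule supp_mono) (simp add: N_def)
  then have "ent (x * y) i j = (\<Sum>k<N. ent x i k * ent y k j)" by (simp add: ent_mult_supp)
  moreover have "mmult (Uf x) (Uf y) i j = (\<Sum>k<N. umult (Uf x i k) (Uf y k j))"
    by (simp add: mmult_def N_def)
  ultimately show "mmult (Uf x) (Uf y) i j = Uf (x * y) i j"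
    by (intro prod_eqI) (simp_all add: Uf_def umult_def fst_sum snd_sum scal_sum vect_sum)
qed

lemma is_proj_Uf [simp]: "is_proj B (Uf p) \<longleftrightarrow> prj B p"
  by (auto simp: is_proj_def prj_def)

lemma inv_morph_Uf:
  assumes "p * p = p" "q * q = q"
  shows "inv_morph B (Uf p) (Uf q) (Uf a) \<longleftrightarrow> imor B p q a"
proof -
  \<comment> \<open>The single equation in \<open>morph\<close> splits into a left and a right one
    because the projections are idempotent.\<close>
  have *: "u * (x * v) = x \<longleftrightarrow> u * x = x \<and> x * v = x" if "u * u = u" "v * v = v"
    for u v x :: "'a unitz fmat"
  proof
    assume x: "u * (x * v) = x"
    have "u * x = (u * u) * (x * v)" by (subst x[symmetric]) (simp only: mult.assoc)
    also have "\<dots> = x" by (simp only: that x)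
    finally have 1: "u * x = x" .
    have "x * v = u * (x * (v * v))" by (subst x[symmetric]) (simp only: mult.assoc)
    also have "\<dots> = x" by (simp only: that x)
    finally show "u * x = x \<and> x * v = x" using 1 by (intro conjI)
  next
    assume "u * x = x \<and> x * v = x"
    then show "u * (x * v) = x" by (simp only:)
  qed
  have m: "morph B (Uf u) (Uf v) (Uf x) \<longleftrightarrow> MB B x \<and> v * x = x \<and> x * u = x"
    if "u * u = u" "v * v = v" for u v x
    unfolding morph_def mat_in_Uf mmult_Uf Uf_inject *[OF that(2,1)] ..
  have ex: "(\<exists>b. morph B (Uf q) (Uf p) b \<and> mmult (Uf a) b = Uf q \<and> mmult b (Uf a) = Uf p)
      \<longleftrightarrow> (\<exists>b. morph B (Uf q) (Uf p) (Uf b) \<and> a * b = q \<and> b * a = p)" (is "?l \<longleftrightarrow> ?r")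
  proof
    assume ?l
    then obtain b where b: "morph B (Uf q) (Uf p) b" "mmult (Uf a) b = Uf q" "mmult b (Uf a) = Uf p" by blast
    obtain b' where b': "b = Uf b'" using mat_inE[of B b] b(1) by (auto simp: morph_def)
    show ?r using b unfolding b' mmult_Uf Uf_inject by (intro exI[of _ b'] conjI)
  next
    assume ?r
    then obtain b where "morph B (Uf q) (Uf p) (Uf b)" "a * b = q" "b * a = p" by blast
    then show ?l by (intro exI[of _ "Uf b"] conjI) (simp_all only: mmult_Uf)
  qed
  show ?thesis
    unfolding inv_morph_def ex m[OF assms] m[OF assms(2,1)] imor_def inv2_def
    by (rule iffI; elim exE conjE; intro exI conjI; assumption)
qed

lemma inv_morphE:
  assumes "inv_morph B p q a"
  shows "\<exists>x. a = Uf x"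
  using assms unfolding inv_morph_def morph_def by (blast dest: mat_inE)

definition UT :: "'a::cstar_algebra mtriple \<Rightarrow> 'a triple" where
  "UT t = (case t of (p, q, a) \<Rightarrow> (Uf p, Uf q, Uf a))"

lemma UT_inject [simp]: "UT t = UT u \<longleftrightarrow> t = u"
  by (auto simp: UT_def split: prod.splits)

lemma Gamma_UT: "Gamma B' B = UT ` Gam B' B"
proof (intro equalityI subsetI)
  fix t assume "t \<in> Gamma B' B"
  then obtain p q a where t: "t = (p, q, a)" "is_proj B' p" "is_proj B' q" "inv_morph B p q a"
    by (auto simp: Gamma_def)
  obtain p' where 1: "p = Uf p'" using t(2) mat_inE[of B' p] by (auto simp: is_proj_def)
  obtain q' where 2: "q = Uf q'" using t(3) mat_inE[of B' q] by (auto simp: is_proj_def)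
  obtain a' where 3: "a = Uf a'" using inv_morphE[OF t(4)] by auto
  note u = 1 2 3
  have "(p', q', a') \<in> Gam B' B"
    using t(2-4) inv_morph_Uf[of p' q'] unfolding u by (auto simp: Gam_def prj_def)
  then show "t \<in> UT ` Gam B' B" by (auto simp: t(1) u UT_def intro!: image_eqI)
next
  fix t assume "t \<in> UT ` Gam B' B"
  then show "t \<in> Gamma B' B"
    by (auto simp: Gamma_def UT_def Gam_def inv_morph_Uf prj_def)
qed

lemma UT_Gamma [simp]: "UT t \<in> Gamma B' B \<longleftrightarrow> t \<in> Gam B' B"
  by (auto simp: Gamma_UT)

lemma iso_triple_UT:
  assumes "t \<in> Gam B' B" "u \<in> Gam B' B"
  shows "iso_triple B' (UT t) (UT u) \<longleftrightarrow> isoT B' t u"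
proof -
  obtain p q a where t: "t = (p, q, a)" by (cases t)
  obtain p' q' a' where u: "u = (p', q', a')" by (cases u)
  have ii: "p * p = p" "q * q = q" "p' * p' = p'" "q' * q' = q'"
    using assms by (auto simp: t u Gam_def prj_def)
  show ?thesis
  proof
    assume "iso_triple B' (UT t) (UT u)"
    then obtain c d where cd: "inv_morph B' (Uf p) (Uf p') c" "inv_morph B' (Uf q) (Uf q') d"
      "mmult d (Uf a) = mmult (Uf a') c" by (auto simp: iso_triple_def UT_def t u)
    obtain c' d' where "c = Uf c'" "d = Uf d'" using cd inv_morphE by metis
    then show "isoT B' t u" using cd ii by (auto simp: isoT_def t u inv_morph_Uf)
  next
    assume "isoT B' t u"
    then obtain c d where "imor B' p p' c" "imor B' q q' d" "d * a = a' * c" by (auto simp: isoT_def t u)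
    then show "iso_triple B' (UT t) (UT u)"
      unfolding iso_triple_def UT_def t u prod.case
      by (intro exI[of _ "Uf c"] exI[of _ "Uf d"]) (simp add: inv_morph_Uf ii)
  qed
qed

text \<open>Entrywise continuity yields norm continuity because invertibles in the corner of
  \<open>p\<close> are supported in the block of \<open>p\<close>, uniformly along the path.\<close>

lemma elementary_UT:
  assumes "t \<in> Gam B' B"
  shows "elementary B (UT t) \<longleftrightarrow> elem B t"
proof -
  obtain p q a where t: "t = (p, q, a)" by (cases t)
  have ii: "p * p = p" using assms by (auto simp: t Gam_def prj_def)
  obtain N where N: "supp N p" using ex_supp by blast
  have "elementary B (UT t) \<longleftrightarrow> p = q \<and> (\<exists>h :: real \<Rightarrow> 'a umat.
      (\<forall>i j. continuous_on {0..1} (\<lambda>s. h s i j)) \<and> h 0 = Uf a \<and> h 1 = Uf p \<and>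
      (\<forall>s\<in>{0..1}. inv_morph B (Uf p) (Uf p) (h s)))" (is "_ \<longleftrightarrow> _ \<and> ?E")
    by (auto simp: elementary_def t UT_def)
  also have "?E \<longleftrightarrow> conn B p a"
  proof
    assume ?E
    then obtain h :: "real \<Rightarrow> 'a umat" where h: "\<And>i j. continuous_on {0..1} (\<lambda>s. h s i j)"
      "h 0 = Uf a" "h 1 = Uf p" "\<And>s. s \<in> {0..1} \<Longrightarrow> inv_morph B (Uf p) (Uf p) (h s)" by blast
    have fs: "fin_supp (h s)" if "s \<in> {0..1}" for s using inv_morphE[OF h(4)[OF that]] by auto
    have im: "imor B p p (Ff (h s))" if "s \<in> {0..1}" for s
      using h(4)[OF that] Uf_Ff[OF fs[OF that]] inv_morph_Uf[OF ii ii] by metis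
    have "continuous_on {0..1} (\<lambda>s. Ff (h s))"
    proof (rule continuous_on_fmat[of _ _ N])
      show "supp N (Ff (h s))" if "s \<in> {0..1}" for s using imor_supp[OF im[OF that] N N] .
      fix i j
      have "continuous_on {0..1} (\<lambda>s. Unitz (fst (h s i j)) (snd (h s i j)))"
        unfolding continuous_on_def
        by (intro ballI tendsto_unitz)
          (use h(1)[of i j] in \<open>auto simp: continuous_on_def intro!: tendsto_fst tendsto_snd\<close>)
      then show "continuous_on {0..1} (\<lambda>s. ent (Ff (h s)) i j)"
        by (rule continuous_on_eq) (simp add: ent_Ff fs)
    qed
    moreover have "Ff (h 0) = a" "Ff (h 1) = p"
      using Uf_Ff[OF fs[of 0]] Uf_Ff[OF fs[of 1]] h(2,3) by simp_all
    ultimately show "conn B p a" unfolding conn_def using im by blast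
  next
    assume "conn B p a"
    then obtain h :: "real \<Rightarrow> 'a unitz fmat" where h: "continuous_on {0..1} h" "h 0 = a" "h 1 = p"
      "\<forall>s\<in>{0..1}. imor B p p (h s)" by (rule connE)
    have "continuous_on {0..1} (\<lambda>s. Uf (h s) i j)" for i j
      unfolding Uf_def
      by (intro continuous_on_Pair bounded_linear.continuous_on[OF bounded_linear_scal]
          bounded_linear.continuous_on[OF bounded_linear_vect] continuous_on_ent h)
    then show ?E using h by (intro exI[of _ "\<lambda>s. Uf (h s)"]) (simp add: inv_morph_Uf ii)
  qed
  finally show ?thesis by (simp add: elem_def t)
qed

lemma suppT_tbound: "suppT (tbound (UT t)) t"
proof -
  obtain p q a where t: "t = (p, q, a)" by (cases t)
  have "\<exists>N. supp N p \<and> supp N q \<and> supp N a" using ex_supp3 by metis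
  then have "supp (LEAST N. supp N p \<and> supp N q \<and> supp N a) p \<and>
      supp (LEAST N. supp N p \<and> supp N q \<and> supp N a) q \<and> supp (LEAST N. supp N p \<and> supp N q \<and> supp N a) a"
    by (rule LeastI_ex)
  then show ?thesis by (simp add: t UT_def tbound_def suppT_def)
qed

lemma dsum_mat_Uf: "supp N x \<Longrightarrow> dsum_mat N (Uf x) (Uf y) = Uf (x + sh N y)"
  by (auto simp: dsum_mat_def Uf_def supp_def fun_eq_iff zero_prod_def not_less not_le)

lemma tsum_UT: "tsum (UT t) (UT u) = UT (t + shT (tbound (UT t)) u)"
  using suppT_tbound[of t] by (cases t; cases u) (auto simp: tsum_def UT_def shT_def suppT_def dsum_mat_Uf)

section \<open>The relation on functions and its classes\<close>

context pair
begin

lemma orth_tsum: "orth t (shT (tbound (UT t)) u)"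
  by (rule orth_shT[OF suppT_tbound order_refl])

text \<open>\<open>K0rel\<close> puts the elementary triples directly after the block given by
  \<open>tbound\<close>, whereas \<open>eqv\<close> admits any orthogonal position; the shift
  isomorphism passes between the two.\<close>

lemma K0rel_UT: "(UT t, UT u) \<in> K0rel B' B \<longleftrightarrow> eqv B' B t u"
proof
  assume "(UT t, UT u) \<in> K0rel B' B"
  then obtain x x' where x: "UT t \<in> Gamma B' B" "UT u \<in> Gamma B' B" "x \<in> Gamma B' B" "x' \<in> Gamma B' B"
    "elementary B x" "elementary B x'" "iso_triple B' (tsum (UT t) x) (tsum (UT u) x')"
    unfolding K0rel_def mem_Collect_eq prod.case by (elim conjE exE)
  obtain e e' where e: "x = UT e" "x' = UT e'" "e \<in> Gam B' B" "e' \<in> Gam B' B"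
    using x(3,4) unfolding Gamma_UT by (elim imageE)
  have G: "t \<in> Gam B' B" "u \<in> Gam B' B" using x(1,2) by (simp_all only: UT_Gamma)
  let ?e = "shT (tbound (UT t)) e" and ?e' = "shT (tbound (UT u)) e'"
  have el: "elem B e" "elem B e'"
    using x(5,6) unfolding e(1,2) elementary_UT[OF e(3)] elementary_UT[OF e(4)] .
  have S: "?e \<in> Gam B' B" "?e' \<in> Gam B' B" by (rule Gam_sh[OF e(3)], rule Gam_sh[OF e(4)])
  have "isoT B' (t + ?e) (u + ?e')"
    using x(7) unfolding e(1,2) tsum_UT
      iso_triple_UT[OF Gam_add[OF G(1) S(1) orth_tsum] Gam_add[OF G(2) S(2) orth_tsum]] .
  then show "eqv B' B t u"
    by (rule eqvI[OF G S elem_sh[OF el(1)] elem_sh[OF el(2)] orth_tsum orth_tsum])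
next
  assume "eqv B' B t u"
  then obtain e e' where e: "e \<in> Gam B' B" "e' \<in> Gam B' B" "elem B e" "elem B e'" "orth t e" "orth u e'"
      "isoT B' (t + e) (u + e')" and tu: "t \<in> Gam B' B" "u \<in> Gam B' B"
    by (auto simp: eqv_def)
  let ?e = "shT (tbound (UT t)) e" and ?e' = "shT (tbound (UT u)) e'"
  have S: "?e \<in> Gam B' B" "?e' \<in> Gam B' B" by (rule Gam_sh[OF e(1)], rule Gam_sh[OF e(2)])
  have T: "t + ?e \<in> Gam B' B" "u + ?e' \<in> Gam B' B"
    by (rule Gam_add[OF tu(1) S(1) orth_tsum], rule Gam_add[OF tu(2) S(2) orth_tsum])
  have "isoT B' ?e e" by (rule isoT_sym[OF isoT_shT[OF e(1)] e(1) S(1)])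
  then have 1: "isoT B' (t + ?e) (t + e)"
    by (rule isoT_add[OF isoT_refl[OF tu(1)] _ orth_tsum e(5) tu(1) tu(1) S(1) e(1)])
  have 2: "isoT B' (u + e') (u + ?e')"
    by (rule isoT_add[OF isoT_refl[OF tu(2)] isoT_shT[OF e(2)] e(6) orth_tsum tu(2) tu(2) e(2) S(2)])
  have "iso_triple B' (tsum (UT t) (UT e)) (tsum (UT u) (UT e'))"
    unfolding tsum_UT iso_triple_UT[OF T] by (rule isoT_trans[OF isoT_trans[OF 1 e(7)] 2])
  moreover have "elementary B (UT e)" "elementary B (UT e')"
    unfolding elementary_UT[OF e(1)] elementary_UT[OF e(2)] by (rule e(3), rule e(4))
  ultimately show "(UT t, UT u) \<in> K0rel B' B"
    unfolding K0rel_def mem_Collect_eq prod.case using tu e(1,2)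
    by (intro conjI exI[of _ "UT e"] exI[of _ "UT e'"]) (simp_all only: UT_Gamma)
qed

lemma K0rel_subset: "K0rel B' B \<subseteq> Gamma B' B \<times> Gamma B' B"
  by (auto simp: K0rel_def)

lemma K0relE:
  assumes "(x, y) \<in> K0rel B' B"
  obtains t u where "x = UT t" "y = UT u" "eqv B' B t u"
proof -
  have "x \<in> UT ` Gam B' B" "y \<in> UT ` Gam B' B"
    using assms K0rel_subset unfolding Gamma_UT by blast+
  then obtain t u where "x = UT t" "y = UT u" by (elim imageE)
  moreover from this have "eqv B' B t u" using assms K0rel_UT by (simp only:)
  ultimately show thesis by (rule that)
qed

lemma equiv_K0rel: "equiv (Gamma B' B) (K0rel B' B)"
proof (rule equivI)
  show "K0rel B' B \<subseteq> Gamma B' B \<times> Gamma B' B" by (rule K0rel_subset)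
  show "refl_on (Gamma B' B) (K0rel B' B)"
    using eqv_refl by (auto simp: refl_on_def Gamma_UT K0rel_UT)
  show "sym (K0rel B' B)"
  proof (rule symI)
    fix x y assume "(x, y) \<in> K0rel B' B"
    then show "(y, x) \<in> K0rel B' B" by (rule K0relE) (simp only: K0rel_UT eqv_sym)
  qed
  show "trans (K0rel B' B)"
  proof (rule transI)
    fix x y z assume xy: "(x, y) \<in> K0rel B' B" and yz: "(y, z) \<in> K0rel B' B"
    obtain t u where 1: "x = UT t" "y = UT u" "eqv B' B t u" using xy by (rule K0relE)
    obtain u' v where 2: "y = UT u'" "z = UT v" "eqv B' B u' v" using yz by (rule K0relE)
    have "u = u'" using 1(2) 2(1) by (simp only: UT_inject)
    then have "eqv B' B t v" using 1(3) 2(3) by (auto intro: eqv_trans)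
    then show "(x, z) \<in> K0rel B' B" by (simp only: 1(1) 2(2) K0rel_UT)
  qed
qed

lemma tsum_closed:
  assumes "x \<in> Gamma B' B" "y \<in> Gamma B' B"
  shows "tsum x y \<in> Gamma B' B"
proof -
  obtain t u where "x = UT t" "y = UT u" "t \<in> Gam B' B" "u \<in> Gam B' B"
    using assms unfolding Gamma_UT by (elim imageE)
  then show ?thesis using Gam_add[OF _ Gam_sh orth_tsum] by (simp only: tsum_UT UT_Gamma)
qed

lemma tsum_cong:
  assumes "(x, x') \<in> K0rel B' B" "(y, y') \<in> K0rel B' B"
  shows "(tsum x y, tsum x' y') \<in> K0rel B' B"
proof -
  obtain t t' where 1: "x = UT t" "x' = UT t'" and t: "eqv B' B t t'" using assms(1) by (rule K0relE)
  obtain u u' where 2: "y = UT u" "y' = UT u'" and u: "eqv B' B u u'" using assms(2) by (rule K0relE)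
  have "eqv B' B (shT N u) (shT M u')" for N M
    using eqv_trans[OF eqv_sym[OF eqv_shT] eqv_trans[OF u eqv_shT]] eqv_Gam[OF u] by blast
  then show ?thesis unfolding 1 2 tsum_UT K0rel_UT using t orth_tsum by (intro eqv_add)
qed

lemma some_class:
  assumes "X \<in> Gamma B' B // K0rel B' B"
  shows "(SOME x. x \<in> X) \<in> Gamma B' B" "X = K0rel B' B `` {SOME x. x \<in> X}"
proof -
  have "X \<noteq> {}" using in_quotient_imp_non_empty[OF equiv_K0rel assms] .
  then have x: "(SOME x. x \<in> X) \<in> X" by (rule some_in_eq[THEN iffD2])
  then show "(SOME x. x \<in> X) \<in> Gamma B' B" using in_quotient_imp_subset[OF equiv_K0rel assms] by blast
  obtain y where y: "X = K0rel B' B `` {y}" using assms by (rule quotientE)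
  then have "(y, SOME x. x \<in> X) \<in> K0rel B' B" using x by blast
  then show "X = K0rel B' B `` {SOME x. x \<in> X}" unfolding y[symmetric]
    using equiv_class_eq[OF equiv_K0rel] y by blast
qed

text \<open>\<open>K0\<close> and \<open>incl_star\<close> pick representatives by
  \<open>SOME\<close>; relating the pick to a given representative is what makes both independent of
  the choice.\<close>

lemma some_class_rel:
  assumes "x \<in> Gamma B' B"
  shows "(x, SOME y. y \<in> K0rel B' B `` {x}) \<in> K0rel B' B"
proof -
  have "x \<in> K0rel B' B `` {x}" by (rule equiv_class_self[OF equiv_K0rel assms])
  then show ?thesis by (metis Image_singleton_iff someI_ex)
qed

lemma class_eq_iff:
  "x \<in> Gamma B' B \<Longrightarrow> y \<in> Gamma B' B \<Longrightarrow> K0rel B' B `` {x} = K0rel B' B `` {y} \<longleftrightarrow> (x, y) \<in> K0rel B' B"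
  by (rule eq_equiv_class_iff[OF equiv_K0rel])

end

section \<open>The induced map on classes\<close>

context excision
begin

lemma Gamma_incl: "x \<in> Gamma A' A \<Longrightarrow> x \<in> Gamma C' UNIV"
  unfolding Gamma_UT by (auto intro!: imageI elim!: Gam_mono)

lemma K0rel_incl: "(x, y) \<in> K0rel A' A \<Longrightarrow> (x, y) \<in> K0rel C' UNIV"
proof -
  assume "(x, y) \<in> K0rel A' A"
  then obtain t u where 1: "x = UT t" "y = UT u" "eqv A' A t u" by (rule small.K0relE)
  have "eqv C' UNIV t u" using 1(3) by (rule eqv_mono) auto
  then show ?thesis by (simp only: 1 big.K0rel_UT)
qed

lemma incl_star_class:
  assumes "x \<in> Gamma A' A"
  shows "incl_star C' UNIV (K0rel A' A `` {x}) = K0rel C' UNIV `` {x}"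
  unfolding incl_star_def
  using equiv_class_eq[OF big.equiv_K0rel K0rel_incl[OF small.some_class_rel[OF assms]]] by simp

theorem incl_star_iso: "incl_star C' UNIV \<in> iso (K0 A' A) (K0 C' UNIV)"
proof -
  have carr: "carrier (K0 A' A) = Gamma A' A // K0rel A' A"
    "carrier (K0 C' UNIV) = Gamma C' UNIV // K0rel C' UNIV" by (simp_all add: K0_def)
  have rep: "\<exists>x\<in>Gamma A' A. X = K0rel A' A `` {x}" if "X \<in> carrier (K0 A' A)" for X
    using small.some_class that unfolding carr by blast
  have multA: "K0rel A' A `` {x} \<otimes>\<^bsub>K0 A' A\<^esub> K0rel A' A `` {y} = K0rel A' A `` {tsum x y}"
    if "x \<in> Gamma A' A" "y \<in> Gamma A' A" for x y
    unfolding K0_def monoid.simps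
    by (rule equiv_class_eq[OF small.equiv_K0rel, symmetric])
      (intro small.tsum_cong small.some_class_rel that)
  have multC: "K0rel C' UNIV `` {x} \<otimes>\<^bsub>K0 C' UNIV\<^esub> K0rel C' UNIV `` {y} = K0rel C' UNIV `` {tsum x y}"
    if "x \<in> Gamma C' UNIV" "y \<in> Gamma C' UNIV" for x y
    unfolding K0_def monoid.simps
    by (rule equiv_class_eq[OF big.equiv_K0rel, symmetric])
      (intro big.tsum_cong big.some_class_rel that)
  have "incl_star C' UNIV \<in> hom (K0 A' A) (K0 C' UNIV)"
  proof (rule homI)
    fix X assume "X \<in> carrier (K0 A' A)"
    then show "incl_star C' UNIV X \<in> carrier (K0 C' UNIV)"
      using rep[of X] by (auto simp: incl_star_class carr quotientI Gamma_incl)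
  next
    fix X Y assume "X \<in> carrier (K0 A' A)" "Y \<in> carrier (K0 A' A)"
    then obtain x y where "x \<in> Gamma A' A" "X = K0rel A' A `` {x}" "y \<in> Gamma A' A" "Y = K0rel A' A `` {y}"
      using rep by meson
    then show "incl_star C' UNIV (X \<otimes>\<^bsub>K0 A' A\<^esub> Y) = incl_star C' UNIV X \<otimes>\<^bsub>K0 C' UNIV\<^esub> incl_star C' UNIV Y"
      by (simp add: multA multC incl_star_class small.tsum_closed Gamma_incl)
  qed
  moreover have "inj_on (incl_star C' UNIV) (carrier (K0 A' A))"
  proof (rule inj_onI)
    fix X Y assume XY: "X \<in> carrier (K0 A' A)" "Y \<in> carrier (K0 A' A)"
      and eq: "incl_star C' UNIV X = incl_star C' UNIV Y"
    then obtain x y where x: "x \<in> Gamma A' A" "X = K0rel A' A `` {x}" and y: "y \<in> Gamma A' A" "Y = K0rel A' A `` {y}"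
      using rep by meson
    have "(x, y) \<in> K0rel C' UNIV" using eq x y by (simp add: incl_star_class big.class_eq_iff Gamma_incl)
    moreover obtain t u where "x = UT t" "y = UT u" "t \<in> Gam A' A" "u \<in> Gam A' A"
      using x y by (auto simp: Gamma_UT)
    ultimately have "(x, y) \<in> K0rel A' A" using injective by (simp add: small.K0rel_UT big.K0rel_UT)
    then show "X = Y" using x y by (simp add: small.class_eq_iff)
  qed
  moreover have "incl_star C' UNIV ` carrier (K0 A' A) = carrier (K0 C' UNIV)"
  proof (intro equalityI subsetI)
    fix Z assume "Z \<in> incl_star C' UNIV ` carrier (K0 A' A)"
    then show "Z \<in> carrier (K0 C' UNIV)"
      using rep by (force simp: incl_star_class carr quotientI Gamma_incl)
  next
    fix Z assume "Z \<in> carrier (K0 C' UNIV)"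
    then obtain z where z: "z \<in> Gamma C' UNIV" "Z = K0rel C' UNIV `` {z}"
      unfolding carr by (auto elim: quotientE)
    then obtain t where t: "z = UT t" "t \<in> Gam C' UNIV" by (auto simp: Gamma_UT)
    obtain u where u: "u \<in> Gam A' A" "eqv C' UNIV t u" using surjective[OF t(2)] .
    have "(z, UT u) \<in> K0rel C' UNIV" using u by (simp add: t big.K0rel_UT)
    then have "Z = incl_star C' UNIV (K0rel A' A `` {UT u})"
      using u z equiv_class_eq[OF big.equiv_K0rel] by (simp add: incl_star_class)
    then show "Z \<in> incl_star C' UNIV ` carrier (K0 A' A)"
      using u unfolding carr by (auto intro!: imageI quotientI)
  qed
  ultimately show ?thesis by (simp add: iso_def bij_betw_def)
qed

end

theorem theorem2p70:
  fixes A A' C' :: "'a::cstar_algebra set"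
    and \<rho> :: "'a \<Rightarrow> 'd::cstar_algebra"
  assumes "closed_ideal A"
    and "cstar_subalgebra C'"
    and "star_hom \<rho>"
    and "surj \<rho>"
    and "{x. \<rho> x = 0} = A"
    and "\<rho> ` C' = UNIV"
    and "A' = A \<inter> C'"
  shows "incl_star C' (UNIV :: 'a set) \<in> iso (K0 A' A) (K0 C' UNIV)"
proof -
  have \<rho>: "\<rho> (x + y) = \<rho> x + \<rho> y" "\<rho> (scaleC c x) = scaleC c (\<rho> x)" "\<rho> (adj x) = adj (\<rho> x)" for x y c
    using assms(3) by (auto simp: star_hom_def)
  have \<rho>_diff: "\<rho> (x - y) = \<rho> x - \<rho> y" for x y
    using \<rho>(1)[of "x - y" y] by (simp add: eq_diff_eq)
  have A: "x \<in> A \<longleftrightarrow> \<rho> x = 0" for x using assms(5) by blast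
  interpret excision A C'
  proof
    show "closed_ideal A" "cstar_subalgebra C'" by fact+
    \<comment> \<open>As the kernel of a star homomorphism, \<open>A\<close> is closed under
      \<open>adj\<close>.\<close>
    show "cstar_subalgebra A"
      using assms(1) by (auto simp: cstar_subalgebra_def closed_ideal_def A \<rho>(3))
    show "\<exists>x\<in>C'. z - x \<in> A" for z
    proof -
      obtain x where "x \<in> C'" "\<rho> x = \<rho> z" using assms(6) by (metis UNIV_I imageE)
      then show ?thesis by (intro bexI[of _ x]) (auto simp: A \<rho>_diff)
    qed
  qed
  show ?thesis using incl_star_iso by (simp only: assms(7))
qed


end
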